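(* Let $D$ be an integrally closed domain which is not a field, with quotient field $K$, let $\overline{K}$ be an algebraic closure of $K$ and $\overline{D}$ the integral closure of $D$ in $\overline{K}$. Let $p\in D[X]$ be a monic non-constant polynomial, and let $p(X)=\prod_{i=1}^{k}p_i(X)^{e_i}$ be its unique factorization into powers of (distinct) monic irreducible polynomials $p_i\in D[X]$, $e_i\geq 1$. Then $D(p)$ is integrally closed if and only if the following conditions are all satisfied: (i) $p(X)$ is square-free, i.e. $e_i=1$ for all $i$; (ii) for each $i=1,\ldots,k$, $D[X]/(p_i(X))\cong D_{K_i}$ (via the canonical embedding $D[X]/(p_i(X))\hookrightarrow K_i$), where $D_{K_i}$ is the integral closure of $D$ in the field $K_i=K[X]/(p_i(X))$; (iii) $\mathrm{Res}(p_i,p_j)\in D^*$ for each $i\neq j$. Moreover, if $D$ is a Prüfer domain, then $D(p)$ is integrally closed if and only if $D(p)$ is a Prüfer domain, and in that case $D(p)=\mathrm{Int}_K(\Omega_p,\overline{D})$.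
   Context: For a monic non-constant $p\in D[X]$, $D(p)=D[X]+p(X)K[X]=\{r+pq : r\in D[X],\ q\in K[X]\}$. $\Omega_p$ is the (multi-)set of roots of $p$ in $\overline{K}$, and $\mathrm{Int}_K(\Omega_p,\overline{D})=\{f\in K[X] : f(\alpha)\in\overline{D}\text{ for all }\alpha\in\Omega_p\}$. $\mathrm{Res}$ denotes the resultant and $D^*$ the group of units of $D$. Over an integrally closed domain $D$, every monic polynomial in $D[X]$ factors uniquely into monic irreducible polynomials of $D[X]$, and a monic irreducible polynomial of $D[X]$ is irreducible in $K[X]$, so each $K_i$ is a field. *)

theory Defs
  imports
    "HOL-Algebra.Algebraic_Closure_Type"
    "HOL-Algebra.QuotRing"
    "HOL-Algebra.Generated_Groups"
    "Subresultants.Resultant_Prelim"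
begin

text \<open>
  Conventions. The domain \<open>D\<close> is a type \<open>'d :: idom\<close>, its quotient field \<open>K\<close> is the type
  \<open>'d fract\<close>, and \<open>to_fract\<close> is the embedding of a domain into its quotient field. Rings that
  occur as subrings of a field, and quotient rings, are treated with HOL-Algebra;
  \<open>ring_of_type_algebra\<close> turns a type of class \<open>ring_1\<close> into a HOL-Algebra ring. The ring
  \<open>D(p)\<close> is a subset of \<open>K[X] = 'd fract poly\<close>; as a subring of a field it is viewed inside
  \<open>K(X) = 'd fract poly fract\<close>, again via \<open>to_fract\<close>.
\<close>

definition integral_closure :: "('a, 'b) ring_scheme \<Rightarrow> 'a set \<Rightarrow> 'a set" where
  "integral_closure S R = {x \<in> carrier S. \<exists>(n::nat) a. (\<forall>i<n. a i \<in> R) \<and>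
     x [^]\<^bsub>S\<^esub> n \<oplus>\<^bsub>S\<^esub> (\<Oplus>\<^bsub>S\<^esub>i\<in>{..<n}. a i \<otimes>\<^bsub>S\<^esub> x [^]\<^bsub>S\<^esub> i) = \<zero>\<^bsub>S\<^esub>}"

definition quot_field_in :: "('a, 'b) ring_scheme \<Rightarrow> 'a set \<Rightarrow> 'a set" where
  "quot_field_in L R = {a \<otimes>\<^bsub>L\<^esub> inv\<^bsub>L\<^esub> b | a b. a \<in> R \<and> b \<in> R \<and> b \<noteq> \<zero>\<^bsub>L\<^esub>}"

text \<open>
  A subring of a field \<open>L\<close> is integrally closed if it is integrally closed in its own quotient
  field (which may be smaller than \<open>L\<close>).
\<close>

definition integrally_closed_domain :: "('a, 'b) ring_scheme \<Rightarrow> 'a set \<Rightarrow> bool" where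
  "integrally_closed_domain L R \<longleftrightarrow>
     subdomain R L \<and> integral_closure (L\<lparr>carrier := quot_field_in L R\<rparr>) R = R"

text \<open>The product \<open>IJ\<close>: finite sums of products \<open>xy\<close> with \<open>x \<in> I\<close> and \<open>y \<in> J\<close>.\<close>

definition fractional_prod :: "('a, 'b) ring_scheme \<Rightarrow> 'a set \<Rightarrow> 'a set \<Rightarrow> 'a set" where
  "fractional_prod L I J = generate (add_monoid L) (I <#>\<^bsub>L\<^esub> J)"

definition fractional_inverse :: "('a, 'b) ring_scheme \<Rightarrow> 'a set \<Rightarrow> 'a set \<Rightarrow> 'a set" where
  "fractional_inverse L R I = {x \<in> quot_field_in L R. \<forall>y\<in>I. x \<otimes>\<^bsub>L\<^esub> y \<in> R}"

definition pruefer_domain :: "('a, 'b) ring_scheme \<Rightarrow> 'a set \<Rightarrow> bool" where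
  "pruefer_domain L R \<longleftrightarrow> subdomain R L \<and>
     (\<forall>A. finite A \<and> A \<subseteq> R \<longrightarrow>
        (let I = genideal (L\<lparr>carrier := R\<rparr>) A
         in I \<noteq> {\<zero>\<^bsub>L\<^esub>} \<longrightarrow> fractional_prod L I (fractional_inverse L R I) = R))"

definition D_ring :: "'d::idom poly \<Rightarrow> 'd fract poly set" where
  "D_ring p = {fract_poly r + fract_poly p * q | r q. True}"

text \<open>
  \<open>\<iota>\<close> makes the algebraically closed field \<open>'c\<close> an algebraic closure of the field \<open>'k\<close>.
\<close>

definition is_algebraic_closure :: "('k::field \<Rightarrow> 'c::alg_closed_field) \<Rightarrow> bool" where
  "is_algebraic_closure \<iota> \<longleftrightarrow>
     field_hom \<iota> \<and>
     (\<forall>x. \<exists>f. f \<noteq> 0 \<and> poly (map_poly \<iota> f) x = 0)"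

definition D_bar :: "('d::idom fract \<Rightarrow> 'c::field) \<Rightarrow> 'c set" where
  "D_bar \<iota> = integral_closure ring_of_type_algebra (range (\<lambda>d. \<iota> (to_fract d)))"

definition Omega :: "('d::idom fract \<Rightarrow> 'c::field) \<Rightarrow> 'd poly \<Rightarrow> 'c multiset" where
  "Omega \<iota> p = proots (map_poly \<iota> (fract_poly p))"

definition Int_K :: "('k::field \<Rightarrow> 'c::field) \<Rightarrow> 'c multiset \<Rightarrow> 'c set \<Rightarrow> 'k poly set" where
  "Int_K \<iota> \<Omega> B = {f. \<forall>\<alpha>\<in>#\<Omega>. poly (map_poly \<iota> f) \<alpha> \<in> B}"

definition D_quot :: "'d::idom poly \<Rightarrow> 'd poly set ring" where
  "D_quot p = ring_of_type_algebra Quot (PIdl\<^bsub>ring_of_type_algebra\<^esub> p)"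

definition K_quot :: "'d::idom poly \<Rightarrow> 'd fract poly set ring" where
  "K_quot p = ring_of_type_algebra Quot (PIdl\<^bsub>ring_of_type_algebra\<^esub> (fract_poly p))"

definition K_class :: "'d::idom poly \<Rightarrow> 'd fract poly \<Rightarrow> 'd fract poly set" where
  "K_class p f =
     (PIdl\<^bsub>ring_of_type_algebra\<^esub> (fract_poly p)) +>\<^bsub>ring_of_type_algebra\<^esub> f"

text \<open>
  The canonical map \<open>D[X]/(p) \<rightarrow> K[X]/(p)\<close>: all elements of a class \<open>C\<close> modulo \<open>p\<close> in \<open>D[X]\<close>
  lie in the same class modulo \<open>p\<close> in \<open>K[X]\<close>, which \<open>the_elem\<close> extracts.
\<close>

definition canonical_map :: "'d::idom poly \<Rightarrow> 'd poly set \<Rightarrow> 'd fract poly set" where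
  "canonical_map p C = the_elem ((\<lambda>f. K_class p (fract_poly f)) ` C)"

definition D_int_closure_quot :: "'d::idom poly \<Rightarrow> 'd fract poly set ring" where
  "D_int_closure_quot p =
     (K_quot p)\<lparr>carrier :=
        integral_closure (K_quot p) (range (\<lambda>d. K_class p [:to_fract d:]))\<rparr>"

end

theory Submission
  imports Defs "Jordan_Normal_Form.Char_Poly"
begin

text \<open>
  Write \<open>V(p)\<close> for the set of all \<open>f \<in> K[X]\<close> whose values at the roots of \<open>p\<close> are integral over
  \<open>D\<close>. The whole theorem rests on one identification: \<open>V(p)\<close> is the integral closure of \<open>D(p)\<close>, so
  \<open>D(p)\<close> is integrally closed if and only if \<open>V(p) \<subseteq> D(p)\<close>. Indeed an element of \<open>K(X)\<close> integral over
  \<open>D(p)\<close> is a polynomial \<open>f\<close>, since \<open>K[X]\<close> is integrally closed; evaluating its equation at a root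
  \<open>\<alpha>\<close> of \<open>p\<close> kills the multiples of \<open>p\<close> in the coefficients, so \<open>f(\<alpha>)\<close> is integral over \<open>D[\<alpha>]\<close>
  and hence over \<open>D\<close>. Conversely, the product \<open>G\<close> of monic equations of the values \<open>f(\<alpha>)\<close> satisfies
  \<open>p dvd G(f)\<close>, and \<open>pK[X] \<subseteq> D(p)\<close> turns \<open>G(f) = pq\<close> into an integral equation of \<open>f\<close> over \<open>D(p)\<close>
  (\<open>integral_closure_D_ring\<close>, \<open>D_ring_integrally_closed_iff\<close>). This also yields the final claim
  \<open>D(p) = Int_K(\<Omega>_p, D_bar)\<close>.

  The three conditions are then read off from \<open>V(p) \<subseteq> D(p)\<close>.
  \<^item> If \<open>P^2 dvd p\<close>, then \<open>(p/P)/d\<close> vanishes at all roots of \<open>p\<close> for each nonzero \<open>d \<in> D\<close>; were it in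
    \<open>D(p)\<close>, comparing leading coefficients would make \<open>d\<close> a unit (\<open>square_factor_imp_units\<close>).
  \<^item> For a product of distinct irreducible \<open>P_i\<close>, idempotents of \<open>K[X]/(p)\<close> lie in \<open>V(p)\<close>. If they lie in
    \<open>D(p)\<close>, the \<open>P_i\<close> are comaximal already in \<open>D[X]\<close> and every \<open>V(P_i)\<close> is contained in \<open>D(P_i)\<close>;
    the Chinese remainder theorem in \<open>D[X]\<close> gives the converse. Comaximality of monic polynomials is
    invertibility of the Sylvester matrix, that is, the resultant is a unit. That the \<open>P_i\<close> stay
    irreducible, hence comaximal, in \<open>K[X]\<close> is where \<open>D\<close> integrally closed enters.
  \<^item> The integral closure of \<open>D\<close> in \<open>K[X]/(P_i)\<close> consists of the classes of \<open>V(P_i)\<close>, so the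
    isomorphism condition says exactly \<open>V(P_i) \<subseteq> D(P_i)\<close> (\<open>canonical_map_iso_iff\<close>).

  Pruefer domains are handled by an elementwise criterion: all pairs \<open>a, b\<close> admit \<open>s + t = 1\<close> with
  \<open>s a \<in> (b)\<close> and \<open>t b \<in> (a)\<close> (\<open>pruefer_domain_iff_pairs\<close>). It implies integral closedness directly.
  For the other direction let \<open>a, b\<close> be coprime in \<open>K[X]\<close>, which can be assumed because the criterion is
  homogeneous in the pair. At a root \<open>\<alpha>\<close> of \<open>P_i\<close> the ratio \<open>y = a(\<alpha>)/b(\<alpha>)\<close> satisfies polynomial
  equations over \<open>D\<close> whose coefficients can be made comaximal since \<open>D\<close> is Pruefer, and their Horner
  partial sums are integral and provide the relations for \<open>y\<close> (\<open>pruefer_relations_at_element\<close>). The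
  Chinese remainder theorem lifts the relations to congruences modulo \<open>p\<close> over \<open>D[X]\<close>, and adding suitable
  multiples of \<open>p\<close>, which remain in \<open>D(p)\<close>, makes them equalities (\<open>correct_relations_mod\<close>).
\<close>

section \<open>Integral elements of a field over a subdomain\<close>

lemma monic_poly_with_coeffs:
  fixes a :: "nat \<Rightarrow> 'a::comm_ring_1"
  shows "\<exists>f. Polynomial.lead_coeff f = 1 \<and> Polynomial.degree f = n \<and>
    (\<forall>i<n. Polynomial.coeff f i = a i)"
proof -
  define f where "f = Polynomial.monom 1 n + (\<Sum>i<n. Polynomial.monom (a i) i)"
  have c: "Polynomial.coeff f j = (if j = n then 1 else if j < n then a j else 0)" for j
    unfolding f_def by (auto simp: coeff_sum)
  have "Polynomial.degree f = n"
    by (rule antisym[OF degree_le le_degree]) (auto simp: c)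
  then show ?thesis by (intro exI[of _ f]) (simp add: c)
qed

text \<open>
  A domain is a type and enters a field through an embedding \<open>\<phi>\<close>; its image is the base ring. This
  covers both \<open>D\<close> in its quotient field and \<open>D\<close> in the algebraic closure of that field.
\<close>

locale domain_in_field = inj_idom_hom \<phi> for \<phi> :: "'d::idom \<Rightarrow> 'c::field"
begin

sublocale M: Modules.module "\<lambda>r x. \<phi> r * x"
  by unfold_locales (auto simp: algebra_simps hom_distribs)

definition integral :: "'c \<Rightarrow> bool" where
  "integral x \<longleftrightarrow> (\<exists>f. Polynomial.lead_coeff f = 1 \<and> poly (map_poly \<phi> f) x = 0)"

text \<open>
  Subrings that are finitely generated as modules over the base ring; the subring itself need not be a
  finite set. Integrality is closed under ring operations and transitive because such subrings can be
  enlarged by any element that is integral over them.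
\<close>

definition module_finite_subring :: "'c set \<Rightarrow> bool" where
  "module_finite_subring R \<longleftrightarrow>
     (\<exists>S. finite S \<and> R = M.span S) \<and> 1 \<in> R \<and> (\<forall>x\<in>R. \<forall>y\<in>R. x * y \<in> R)"

lemma poly_map_monic:
  assumes "Polynomial.lead_coeff f = 1"
  shows "poly (map_poly \<phi> f) x =
    x ^ Polynomial.degree f + (\<Sum>i<Polynomial.degree f. \<phi> (Polynomial.coeff f i) * x ^ i)"
proof -
  have "poly (map_poly \<phi> f) x = (\<Sum>i\<le>Polynomial.degree f. \<phi> (Polynomial.coeff f i) * x ^ i)"
    by (simp add: poly_altdef)
  also have "{..Polynomial.degree f} = insert (Polynomial.degree f) {..<Polynomial.degree f}"
    by auto
  finally show ?thesis using assms by simp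
qed

lemma integral_iff_equation:
  "integral x \<longleftrightarrow> (\<exists>(n::nat) a. x ^ n + (\<Sum>i<n. \<phi> (a i) * x ^ i) = 0)"
proof
  assume "integral x"
  then obtain f where f: "Polynomial.lead_coeff f = 1" "poly (map_poly \<phi> f) x = 0"
    unfolding integral_def by blast
  from f(2) show "\<exists>(n::nat) a. x ^ n + (\<Sum>i<n. \<phi> (a i) * x ^ i) = 0"
    unfolding poly_map_monic[OF f(1)] by blast
next
  assume "\<exists>(n::nat) a. x ^ n + (\<Sum>i<n. \<phi> (a i) * x ^ i) = 0"
  then obtain n :: nat and a where eq: "x ^ n + (\<Sum>i<n. \<phi> (a i) * x ^ i) = 0" by blast
  obtain f where f: "Polynomial.lead_coeff f = 1" "Polynomial.degree f = n"
      "\<And>i. i < n \<Longrightarrow> Polynomial.coeff f i = a i"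
    using monic_poly_with_coeffs by blast
  then have "poly (map_poly \<phi> f) x = 0" using eq by (simp add: poly_map_monic)
  with f(1) show "integral x" unfolding integral_def by blast
qed

text \<open>
  The determinant trick: a multiplication that maps the span of finitely many elements into itself is
  given on the generators by a matrix over the base ring. The vector of generators is an eigenvector for
  the eigenvalue \<open>x\<close>, so \<open>x\<close> is a root of the characteristic polynomial, which is monic. The span has to
  contain \<open>1\<close> only to make that vector nonzero.
\<close>

lemma integral_if_multiplication_stable:
  assumes fin: "finite S" and one: "1 \<in> M.span S"
    and stable: "\<And>s. s \<in> S \<Longrightarrow> x * s \<in> M.span S"
  shows "integral x"
proof -
  obtain s where s: "bij_betw s {0..<card S} S"
    using ex_bij_betw_nat_finite[OF fin] by blast
  define n where "n = card S"
  have "\<exists>a. x * t = (\<Sum>j<n. \<phi> (a j) * s j)" if "t \<in> S" for t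
  proof -
    from stable[OF that] obtain u where "x * t = (\<Sum>v\<in>S. \<phi> (u v) * v)"
      unfolding M.span_finite[OF fin] by auto
    also have "\<dots> = (\<Sum>j\<in>{0..<n}. \<phi> (u (s j)) * s j)"
      using sum.reindex_bij_betw[OF s, of "\<lambda>v. \<phi> (u v) * v"] by (simp add: n_def)
    finally show ?thesis by (auto simp: atLeast0LessThan intro!: exI[of _ "\<lambda>j. u (s j)"])
  qed
  moreover have "s i \<in> S" if "i < n" for i
    using bij_betwE[OF s] that by (auto simp: n_def)
  ultimately have "\<forall>i<n. \<exists>a. x * s i = (\<Sum>j<n. \<phi> (a j) * s j)"
    by blast
  then obtain a where a: "\<And>i. i < n \<Longrightarrow> x * s i = (\<Sum>j<n. \<phi> (a i j) * s j)"
    by metis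
  define A where "A = mat n n (\<lambda>(i,j). a i j)"
  have A: "A \<in> carrier_mat n n" by (simp add: A_def)
  define v where "v = vec n s"
  have "v \<noteq> 0\<^sub>v n"
  proof
    assume 0: "v = 0\<^sub>v n"
    have "s i = 0" if "i < n" for i
      using arg_cong[OF 0, of "\<lambda>w. vec_index w i"] that by (simp add: v_def)
    then have "S \<subseteq> {0}" using s unfolding bij_betw_def n_def by auto
    then have "M.span S \<subseteq> {0}" by (rule M.span_minimal) (rule M.subspace_single_0)
    with one show False by auto
  qed
  moreover have "map_mat \<phi> A *\<^sub>v v = x \<cdot>\<^sub>v v"
    by (rule eq_vecI) (auto simp: A_def v_def scalar_prod_def a atLeast0LessThan)
  ultimately have "eigenvector (map_mat \<phi> A) v x"
    unfolding eigenvector_def using A by (auto simp: v_def)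
  then have "eigenvalue (map_mat \<phi> A) x" unfolding eigenvalue_def by blast
  then have "poly (char_poly (map_mat \<phi> A)) x = 0"
    using eigenvalue_root_char_poly[of "map_mat \<phi> A" n] A by auto
  then have "poly (map_poly \<phi> (char_poly A)) x = 0"
    using char_poly_hom[OF A] by simp
  then show ?thesis
    unfolding integral_def using degree_monic_char_poly[OF A] by auto
qed

lemma module_finite_subring_imp_integral: "module_finite_subring R \<Longrightarrow> x \<in> R \<Longrightarrow> integral x"
  unfolding module_finite_subring_def
  using integral_if_multiplication_stable M.span_base by blast

lemma module_finite_subring_range: "module_finite_subring (range \<phi>)"
proof -
  have "range \<phi> = M.span {1}" by (simp add: M.span_singleton)
  moreover have "x * y \<in> range \<phi>" if "x \<in> range \<phi>" "y \<in> range \<phi>" for x y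
    using that by (auto simp flip: hom_mult)
  moreover have "1 \<in> range \<phi>" using hom_one by (metis rangeI)
  ultimately show ?thesis
    unfolding module_finite_subring_def by blast
qed

lemma range_subset_module_finite_subring: "module_finite_subring R \<Longrightarrow> \<phi> d \<in> R"
  unfolding module_finite_subring_def by (metis M.span_scale mult.right_neutral)

text \<open>
  If \<open>S\<close> generates \<open>R\<close> and \<open>x\<close> satisfies a monic equation of degree \<open>n\<close> over \<open>R\<close>, then the products
  \<open>s * x ^ i\<close> with \<open>i < n\<close> generate \<open>R[x]\<close>: the equation rewrites \<open>x ^ n\<close>.
\<close>

lemma module_finite_subring_adjoin:
  assumes R: "module_finite_subring R"
    and c: "\<And>i. i < n \<Longrightarrow> c i \<in> R"
    and eq: "x ^ n + (\<Sum>i<n. c i * x ^ i) = 0"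
  shows "\<exists>R'. module_finite_subring R' \<and> R \<subseteq> R' \<and> x \<in> R'"
proof -
  from R obtain S where fin: "finite S" and RS: "R = M.span S" and one: "1 \<in> R"
    and mult: "\<And>x y. x \<in> R \<Longrightarrow> y \<in> R \<Longrightarrow> x * y \<in> R"
    unfolding module_finite_subring_def by blast
  define T where "T = (\<lambda>(s, i). s * x ^ i) ` (S \<times> {..<n})"
  define R' where "R' = M.span T"
  have finT: "finite T" unfolding T_def using fin by auto
  have n: "n > 0" using eq by (cases n) auto
  have monomial: "m * x ^ i \<in> R'" if m: "m \<in> R" and i: "i < n" for m i
    using m[unfolded RS]
  proof (induction rule: M.span_induct_alt)
    case base
    then show ?case by (simp add: R'_def M.span_zero)
  next
    case (step c s y)
    have "s * x ^ i \<in> R'"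
      unfolding R'_def by (rule M.span_base) (use step i in \<open>auto simp: T_def\<close>)
    then have "\<phi> c * (s * x ^ i) + y * x ^ i \<in> R'"
      using step unfolding R'_def by (intro M.span_add M.span_scale) auto
    then show ?case by (simp add: algebra_simps)
  qed
  have stable: "x * m \<in> R'" if m: "m \<in> R'" for m
    using m[unfolded R'_def]
  proof (induction rule: M.span_induct_alt)
    case base
    then show ?case by (simp add: R'_def M.span_zero)
  next
    case (step d t y)
    then obtain s i where t: "t = s * x ^ i" and s: "s \<in> S" and i: "i < n"
      unfolding T_def by auto
    have sR: "s \<in> R" using s RS M.span_base by auto
    have "x * t \<in> R'"
    proof (cases "Suc i < n")
      case True
      then show ?thesis using monomial[OF sR True] by (simp add: t ac_simps)
    next
      case False
      with i have "n = Suc i" by simp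
      then have "x * t = s * x ^ n" by (simp add: t ac_simps)
      also have "x ^ n = - (\<Sum>i<n. c i * x ^ i)" using eq by (simp add: eq_neg_iff_add_eq_0)
      also have "s * \<dots> = - (\<Sum>i<n. (s * c i) * x ^ i)"
        by (simp add: sum_distrib_left ac_simps)
      also have "\<dots> \<in> R'"
        using monomial[OF mult[OF sR c]] unfolding R'_def
        by (intro M.span_neg M.span_sum) auto
      finally show ?thesis .
    qed
    then have "\<phi> d * (x * t) + x * y \<in> R'"
      using step unfolding R'_def by (intro M.span_add M.span_scale) auto
    then show ?case by (simp add: algebra_simps)
  qed
  have stable_pow: "x ^ k * m \<in> R'" if m: "m \<in> R'" for m k
    using m by (induction k) (auto simp: mult.assoc stable)
  have scale: "m * m' \<in> R'" if m: "m \<in> R" and m': "m' \<in> R'" for m m'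
    using m'[unfolded R'_def]
  proof (induction rule: M.span_induct_alt)
    case base
    then show ?case by (simp add: R'_def M.span_zero)
  next
    case (step d t y)
    then obtain s i where t: "t = s * x ^ i" and s: "s \<in> S" and i: "i < n"
      unfolding T_def by auto
    have sR: "s \<in> R" using s RS M.span_base by auto
    have "m * t \<in> R'" using monomial[OF mult[OF m sR] i] by (simp add: t ac_simps)
    then have "\<phi> d * (m * t) + m * y \<in> R'"
      using step unfolding R'_def by (intro M.span_add M.span_scale) auto
    then show ?case by (simp add: algebra_simps)
  qed
  have prod: "m * m' \<in> R'" if m: "m \<in> R'" and m': "m' \<in> R'" for m m'
    using m[unfolded R'_def]
  proof (induction rule: M.span_induct_alt)
    case base
    then show ?case by (simp add: R'_def M.span_zero)
  next
    case (step d t y)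
    then obtain s i where t: "t = s * x ^ i" and s: "s \<in> S" and i: "i < n"
      unfolding T_def by auto
    have sR: "s \<in> R" using s RS M.span_base by auto
    have "t * m' \<in> R'" using scale[OF sR stable_pow[OF m']] by (simp add: t ac_simps)
    then have "\<phi> d * (t * m') + y * m' \<in> R'"
      using step unfolding R'_def by (intro M.span_add M.span_scale) auto
    then show ?case by (simp add: algebra_simps)
  qed
  have sub: "R \<subseteq> R'" using monomial[OF _ n] by auto
  have "module_finite_subring R'"
    unfolding module_finite_subring_def using finT sub one prod R'_def by blast
  moreover have "x \<in> R'" using stable[of 1] sub one by auto
  ultimately show ?thesis using sub by blast
qed

lemma module_finite_subring_containing:
  assumes "finite T" and "\<And>x. x \<in> T \<Longrightarrow> integral x"
  shows "\<exists>R. module_finite_subring R \<and> T \<subseteq> R"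
  using assms
proof (induction T rule: finite_induct)
  case empty
  then show ?case using module_finite_subring_range by blast
next
  case (insert x T)
  then obtain R where R: "module_finite_subring R" "T \<subseteq> R" by auto
  from insert.prems obtain n :: nat and a where "x ^ n + (\<Sum>i<n. \<phi> (a i) * x ^ i) = 0"
    unfolding integral_iff_equation by blast
  then obtain R' where "module_finite_subring R'" "R \<subseteq> R'" "x \<in> R'"
    using module_finite_subring_adjoin[OF R(1), of n "\<lambda>i. \<phi> (a i)" x]
      range_subset_module_finite_subring[OF R(1)] by blast
  with R show ?case by blast
qed

lemma integral_trans:
  assumes "\<And>i. i < n \<Longrightarrow> integral (c i)" and "x ^ n + (\<Sum>i<n. c i * x ^ i) = 0"
  shows "integral x"
proof -
  obtain R where R: "module_finite_subring R" "c ` {..<n} \<subseteq> R"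
    using module_finite_subring_containing[of "c ` {..<n}"] assms(1) by auto
  then obtain R' where "module_finite_subring R'" "x \<in> R'"
    using module_finite_subring_adjoin[OF R(1) _ assms(2)] by auto
  then show ?thesis by (rule module_finite_subring_imp_integral)
qed

lemma integral_hom [simp]: "integral (\<phi> d)"
  using module_finite_subring_imp_integral[OF module_finite_subring_range] by blast

lemma integral_0 [simp]: "integral 0"
  using integral_hom[of 0] by simp

lemma integral_1 [simp]: "integral 1"
  using integral_hom[of 1] by simp

lemma
  assumes "integral x" "integral y"
  shows integral_add: "integral (x + y)" and integral_mult: "integral (x * y)"
proof -
  obtain R where R: "module_finite_subring R" "{x, y} \<subseteq> R"
    using module_finite_subring_containing[of "{x, y}"] assms by auto
  then have "x + y \<in> R" "x * y \<in> R"
    unfolding module_finite_subring_def by (auto intro: M.span_add)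
  with R show "integral (x + y)" "integral (x * y)"
    using module_finite_subring_imp_integral by blast+
qed

lemma integral_uminus: "integral x \<Longrightarrow> integral (- x)"
  using integral_mult[OF integral_hom[of "-1"], of x] by (simp add: hom_distribs)

lemma integral_diff: "integral x \<Longrightarrow> integral y \<Longrightarrow> integral (x - y)"
  using integral_add[OF _ integral_uminus, of x y] by simp

lemma integral_sum: "(\<And>i. i \<in> I \<Longrightarrow> integral (f i)) \<Longrightarrow> integral (sum f I)"
  by (induction I rule: infinite_finite_induct) (auto intro: integral_add)

lemma integral_power: "integral x \<Longrightarrow> integral (x ^ n)"
  by (induction n) (auto intro: integral_mult)

lemma integral_poly: "integral x \<Longrightarrow> integral (poly (map_poly \<phi> f) x)"
  by (simp add: poly_altdef) (intro integral_sum integral_mult integral_power, auto)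

text \<open>
  The Horner partial sums \<open>z = g_k + g_(k+1) y + ... + g_n y^(n-k)\<close> of an equation \<open>g(y) = 0\<close> are
  integral although \<open>y\<close> need not be: multiplication by \<open>z\<close> maps the span of \<open>1, y, ..., y^(n-1)\<close> into
  itself. For \<open>y^i\<close> with \<open>i < k\<close> the degree of \<open>z y^i\<close> stays below \<open>n\<close>, and for \<open>i \<ge> k\<close> the
  equation replaces \<open>z y^k\<close> by the negative of the lower terms of \<open>g(y)\<close>.
\<close>

lemma integral_horner_sum:
  assumes root: "poly (map_poly \<phi> g) y = 0"
  shows "integral (\<Sum>j\<in>{k..Polynomial.degree g}. \<phi> (Polynomial.coeff g j) * y ^ (j - k))"
    (is "integral ?z")
proof -
  define n where "n = Polynomial.degree g"
  have rel: "(\<Sum>j\<le>n. \<phi> (Polynomial.coeff g j) * y ^ j) = 0"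
    using root by (simp add: poly_altdef n_def)
  consider "k = 0" | "k > n" | "0 < k" "k \<le> n" by linarith
  then show ?thesis
  proof cases
    case 1
    then show ?thesis using rel by (simp add: n_def atLeast0AtMost)
  next
    case 2
    then show ?thesis by (simp add: n_def)
  next
    case 3
    define S where "S = (\<lambda>i. y ^ i) ` {..<n}"
    have pow: "y ^ i \<in> M.span S" if "i < n" for i
      by (rule M.span_base) (use that in \<open>auto simp: S_def\<close>)
    have "?z * y ^ i \<in> M.span S" if i: "i < n" for i
    proof (cases "i < k")
      case True
      have "?z * y ^ i = (\<Sum>j\<in>{k..n}. \<phi> (Polynomial.coeff g j) * y ^ (j - k + i))"
        unfolding n_def sum_distrib_right power_add mult.assoc ..
      also have "\<dots> \<in> M.span S"
        using True by (intro M.span_sum M.span_scale pow) auto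
      finally show ?thesis .
    next
      case False
      have split: "{..n} = {..<k} \<union> {k..n}" using 3 by auto
      have "?z * y ^ k = (\<Sum>j\<in>{k..n}. \<phi> (Polynomial.coeff g j) * y ^ j)"
        by (auto simp: n_def sum_distrib_right mult.assoc simp flip: power_add intro!: sum.cong)
      also have "\<dots> = - (\<Sum>j<k. \<phi> (Polynomial.coeff g j) * y ^ j)"
      proof -
        have "(\<Sum>j<k. \<phi> (Polynomial.coeff g j) * y ^ j) +
              (\<Sum>j\<in>{k..n}. \<phi> (Polynomial.coeff g j) * y ^ j) = 0"
          using rel unfolding split by (subst (asm) sum.union_disjoint) auto
        then show ?thesis by (simp add: eq_neg_iff_add_eq_0 add.commute)
      qed
      finally have zk: "?z * y ^ k = - (\<Sum>j<k. \<phi> (Polynomial.coeff g j) * y ^ j)" .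
      have "?z * y ^ i = (?z * y ^ k) * y ^ (i - k)"
        using False by (simp add: mult.assoc flip: power_add)
      also have "\<dots> = - (\<Sum>j<k. \<phi> (Polynomial.coeff g j) * y ^ (j + (i - k)))"
        unfolding zk by (simp add: sum_distrib_right power_add mult.assoc)
      also have "\<dots> \<in> M.span S"
        using False i by (intro M.span_neg M.span_sum M.span_scale pow) auto
      finally show ?thesis .
    qed
    moreover have "1 \<in> M.span S" using pow[of 0] 3 by simp
    moreover have "finite S" by (simp add: S_def)
    ultimately show ?thesis
      using integral_if_multiplication_stable[of S ?z] unfolding S_def by auto
  qed
qed

end

lemma (in domain_in_field) integral_coeff_mult:
  assumes "\<And>i. integral (Polynomial.coeff f i)" "\<And>i. integral (Polynomial.coeff g i)"
  shows "integral (Polynomial.coeff (f * g) i)"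
  unfolding coeff_mult using assms by (intro integral_sum integral_mult) auto

lemma (in domain_in_field) integral_coeff_prod_linear:
  assumes "\<And>x. x \<in># A \<Longrightarrow> integral x"
  shows "integral (Polynomial.coeff (\<Prod>x\<in>#A. [:- x, 1:]) i)"
  using assms
proof (induction A arbitrary: i)
  case empty
  then show ?case by (simp add: coeff_1)
next
  case (add x A)
  have "integral (Polynomial.coeff [:- x, 1:] j)" for j
    using add.prems by (auto simp: coeff_pCons integral_uminus split: nat.splits)
  then have "integral (Polynomial.coeff ([:- x, 1:] * (\<Prod>x\<in>#A. [:- x, 1:])) i)"
    using add by (intro integral_coeff_mult) auto
  then show ?case by simp
qed

section \<open>Comaximal elements and polynomials over a field\<close>

definition comaximal :: "'a::comm_ring_1 \<Rightarrow> 'a \<Rightarrow> bool" where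
  "comaximal a b \<longleftrightarrow> (\<exists>u v. u * a + v * b = 1)"

lemma comaximalI: "u * a + v * b = 1 \<Longrightarrow> comaximal a b"
  unfolding comaximal_def by blast

lemma comaximal_sym: "comaximal a b \<Longrightarrow> comaximal b a"
  unfolding comaximal_def by (metis add.commute)

lemma comaximal_one: "comaximal 1 a"
  by (rule comaximalI[of 1 _ 0]) simp

lemma comaximal_mult_left:
  assumes "comaximal a c" "comaximal b c"
  shows "comaximal (a * b) c"
proof -
  from assms obtain u v u' v' where "u * a + v * c = 1" "u' * b + v' * c = 1"
    unfolding comaximal_def by blast
  then have "(u * a + v * c) * (u' * b + v' * c) = 1" by simp
  then have "(u * u') * (a * b) + (u * a * v' + v * u' * b + v * c * v') * c = 1"
    by (simp add: algebra_simps)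
  then show ?thesis by (rule comaximalI)
qed

lemma comaximal_prod_left:
  "(\<And>i. i \<in> I \<Longrightarrow> comaximal (f i) c) \<Longrightarrow> comaximal (\<Prod>i\<in>I. f i) c"
  by (induction I rule: infinite_finite_induct)
     (auto intro: comaximal_one comaximal_mult_left)

lemma comaximal_dvd_mult:
  assumes "comaximal a b" "a dvd b * c"
  shows "a dvd c"
proof -
  from assms(1) obtain u v where "u * a + v * b = 1" unfolding comaximal_def by blast
  then have "c = (u * a + v * b) * c" by simp
  also have "\<dots> = a * (u * c) + v * (b * c)" by (simp add: algebra_simps)
  finally have "c = a * (u * c) + v * (b * c)" .
  then show ?thesis using assms(2) by (metis dvd_add dvd_mult dvd_triv_left)
qed

lemma prod_dvd_if_comaximal:
  assumes "finite I" "\<And>i j. i \<in> I \<Longrightarrow> j \<in> I \<Longrightarrow> i \<noteq> j \<Longrightarrow> comaximal (f i) (f j)"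
    and "\<And>i. i \<in> I \<Longrightarrow> f i dvd h"
  shows "(\<Prod>i\<in>I. f i) dvd h"
  using assms
proof (induction I rule: finite_induct)
  case (insert i I)
  then obtain c where h: "h = f i * c" by blast
  have "comaximal (\<Prod>j\<in>I. f j) (f i)"
    using insert by (intro comaximal_prod_left) auto
  moreover have "(\<Prod>j\<in>I. f j) dvd f i * c" using insert h by auto
  ultimately have "(\<Prod>j\<in>I. f j) dvd c" by (rule comaximal_dvd_mult)
  then show ?case using insert h by (simp add: mult_dvd_mono)
qed simp

text \<open>
  Stated for elements of an arbitrary commutative ring, since it is applied both in \<open>K[X]\<close>, to obtain
  idempotents modulo \<open>p\<close>, and in \<open>D[X]\<close>, which need not be a principal ideal domain.
\<close>

lemma chinese_remainder_comaximal:
  assumes "finite I" "\<And>i j. i \<in> I \<Longrightarrow> j \<in> I \<Longrightarrow> i \<noteq> j \<Longrightarrow> comaximal (f i) (f j)"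
  shows "\<exists>x. \<forall>i\<in>I. f i dvd x - r i"
  using assms
proof (induction I rule: finite_induct)
  case (insert i I)
  then obtain x where x: "\<forall>j\<in>I. f j dvd x - r j" by auto
  have "comaximal (\<Prod>j\<in>I. f j) (f i)"
    using insert by (intro comaximal_prod_left) auto
  then obtain u v where uv: "u * (\<Prod>j\<in>I. f j) + v * f i = 1"
    unfolding comaximal_def by blast
  define y where "y = x + u * (\<Prod>j\<in>I. f j) * (r i - x)"
  have "v * f i = 1 - u * (\<Prod>j\<in>I. f j)" using uv by (metis add_diff_cancel_left')
  moreover have "y - r i = (1 - u * (\<Prod>j\<in>I. f j)) * (x - r i)"
    by (simp add: y_def algebra_simps)
  ultimately have "y - r i = f i * (v * (x - r i))" by (metis mult.assoc mult.commute)
  moreover have "f j dvd y - r j" if j: "j \<in> I" for j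
  proof -
    have "f j dvd (\<Prod>j\<in>I. f j)" using insert j by (intro dvd_prodI) auto
    then have "f j dvd (x - r j) + u * (\<Prod>j\<in>I. f j) * (r i - x)"
      using x j by (intro dvd_add dvd_mult2 dvd_mult) auto
    then show ?thesis by (simp add: y_def algebra_simps)
  qed
  ultimately show ?case by (intro exI[of _ y]) auto
qed simp

lemma field_poly_bezout:
  fixes a b :: "'k::field poly"
  shows "\<exists>u v. (u * a + v * b) dvd a \<and> (u * a + v * b) dvd b"
proof (induction "if b = 0 then 0 else Suc (Polynomial.degree b)" arbitrary: a b rule: less_induct)
  case less
  show ?case
  proof (cases "b = 0")
    case True
    then show ?thesis by (intro exI[of _ 1]) auto
  next
    case False
    then have "(if a mod b = 0 then 0 else Suc (Polynomial.degree (a mod b))) <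
        (if b = 0 then 0 else Suc (Polynomial.degree b))"
      using degree_mod_less'[of b a] by auto
    from less[OF this, of b] obtain u v
      where uv: "(u * b + v * (a mod b)) dvd b" "(u * b + v * (a mod b)) dvd a mod b" by auto
    have eq: "v * a + (u - v * (a div b)) * b = u * b + v * (a mod b)"
      unfolding minus_div_mult_eq_mod[of a b, symmetric] by (simp add: algebra_simps)
    have "(u * b + v * (a mod b)) dvd a"
      using uv by (metis dvd_add dvd_mult div_mult_mod_eq)
    then show ?thesis using uv unfolding eq[symmetric] by blast
  qed
qed

lemma field_poly_comaximal_if_no_common_divisor:
  fixes a b :: "'k::field poly"
  assumes "\<And>g. g dvd a \<Longrightarrow> g dvd b \<Longrightarrow> g dvd 1"
  shows "comaximal a b"
proof -
  obtain u v where uv: "(u * a + v * b) dvd a" "(u * a + v * b) dvd b"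
    using field_poly_bezout by blast
  then have "(u * a + v * b) dvd 1" using assms by blast
  then obtain w where "1 = (u * a + v * b) * w" by blast
  then have "(w * u) * a + (w * v) * b = 1" by (simp add: algebra_simps)
  then show ?thesis by (rule comaximalI)
qed

lemma irreducible_field_poly_comaximal:
  fixes q f :: "'k::field poly"
  assumes q: "Factorial_Ring.irreducible q" and ndvd: "\<not> q dvd f"
  shows "comaximal q f"
proof (rule field_poly_comaximal_if_no_common_divisor)
  fix g assume g: "g dvd q" "g dvd f"
  then obtain c where c: "q = g * c" by blast
  then have "g dvd 1 \<or> c dvd 1" using q irreducibleD by blast
  moreover have "\<not> c dvd 1"
  proof
    assume "c dvd 1"
    then have "q dvd g" using c by simp
    then show False using g ndvd dvd_trans by blast
  qed
  ultimately show "g dvd 1" by blast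
qed

lemma irreducible_field_poly_degree:
  fixes q :: "'k::field poly"
  assumes "Factorial_Ring.irreducible q"
  shows "Polynomial.degree q > 0"
proof (rule ccontr)
  assume "\<not> Polynomial.degree q > 0"
  moreover have "q \<noteq> 0" using assms by (metis not_irreducible_zero)
  ultimately have "q dvd 1" by (simp add: is_unit_iff_degree)
  then show False using irreducible_not_unit[OF assms] by contradiction
qed

lemma monic_division:
  fixes f g :: "'a::idom poly"
  assumes "Polynomial.lead_coeff g = 1"
  shows "\<exists>q r. f = g * q + r \<and> (r = 0 \<or> Polynomial.degree r < Polynomial.degree g)"
proof -
  obtain q r where qr: "pseudo_divmod f g = (q, r)" by force
  have "g \<noteq> 0" using assms by auto
  from pseudo_divmod[OF this qr] assms show ?thesis by auto
qed

section \<open>Unit resultants\<close>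

text \<open>
  Row \<open>i\<close> of the Sylvester matrix read as a polynomial, multiplied by \<open>X\<close>: this shift lets column \<open>j\<close>
  hold the coefficient at \<open>N - j\<close> rather than \<open>N - 1 - j\<close>, where \<open>N\<close> is the size of the matrix.
\<close>

definition sylvester_row :: "'a::comm_ring_1 poly \<Rightarrow> 'a poly \<Rightarrow> nat \<Rightarrow> 'a poly" where
  "sylvester_row f g i =
     (if i < Polynomial.degree g then Polynomial.monom 1 (Polynomial.degree g - i) * f
      else Polynomial.monom 1 (Polynomial.degree f + Polynomial.degree g - i) * g)"

lemma mult_sylvester_mat_entry:
  fixes f g :: "'a::comm_ring_1 poly"
  defines "N \<equiv> Polynomial.degree f + Polynomial.degree g"
  assumes W: "W \<in> carrier_mat N N" and r: "r < N" and j: "j < N"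
  shows "(W * sylvester_mat f g) $$ (r, j) =
    Polynomial.coeff (\<Sum>i<N. Polynomial.smult (W $$ (r, i)) (sylvester_row f g i)) (N - j)"
  using assms
  by (auto simp: scalar_prod_def sylvester_index_mat2 sylvester_row_def coeff_sum atLeast0LessThan
      intro!: sum.cong)

text \<open>
  Vectors times the Sylvester matrix are the combinations \<open>a f + b g\<close> with \<open>a\<close> of degree below
  \<open>degree g\<close> and \<open>b\<close> of degree below \<open>degree f\<close>; the entries of the vector are the coefficients of \<open>a\<close>
  and \<open>b\<close>, highest first. The factor \<open>X\<close> is the shift of the rows.
\<close>

lemma sum_sylvester_rows:
  fixes f g :: "'a::comm_ring_1 poly"
  defines "m \<equiv> Polynomial.degree f" and "n \<equiv> Polynomial.degree g"
  shows "(\<Sum>i<m + n. Polynomial.smult (w i) (sylvester_row f g i)) =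
    pCons 0 ((\<Sum>i<n. Polynomial.monom (w i) (n - 1 - i)) * f +
             (\<Sum>i<m. Polynomial.monom (w (n + i)) (m - 1 - i)) * g)"
proof -
  have mon: "Polynomial.smult c (Polynomial.monom 1 (l - i) * h) =
      pCons 0 (Polynomial.monom c (l - 1 - i) * h)"
    if "i < l" for c :: 'a and l i and h :: "'a poly"
  proof -
    have "l - i = Suc (l - 1 - i)" using that by simp
    then show ?thesis by (simp add: monom_Suc smult_monom flip: mult_smult_left)
  qed
  have split: "(\<Sum>i<l + n. F i) = (\<Sum>i<n. F i) + (\<Sum>i<l. F (n + i))"
    for l and F :: "nat \<Rightarrow> 'a poly"
    by (induction l) (auto simp: add_ac)
  have shift: "(\<Sum>i<l. pCons 0 (F i)) = pCons 0 (\<Sum>i<l. F i)"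
    for l and F :: "nat \<Rightarrow> 'a poly"
    by (induction l) auto
  have "(\<Sum>i<m + n. Polynomial.smult (w i) (sylvester_row f g i)) =
      (\<Sum>i<n. Polynomial.smult (w i) (sylvester_row f g i)) +
      (\<Sum>i<m. Polynomial.smult (w (n + i)) (sylvester_row f g (n + i)))"
    by (rule split)
  also have "(\<Sum>i<n. Polynomial.smult (w i) (sylvester_row f g i)) =
      (\<Sum>i<n. pCons 0 (Polynomial.monom (w i) (n - 1 - i) * f))"
    by (intro sum.cong) (auto simp: sylvester_row_def n_def[symmetric] mon)
  also have "(\<Sum>i<m. Polynomial.smult (w (n + i)) (sylvester_row f g (n + i))) =
      (\<Sum>i<m. pCons 0 (Polynomial.monom (w (n + i)) (m - 1 - i) * g))"
    by (intro sum.cong) (auto simp: sylvester_row_def n_def[symmetric] m_def[symmetric] mon)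
  also have "(\<Sum>i<n. pCons 0 (Polynomial.monom (w i) (n - 1 - i) * f)) =
      pCons 0 ((\<Sum>i<n. Polynomial.monom (w i) (n - 1 - i)) * f)"
    by (simp add: shift sum_distrib_right)
  also have "(\<Sum>i<m. pCons 0 (Polynomial.monom (w (n + i)) (m - 1 - i) * g)) =
      pCons 0 ((\<Sum>i<m. Polynomial.monom (w (n + i)) (m - 1 - i)) * g)"
    by (simp add: shift sum_distrib_right)
  finally show ?thesis by simp
qed

lemma poly_as_reversed_sum:
  assumes "\<And>i. i \<ge> n \<Longrightarrow> Polynomial.coeff a i = 0"
  shows "(\<Sum>i<n. Polynomial.monom (Polynomial.coeff a (n - 1 - i)) (n - 1 - i)) = a"
proof -
  have "(\<Sum>i<n. Polynomial.monom (Polynomial.coeff a (n - 1 - i)) (n - 1 - i)) =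
      (\<Sum>i<n. Polynomial.monom (Polynomial.coeff a i) i)"
    using sum.nat_diff_reindex[of "\<lambda>i. Polynomial.monom (Polynomial.coeff a i) i" n] by simp
  also have "\<dots> = a"
    by (rule poly_eqI) (use assms in \<open>auto simp: coeff_sum not_less\<close>)
  finally show ?thesis .
qed

text \<open>
  When the determinant is a unit, the adjugate gives an inverse of the Sylvester matrix over the base
  ring, and the last row of the inverse represents the constant polynomial \<open>1\<close> as \<open>a f + b g\<close>.
\<close>

lemma resultant_unit_imp_comaximal:
  fixes f g :: "'a::idom poly"
  assumes unit: "resultant f g dvd 1" and deg: "Polynomial.degree f > 0"
  shows "comaximal f g"
proof -
  define m n where "m = Polynomial.degree f" and "n = Polynomial.degree g"
  define S where "S = sylvester_mat f g"
  have S: "S \<in> carrier_mat (m + n) (m + n)"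
    unfolding S_def m_def n_def by (rule sylvester_carrier_mat)
  from unit obtain c where c: "c * det S = 1"
    unfolding resultant_def S_def by (metis dvdE mult.commute)
  define W where "W = c \<cdot>\<^sub>m adj_mat S"
  have W: "W \<in> carrier_mat (m + n) (m + n)" using adj_mat(1)[OF S] by (simp add: W_def)
  have WS: "W * S = 1\<^sub>m (m + n)"
    using adj_mat[OF S] S c by (simp add: W_def mult_smult_assoc_mat[where n = "m + n" and nc = "m + n"]) auto
  \<comment> \<open>The last column of the Sylvester matrix belongs to the constant coefficient.\<close>
  define w where "w = (\<lambda>i. W $$ (m + n - 1, i))"
  define h where "h = (\<Sum>i<n. Polynomial.monom (w i) (n - 1 - i)) * f +
             (\<Sum>i<m. Polynomial.monom (w (n + i)) (m - 1 - i)) * g"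
  have pos: "m + n > 0" using deg by (simp add: m_def)
  have co: "Polynomial.coeff (pCons 0 h) (m + n - j) = (if j = m + n - 1 then 1 else 0)"
    if "j < m + n" for j
  proof -
    have row: "(W * S) $$ (m + n - 1, j) = Polynomial.coeff (pCons 0 h) (m + n - j)"
      using mult_sylvester_mat_entry[of W f g "m + n - 1" j] W that pos
      using sum_sylvester_rows[of w f g]
      unfolding S_def m_def n_def w_def h_def by simp
    have "(W * S) $$ (m + n - 1, j) = (if j = m + n - 1 then 1 else 0)"
      using that pos by (auto simp: WS)
    with row show ?thesis by (rule trans[OF sym])
  qed
  have "Polynomial.coeff h i = (if i = 0 then 1 else 0)" for i
  proof (cases "i < m + n")
    case True
    then show ?thesis using co[of "m + n - 1 - i"] pos
      by (auto simp: coeff_pCons split: nat.splits)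
  next
    case False
    have da: "Polynomial.coeff (\<Sum>i<n. Polynomial.monom (w i) (n - 1 - i)) k = 0" if "k \<ge> n" for k
      using that by (auto simp: coeff_sum intro!: sum.neutral)
    have db: "Polynomial.coeff (\<Sum>i<m. Polynomial.monom (w (n + i)) (m - 1 - i)) k = 0"
      if "k \<ge> m" for k
      using that by (auto simp: coeff_sum intro!: sum.neutral)
    have "Polynomial.coeff ((\<Sum>i<n. Polynomial.monom (w i) (n - 1 - i)) * f) i = 0"
      unfolding coeff_mult
    proof (intro sum.neutral ballI)
      fix k assume "k \<in> {..i}"
      then have "k \<ge> n \<or> i - k > m" using False by auto
      then show "Polynomial.coeff (\<Sum>i<n. Polynomial.monom (w i) (n - 1 - i)) k *
          Polynomial.coeff f (i - k) = 0"
        using da coeff_eq_0[of f] by (auto simp: m_def)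
    qed
    moreover have "Polynomial.coeff ((\<Sum>i<m. Polynomial.monom (w (n + i)) (m - 1 - i)) * g) i = 0"
      unfolding coeff_mult
    proof (intro sum.neutral ballI)
      fix k assume "k \<in> {..i}"
      then have "k \<ge> m \<or> i - k > n" using False by auto
      then show "Polynomial.coeff (\<Sum>i<m. Polynomial.monom (w (n + i)) (m - 1 - i)) k *
          Polynomial.coeff g (i - k) = 0"
        using db coeff_eq_0[of g] by (auto simp: n_def)
    qed
    moreover have "i \<noteq> 0" using False pos by (cases i) auto
    ultimately show ?thesis by (simp add: h_def)
  qed
  then have "h = 1" by (intro poly_eqI) auto
  then show ?thesis unfolding h_def by (rule comaximalI)
qed

text \<open>
  From \<open>u f + v g = 1\<close> every \<open>h\<close> of degree below \<open>degree f + degree g\<close> is a combination of \<open>f\<close> and \<open>g\<close>,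
  and dividing the cofactor of \<open>g\<close> by the monic \<open>f\<close> brings both cofactors into the degree range of the
  Sylvester matrix. Applied to the monomials \<open>h\<close>, this gives a left inverse of the matrix.
\<close>

lemma comaximal_imp_resultant_unit:
  fixes f g :: "'a::idom poly"
  assumes monic: "Polynomial.lead_coeff f = 1" and co: "comaximal f g"
  shows "resultant f g dvd 1"
proof -
  define m n where "m = Polynomial.degree f" and "n = Polynomial.degree g"
  define S where "S = sylvester_mat f g"
  have S: "S \<in> carrier_mat (m + n) (m + n)"
    unfolding S_def m_def n_def by (rule sylvester_carrier_mat)
  have f0: "f \<noteq> 0" using monic by auto
  obtain u v where uv: "u * f + v * g = 1" using co unfolding comaximal_def by blast
  have "\<exists>w. (\<Sum>i<m + n. Polynomial.smult (w i) (sylvester_row f g i)) =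
      pCons 0 (Polynomial.monom 1 (m + n - 1 - r))" if r: "r < m + n" for r
  proof -
    define h :: "'a poly" where "h = Polynomial.monom 1 (m + n - 1 - r)"
    obtain q b where qb: "v * h = f * q + b" "b = 0 \<or> Polynomial.degree b < m"
      using monic_division[OF monic] unfolding m_def by blast
    \<comment> \<open>The part of \<open>v h\<close> divisible by \<open>f\<close> is moved to the cofactor of \<open>f\<close>.\<close>
    define a where "a = u * h + q * g"
    have "h = (u * f + v * g) * h" using uv by simp
    also have "\<dots> = u * h * f + (v * h) * g" by (simp add: algebra_simps)
    also have "\<dots> = a * f + b * g" unfolding qb a_def by (simp add: algebra_simps)
    finally have h: "h = a * f + b * g" .
    have degb: "Polynomial.coeff b i = 0" if "i \<ge> m" for i
      using that qb(2) by (auto intro: coeff_eq_0)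
    have dega: "Polynomial.coeff a i = 0" if "i \<ge> n" for i
    proof (rule ccontr)
      assume "Polynomial.coeff a i \<noteq> 0"
      then have a0: "a \<noteq> 0" and "n \<le> Polynomial.degree a"
        using that le_degree[of a i] by auto
      then have "Polynomial.degree (a * f) \<ge> m + n"
        using f0 by (simp add: degree_mult_eq m_def)
      moreover have "a * f = h - b * g" using h by simp
      moreover have "Polynomial.degree h < m + n"
        using r by (simp add: h_def degree_monom_eq)
      moreover have "Polynomial.degree (b * g) < m + n"
        using qb(2) r degree_mult_le[of b g] by (auto simp: n_def)
      ultimately show False
        using degree_diff_less[of h "m + n" "b * g"] by simp
    qed
    define w where "w = (\<lambda>i. if i < n then Polynomial.coeff a (n - 1 - i)
       else Polynomial.coeff b (m - 1 - (i - n)))"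
    have "(\<Sum>i<n. Polynomial.monom (w i) (n - 1 - i)) = a"
      using poly_as_reversed_sum[of n a] dega by (simp add: w_def)
    moreover have "(\<Sum>i<m. Polynomial.monom (w (n + i)) (m - 1 - i)) = b"
      using poly_as_reversed_sum[of m b] degb by (simp add: w_def)
    ultimately have "(\<Sum>i<m + n. Polynomial.smult (w i) (sylvester_row f g i)) = pCons 0 h"
      unfolding m_def n_def sum_sylvester_rows using h by simp
    then show ?thesis unfolding h_def by blast
  qed
  then obtain w where w: "\<And>r. r < m + n \<Longrightarrow>
      (\<Sum>i<m + n. Polynomial.smult (w r i) (sylvester_row f g i)) =
      pCons 0 (Polynomial.monom 1 (m + n - 1 - r))"
    by metis
  define W where "W = mat (m + n) (m + n) (\<lambda>(r, i). w r i)"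
  have W: "W \<in> carrier_mat (m + n) (m + n)" by (simp add: W_def)
  have "W * S = 1\<^sub>m (m + n)"
  proof (rule eq_matI)
    fix r j assume "r < dim_row (1\<^sub>m (m + n) :: 'a mat)" "j < dim_col (1\<^sub>m (m + n) :: 'a mat)"
    then have rj: "r < m + n" "j < m + n" by auto
    have "(W * S) $$ (r, j) = Polynomial.coeff (pCons 0 (Polynomial.monom 1 (m + n - 1 - r))) (m + n - j)"
      using mult_sylvester_mat_entry[of W f g r j] W rj w[OF rj(1)]
      by (simp add: S_def m_def n_def W_def)
    also have "\<dots> = (if r = j then 1 else 0)"
      using rj by (auto simp: coeff_pCons split: nat.splits)
    finally show "(W * S) $$ (r, j) = 1\<^sub>m (m + n) $$ (r, j)" using rj by simp
  qed (use S W in auto)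
  then have "det W * det S = 1" using det_mult[OF W S] by simp
  then show ?thesis unfolding resultant_def S_def by (metis dvd_triv_right)
qed

section \<open>Polynomials over the quotient field\<close>

interpretation quotient_field: domain_in_field "to_fract :: 'd::idom \<Rightarrow> 'd fract"
  by unfold_locales auto

text \<open>
  Division by a monic polynomial does not leave \<open>D[X]\<close>, and the remainder is determined by its degree.
\<close>

lemma fract_poly_dvd_iff:
  fixes f g :: "'a::idom poly"
  assumes "Polynomial.lead_coeff g = 1"
  shows "fract_poly g dvd fract_poly f \<longleftrightarrow> g dvd f"
proof
  assume dvd: "fract_poly g dvd fract_poly f"
  obtain q r where qr: "f = g * q + r" "r = 0 \<or> Polynomial.degree r < Polynomial.degree g"
    using monic_division[OF assms] by blast
  have "fract_poly r = fract_poly f - fract_poly g * fract_poly q" by (simp add: qr)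
  then have "fract_poly g dvd fract_poly r" using dvd by simp
  then have "r = 0"
    using qr(2) by (auto dest!: dvd_imp_degree_le simp: degree_map_poly)
  then show "g dvd f" using qr by simp
qed (rule fract_poly_dvd)

lemma fract_as_quotient: "\<exists>a b. b \<noteq> 0 \<and> x = to_fract a / to_fract b"
  by (cases x) (auto simp: Fract_conv_to_fract)

lemma fract_poly_lift:
  assumes "\<And>i. Polynomial.coeff g i \<in> range (to_fract :: 'd::idom \<Rightarrow> 'd fract)"
  shows "\<exists>g' :: 'd poly. g = fract_poly g'"
proof
  have "inv_into UNIV (to_fract :: 'd \<Rightarrow> 'd fract) 0 = 0"
    by (metis inv_f_f injI to_fract_0 to_fract_eq_iff)
  then show "g = fract_poly (map_poly (inv_into UNIV to_fract) g)"
    by (intro poly_eqI) (simp add: coeff_map_poly f_inv_into_f[OF assms])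
qed

lemma fract_poly_lead_coeff:
  "Polynomial.lead_coeff (fract_poly f) = to_fract (Polynomial.lead_coeff f)"
  by (rule quotient_field.hom_lead_coeff)

lemma fract_poly_degree [simp]: "Polynomial.degree (fract_poly f) = Polynomial.degree f"
  by (rule quotient_field.degree_map_poly_hom)

lemma fract_poly_const: "fract_poly [:c:] = [:to_fract c:]"
  by (rule poly_eqI) (simp add: coeff_map_poly coeff_pCons split: nat.splits)

lemma pcompose_monic:
  assumes "Polynomial.lead_coeff G = 1"
  shows "fract_poly G \<circ>\<^sub>p f = f ^ Polynomial.degree G +
    (\<Sum>i<Polynomial.degree G. [:to_fract (Polynomial.coeff G i):] * f ^ i)"
proof -
  have "fract_poly G \<circ>\<^sub>p f = (\<Sum>i\<le>Polynomial.degree G. [:to_fract (Polynomial.coeff G i):] * f ^ i)"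
    by (simp add: pcompose_altdef poly_altdef coeff_map_poly degree_map_poly)
  also have "{..Polynomial.degree G} = insert (Polynomial.degree G) {..<Polynomial.degree G}"
    by auto
  finally show ?thesis using assms by simp
qed

lemma fract_poly_prod: "fract_poly (\<Prod>i\<in>I. f i) = (\<Prod>i\<in>I. fract_poly (f i))"
  by (induction I rule: infinite_finite_induct) simp_all

lemma fract_poly_pCons: "fract_poly (pCons c f) = pCons (to_fract c) (fract_poly f)"
  by (rule poly_eqI) (simp add: coeff_map_poly coeff_pCons split: nat.splits)

lemma common_denominator:
  fixes f :: "'d::idom fract poly"
  shows "\<exists>d g. d \<noteq> 0 \<and> fract_poly g = Polynomial.smult (to_fract d) f"
proof (induction f)
  case 0
  show ?case by (intro exI[of _ 1] exI[of _ 0]) simp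
next
  case (pCons c f)
  then obtain d g where d: "d \<noteq> 0" and g: "fract_poly g = Polynomial.smult (to_fract d) f" by blast
  obtain a b where b: "b \<noteq> 0" and c: "c = to_fract a / to_fract b"
    using fract_as_quotient by blast
  have "fract_poly (pCons (a * d) (Polynomial.smult b g)) = Polynomial.smult (to_fract (d * b)) (pCons c f)"
  proof -
    have "to_fract (d * b) * c = to_fract (a * d)" using b by (simp add: c)
    moreover have "fract_poly (pCons (a * d) (Polynomial.smult b g)) =
        pCons (to_fract (a * d)) (Polynomial.smult (to_fract (d * b)) f)"
      unfolding fract_poly_pCons fract_poly_smult g smult_smult to_fract_mult[symmetric]
        mult.commute[of b d] ..
    ultimately show ?thesis by (simp only: smult_pCons)
  qed
  then show ?case using b d by (intro exI[of _ "d * b"]) auto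
qed

text \<open>
  \<open>K[X]\<close> is integrally closed in \<open>K(X)\<close>: in lowest terms \<open>a'/b'\<close>, clearing denominators in the equation
  shows that \<open>b'\<close> divides a power of \<open>a'\<close>, so \<open>b'\<close> is a unit.
\<close>

lemma field_poly_integrally_closed:
  fixes x :: "'k::field poly fract"
  assumes eq: "x ^ n + (\<Sum>i<n. to_fract (c i) * x ^ i) = 0"
  shows "x \<in> range to_fract"
proof -
  obtain a b where b: "b \<noteq> 0" and x: "x = to_fract a / to_fract b"
    using fract_as_quotient by blast
  obtain u v where "(u * a + v * b) dvd a" "(u * a + v * b) dvd b"
    using field_poly_bezout by blast
  then obtain a' b' where ab: "a = (u * a + v * b) * a'" "b = (u * a + v * b) * b'"
    by blast
  define g where "g = u * a + v * b"
  have g: "g \<noteq> 0" and b': "b' \<noteq> 0" using ab(2) b by (auto simp: g_def)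
  have "g * (u * a' + v * b') = u * (g * a') + v * (g * b')" by (simp add: algebra_simps)
  also have "\<dots> = g * 1" using ab by (simp add: g_def)
  finally have "g * (u * a' + v * b') = g * 1" .
  then have co: "comaximal a' b'" using g by (intro comaximalI) simp
  have x': "x = to_fract a' / to_fract b'"
    using ab g unfolding x g_def[symmetric]
    by (metis mult_divide_mult_cancel_left to_fract_eq_0_iff to_fract_mult)
  then have xb: "x * to_fract b' = to_fract a'" using b' by simp
  have n: "n > 0" using eq by (cases n) auto
  have "to_fract b' ^ n * (x ^ n + (\<Sum>i<n. to_fract (c i) * x ^ i)) =
      to_fract (a' ^ n + b' * (\<Sum>i<n. c i * a' ^ i * b' ^ (n - 1 - i)))"
  proof -
    have pow: "to_fract b' ^ i * x ^ i = to_fract (a' ^ i)" for i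
      using xb by (simp add: quotient_field.hom_power mult.commute flip: power_mult_distrib)
    have summand: "to_fract b' ^ n * (to_fract (c i) * x ^ i) = to_fract (b' * (c i * a' ^ i * b' ^ (n - 1 - i)))"
      if "i < n" for i
    proof -
      have "n = Suc (n - 1 - i) + i" using that by simp
      then have "to_fract b' ^ n = to_fract b' ^ (Suc (n - 1 - i) + i)" by (rule arg_cong)
      also have "\<dots> = to_fract b' * to_fract b' ^ (n - 1 - i) * to_fract b' ^ i"
        by (simp only: power_add power_Suc)
      finally have "to_fract b' ^ n * (to_fract (c i) * x ^ i) =
          to_fract b' * to_fract b' ^ (n - 1 - i) * to_fract b' ^ i * (to_fract (c i) * x ^ i)"
        by (rule arg_cong)
      also have "\<dots> = to_fract b' * to_fract b' ^ (n - 1 - i) * to_fract (c i) * (to_fract b' ^ i * x ^ i)"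
        by (simp only: mult_ac)
      finally show ?thesis unfolding pow by (simp only: to_fract_mult quotient_field.hom_power mult_ac)
    qed
    have "to_fract b' ^ n * (x ^ n + (\<Sum>i<n. to_fract (c i) * x ^ i)) =
        to_fract b' ^ n * x ^ n + (\<Sum>i<n. to_fract b' ^ n * (to_fract (c i) * x ^ i))"
      by (simp only: distrib_left sum_distrib_left)
    also have "\<dots> = to_fract (a' ^ n) + (\<Sum>i<n. to_fract (b' * (c i * a' ^ i * b' ^ (n - 1 - i))))"
      unfolding pow by (intro arg_cong2[of _ _ _ _ "(+)"] sum.cong refl summand) auto
    also have "\<dots> = to_fract (a' ^ n + b' * (\<Sum>i<n. c i * a' ^ i * b' ^ (n - 1 - i)))"
      by (simp only: to_fract_add to_fract_sum sum_distrib_left)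
    finally show ?thesis .
  qed
  then have "to_fract (a' ^ n + b' * (\<Sum>i<n. c i * a' ^ i * b' ^ (n - 1 - i))) = 0"
    unfolding eq by simp
  then have "a' ^ n + b' * (\<Sum>i<n. c i * a' ^ i * b' ^ (n - 1 - i)) = 0"
    by (simp only: to_fract_eq_0_iff)
  then obtain s where "a' ^ n + b' * s = 0" by blast
  then have "a' ^ n = b' * - s" by (simp add: eq_neg_iff_add_eq_0)
  then have "b' dvd a' ^ n" by (rule dvdI)
  moreover have "comaximal b' (a' ^ n)"
    using comaximal_prod_left[of "{..<n}" "\<lambda>_. a'" b'] co by (simp add: comaximal_sym)
  ultimately have "b' dvd 1" using comaximal_dvd_mult[of b' "a' ^ n" 1] by simp
  then obtain d where d: "1 = b' * d" by blast
  then have "x = to_fract (a' * d)"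
    using b' unfolding x' by (simp add: field_simps flip: to_fract_mult)
  then show ?thesis by blast
qed

section \<open>Values at roots in an algebraic closure\<close>

locale algebraic_closure_of_fractions =
  fixes \<iota> :: "'d::idom fract \<Rightarrow> 'c::alg_closed_field"
  assumes closure: "is_algebraic_closure \<iota>"
begin

sublocale field_hom \<iota>
  using closure unfolding is_algebraic_closure_def by blast

sublocale D: domain_in_field "\<lambda>d. \<iota> (to_fract d)"
  by unfold_locales (auto simp: hom_distribs)

sublocale \<iota>_poly: map_poly_inj_idom_hom \<iota> ..

abbreviation ev :: "'d fract poly \<Rightarrow> 'c \<Rightarrow> 'c" where
  "ev f \<equiv> poly (map_poly \<iota> f)"

lemma map_poly_to_closure: "map_poly (\<lambda>d. \<iota> (to_fract d)) f = map_poly \<iota> (fract_poly f)"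
  by (simp add: map_poly_map_poly o_def)

lemma D_integral_iff: "D.integral x \<longleftrightarrow> (\<exists>f. Polynomial.lead_coeff f = 1 \<and> ev (fract_poly f) x = 0)"
  unfolding D.integral_def map_poly_to_closure ..

lemma ev_simps [simp]:
  "ev (f + g) x = ev f x + ev g x" "ev (f - g) x = ev f x - ev g x"
  "ev (f * g) x = ev f x * ev g x" "ev (f ^ n) x = ev f x ^ n"
  "ev (Polynomial.smult c f) x = \<iota> c * ev f x"
  by (simp_all add: hom_distribs)

lemma ev_pcompose: "ev (f \<circ>\<^sub>p g) x = ev f (ev g x)"
  by (simp add: map_poly_pcompose poly_pcompose)

lemma integral_ev_fract_poly: "D.integral x \<Longrightarrow> D.integral (ev (fract_poly r) x)"
  using D.integral_poly[of x r] by (simp only: map_poly_to_closure)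

lemma integral_\<iota>_iff: "D.integral (\<iota> x) \<longleftrightarrow> quotient_field.integral x"
  unfolding D_integral_iff quotient_field.integral_def by simp

lemma exists_root: "Polynomial.degree f > 0 \<Longrightarrow> \<exists>\<alpha>. ev f \<alpha> = 0"
  using alg_closed_imp_poly_has_root[of "map_poly \<iota> f"] by auto

lemma monic_splits:
  assumes "Polynomial.lead_coeff f = 1"
  shows "\<exists>A. map_poly \<iota> f = (\<Prod>x\<in>#A. [:- x, 1:])"
proof -
  have "map_poly \<iota> f \<noteq> 0" using assms by auto
  from alg_closed_imp_factorization[OF this] show ?thesis using assms by auto
qed

lemma root_of_linear_product: "x \<in># A \<Longrightarrow> poly (\<Prod>x\<in>#A. [:- x, 1:]) x = (0 :: 'c)"
  by (induction A) auto

text \<open>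
  This is \<open>V(p)\<close>. It is the set \<open>Int_K\<close> at the roots of \<open>p\<close> (\<open>Int_K_eq\<close>), phrased without the
  multiset of roots.
\<close>

definition int_valued_at_roots :: "'d poly \<Rightarrow> 'd fract poly set" where
  "int_valued_at_roots p = {f. \<forall>\<alpha>. ev (fract_poly p) \<alpha> = 0 \<longrightarrow> D.integral (ev f \<alpha>)}"

text \<open>
  This and the next lemma translate integrality of the values at all roots into a single monic equation
  modulo \<open>p\<close> over \<open>D\<close>. The equation is the product of equations of the values, one for each root counted
  with multiplicity, so that the repeated linear factors of \<open>p\<close> are matched. Divisibility by \<open>p\<close> then
  descends from the algebraic closure to \<open>K\<close>.
\<close>

lemma monic_equation_mod_if_int_valued:
  assumes p: "Polynomial.lead_coeff p = 1" and f: "f \<in> int_valued_at_roots p"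
  shows "\<exists>G. Polynomial.lead_coeff G = 1 \<and> fract_poly p dvd fract_poly G \<circ>\<^sub>p f"
proof -
  have "Polynomial.lead_coeff (fract_poly p) = 1"
    unfolding fract_poly_lead_coeff using p by simp
  then obtain A where A: "map_poly \<iota> (fract_poly p) = (\<Prod>x\<in>#A. [:- x, 1:])"
    using monic_splits by blast
  have "D.integral (ev f x)" if "x \<in># A" for x
    using f root_of_linear_product[OF that] unfolding int_valued_at_roots_def A[symmetric] by blast
  then have "\<exists>G :: 'd poly. Polynomial.lead_coeff G = 1 \<and>
      (\<Prod>x\<in>#A. [:- x, 1:]) dvd map_poly \<iota> (fract_poly G \<circ>\<^sub>p f)"
  proof (induction A)
    case empty
    then show ?case by (intro exI[of _ 1]) simp
  next
    case (add x A)
    then obtain G where G: "Polynomial.lead_coeff G = 1"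
      "(\<Prod>x\<in>#A. [:- x, 1:]) dvd map_poly \<iota> (fract_poly G \<circ>\<^sub>p f)" by auto
    from add.prems have "D.integral (ev f x)" by simp
    then obtain g where g: "Polynomial.lead_coeff g = 1" "ev (fract_poly g) (ev f x) = 0"
      unfolding D_integral_iff by blast
    have "[:- x, 1:] dvd map_poly \<iota> (fract_poly g \<circ>\<^sub>p f)"
      using g(2) by (simp add: poly_eq_0_iff_dvd[symmetric] ev_pcompose)
    from mult_dvd_mono[OF this G(2)]
    have "[:- x, 1:] * (\<Prod>x\<in>#A. [:- x, 1:]) dvd map_poly \<iota> (fract_poly (g * G) \<circ>\<^sub>p f)"
      by (simp only: fract_poly_mult pcompose_mult \<iota>_poly.hom_mult)
    moreover have "Polynomial.lead_coeff (g * G) = 1"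
      using g G by (simp add: lead_coeff_mult)
    ultimately show ?case by (intro exI[of _ "g * G"]) simp
  qed
  then obtain G :: "'d poly" where G: "Polynomial.lead_coeff G = 1"
    and dvd: "map_poly \<iota> (fract_poly p) dvd map_poly \<iota> (fract_poly G \<circ>\<^sub>p f)"
    unfolding A by blast
  from dvd have "fract_poly p dvd fract_poly G \<circ>\<^sub>p f" by (rule dvd_map_poly_hom_imp_dvd)
  with G show ?thesis by blast
qed

lemma int_valued_if_monic_equation_mod:
  assumes G: "Polynomial.lead_coeff G = 1" and dvd: "fract_poly p dvd fract_poly G \<circ>\<^sub>p f"
  shows "f \<in> int_valued_at_roots p"
  unfolding int_valued_at_roots_def
proof (intro CollectI allI impI)
  fix \<alpha> assume \<alpha>: "ev (fract_poly p) \<alpha> = 0"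
  from dvd obtain c where "fract_poly G \<circ>\<^sub>p f = fract_poly p * c" by blast
  then have "ev (fract_poly G \<circ>\<^sub>p f) \<alpha> = ev (fract_poly p * c) \<alpha>" by simp
  then have "ev (fract_poly G) (ev f \<alpha>) = 0" using \<alpha> by (simp add: ev_pcompose)
  then show "D.integral (ev f \<alpha>)" unfolding D_integral_iff using G by blast
qed

lemma D_ring_iff: "f \<in> D_ring p \<longleftrightarrow> (\<exists>r. fract_poly p dvd f - fract_poly r)"
proof
  assume "f \<in> D_ring p"
  then obtain r q where "f = fract_poly r + fract_poly p * q" unfolding D_ring_def by blast
  then have "fract_poly p dvd f - fract_poly r" by simp
  then show "\<exists>r. fract_poly p dvd f - fract_poly r" by blast
next
  assume "\<exists>r. fract_poly p dvd f - fract_poly r"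
  then obtain r q where "f - fract_poly r = fract_poly p * q" by (auto elim: dvdE)
  then have "f = fract_poly r + fract_poly p * q" by (simp add: diff_eq_eq add.commute)
  then show "f \<in> D_ring p" unfolding D_ring_def by blast
qed

text \<open>
  Roots of a monic polynomial over \<open>D\<close> are integral, and so are the values of \<open>D[X]\<close> at them.
\<close>

lemma D_ring_subset_int_valued:
  assumes p: "Polynomial.lead_coeff p = 1"
  shows "D_ring p \<subseteq> int_valued_at_roots p"
proof
  fix f assume "f \<in> D_ring p"
  then obtain r q where f: "f = fract_poly r + fract_poly p * q" unfolding D_ring_def by blast
  show "f \<in> int_valued_at_roots p" unfolding int_valued_at_roots_def
  proof (intro CollectI allI impI)
    fix \<alpha> assume \<alpha>: "ev (fract_poly p) \<alpha> = 0"
    then have "D.integral \<alpha>" unfolding D_integral_iff using p by blast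
    then have "D.integral (ev (fract_poly r) \<alpha>)" by (rule integral_ev_fract_poly)
    then show "D.integral (ev f \<alpha>)" using \<alpha> by (simp add: f)
  qed
qed

lemma irreducible_dvd_if_common_root:
  assumes Q: "Factorial_Ring.irreducible Q" and "ev Q \<alpha> = 0" "ev f \<alpha> = 0"
  shows "Q dvd f"
proof (rule ccontr)
  assume "\<not> Q dvd f"
  then obtain u v where "u * Q + v * f = 1"
    using irreducible_field_poly_comaximal[OF Q] unfolding comaximal_def by blast
  then have "ev (u * Q + v * f) \<alpha> = ev 1 \<alpha>" by simp
  then show False using assms by simp
qed

context
  assumes D_closed: "\<And>x::'d fract. quotient_field.integral x \<Longrightarrow> x \<in> range to_fract"
begin

text \<open>
  Gauss's lemma for integrally closed domains: the roots of the factor are roots of \<open>p\<close> and therefore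
  integral, so its coefficients are integral elements of \<open>K\<close>.
\<close>

lemma monic_factor_in_D:
  fixes p :: "'d poly"
  assumes p: "Polynomial.lead_coeff p = 1" and g: "Polynomial.lead_coeff g = 1"
    and fact: "g dvd fract_poly p"
  shows "\<exists>g'. g = fract_poly g'"
proof (rule fract_poly_lift)
  fix i
  obtain A where A: "map_poly \<iota> g = (\<Prod>x\<in>#A. [:- x, 1:])"
    using monic_splits[OF g] by blast
  have int: "D.integral x" if "x \<in># A" for x
  proof -
    have "ev g x = 0" using root_of_linear_product[OF that] by (simp add: A)
    moreover obtain h where "fract_poly p = g * h" using fact by blast
    ultimately have "ev (fract_poly p) x = 0" by simp
    then show ?thesis using p unfolding D_integral_iff by blast
  qed
  have "D.integral (Polynomial.coeff (map_poly \<iota> g) i)"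
    unfolding A using int by (rule D.integral_coeff_prod_linear)
  then have "D.integral (\<iota> (Polynomial.coeff g i))" by simp
  then show "Polynomial.coeff g i \<in> range to_fract"
    unfolding integral_\<iota>_iff by (rule D_closed)
qed

lemma irreducible_fract_poly:
  fixes p :: "'d poly"
  assumes p: "Polynomial.lead_coeff p = 1" and irr: "Factorial_Ring.irreducible p"
  shows "Factorial_Ring.irreducible (fract_poly p)"
proof (rule irreducibleI)
  have "p \<noteq> 0" using p by (metis leading_coeff_0_iff zero_neq_one)
  then show "fract_poly p \<noteq> 0" by (simp only: fract_poly_eq_0_iff not_False_eq_True)
  show "\<not> fract_poly p dvd 1"
  proof
    assume "fract_poly p dvd 1"
    then have "Polynomial.degree p = 0" using poly_dvd_1 by fastforce
    with p have "p = 1" by (metis degree_eq_zeroE lead_coeff_pCons(2) one_pCons)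
    with irr show False by auto
  qed
  fix a b assume ab: "fract_poly p = a * b"
  have mon: "Polynomial.lead_coeff a * Polynomial.lead_coeff b = 1"
    using arg_cong[OF ab, of Polynomial.lead_coeff] p
    by (simp add: fract_poly_lead_coeff lead_coeff_mult)
  \<comment> \<open>The leading coefficients of \<open>a\<close> and \<open>b\<close> are inverse to each other, so exchanging them makes both factors
    monic without changing the product.\<close>
  define a' b' where "a' = Polynomial.smult (Polynomial.lead_coeff b) a"
    and "b' = Polynomial.smult (Polynomial.lead_coeff a) b"
  have nz: "Polynomial.lead_coeff a \<noteq> 0" "Polynomial.lead_coeff b \<noteq> 0" using mon by auto
  have ab': "fract_poly p = a' * b'"
    using mon ab by (simp add: a'_def b'_def mult.commute)
  have lc: "Polynomial.lead_coeff a' = 1" "Polynomial.lead_coeff b' = 1"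
    using mon nz by (simp_all add: a'_def b'_def mult.commute)
  obtain A B where A: "a' = fract_poly A" and B: "b' = fract_poly B"
    using monic_factor_in_D[OF p lc(1)] monic_factor_in_D[OF p lc(2)] ab' by auto
  have "p = A * B" using ab' unfolding A B by (simp flip: fract_poly_mult)
  from irreducibleD[OF irr this] have "A dvd 1 \<or> B dvd 1" .
  then have "a' dvd 1 \<or> b' dvd 1" unfolding A B using fract_poly_is_unit by blast
  then show "a dvd 1 \<or> b dvd 1" using nz by (simp add: a'_def b'_def smult_dvd_iff)
qed

lemma monic_irreducibles_comaximal:
  fixes p q :: "'d poly"
  assumes "Polynomial.lead_coeff p = 1" "Factorial_Ring.irreducible p"
    and "Polynomial.lead_coeff q = 1" "Factorial_Ring.irreducible q" and "p \<noteq> q"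
  shows "comaximal (fract_poly p) (fract_poly q)"
proof (rule irreducible_field_poly_comaximal)
  show "Factorial_Ring.irreducible (fract_poly p)" by (rule irreducible_fract_poly[OF assms(1,2)])
  show "\<not> fract_poly p dvd fract_poly q"
  proof
    assume "fract_poly p dvd fract_poly q"
    then obtain c where c: "q = p * c" using fract_poly_dvd_iff[OF assms(1)] by blast
    from irreducibleD[OF assms(4) this] have "c dvd 1"
      using irreducible_not_unit[OF assms(2)] by blast
    moreover have "Polynomial.lead_coeff c = 1"
      using arg_cong[OF c, of Polynomial.lead_coeff] assms by (simp add: lead_coeff_mult)
    ultimately have "c = 1"
      by (metis degree_eq_zeroE lead_coeff_pCons(2) one_pCons poly_dvd_1)
    with c show False using assms by simp
  qed
qed

end
end

section \<open>Subrings of a field and their integral closures\<close>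

lemma ring_of_type_simps [simp]:
  "carrier ring_of_type_algebra = UNIV"
  "x \<otimes>\<^bsub>ring_of_type_algebra\<^esub> y = x * y"
  "\<one>\<^bsub>ring_of_type_algebra\<^esub> = 1"
  "\<zero>\<^bsub>ring_of_type_algebra\<^esub> = 0"
  "x \<oplus>\<^bsub>ring_of_type_algebra\<^esub> y = x + y"
  by (simp_all add: ring_of_type_algebra_def)

lemma ring_of_type_power [simp]:
  "x [^]\<^bsub>ring_of_type_algebra\<^esub> (n::nat) = x ^ n"
  by (induction n) (simp_all add: nat_pow_def power_commutes)

lemma ring_of_type_finsum [simp]:
  fixes f :: "nat \<Rightarrow> 'a::comm_ring_1"
  shows "finsum ring_of_type_algebra f {..<n} = sum f {..<n}"
proof -
  interpret cring "ring_of_type_algebra :: 'a ring" by (rule cring_from_type_algebra)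
  show ?thesis by (induction n) (auto simp: lessThan_Suc)
qed

lemma ring_of_type_uminus [simp]:
  fixes x :: "'a::comm_ring_1"
  shows "\<ominus>\<^bsub>ring_of_type_algebra\<^esub> x = - x"
proof -
  interpret cring "ring_of_type_algebra :: 'a ring" by (rule cring_from_type_algebra)
  show ?thesis by (rule sum_zero_eq_neg[symmetric]) auto
qed

lemma ring_of_type_inverse:
  fixes x :: "'a::field"
  assumes "x \<noteq> 0"
  shows "inv\<^bsub>ring_of_type_algebra\<^esub> x = inverse x"
proof -
  interpret cring "ring_of_type_algebra :: 'a ring" by (rule cring_from_type_algebra)
  show ?thesis by (rule comm_inv_char) (use assms in auto)
qed

lemma integral_closure_ring_of_type:
  fixes R :: "'a::comm_ring_1 set"
  shows "integral_closure ring_of_type_algebra R =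
    {x. \<exists>(n::nat) a. (\<forall>i<n. a i \<in> R) \<and> x ^ n + (\<Sum>i<n. a i * x ^ i) = 0}"
  unfolding integral_closure_def by simp

lemma (in domain_in_field) integral_closure_range:
  "integral_closure ring_of_type_algebra (range \<phi>) = {x. integral x}"
proof (intro Set.set_eqI iffI)
  fix x assume "x \<in> integral_closure ring_of_type_algebra (range \<phi>)"
  then obtain n :: nat and c where c: "\<forall>i<n. c i \<in> range \<phi>"
    and eq: "x ^ n + (\<Sum>i<n. c i * x ^ i) = 0"
    unfolding integral_closure_ring_of_type mem_Collect_eq by iprover
  have "integral (c i)" if "i < n" for i
  proof -
    from c that obtain d where "c i = \<phi> d" by blast
    then show ?thesis by simp
  qed
  from integral_trans[OF this eq] show "x \<in> {x. integral x}" by simp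
next
  fix x assume "x \<in> {x. integral x}"
  then obtain n :: nat and a where "x ^ n + (\<Sum>i<n. \<phi> (a i) * x ^ i) = 0"
    unfolding integral_iff_equation by blast
  then show "x \<in> integral_closure ring_of_type_algebra (range \<phi>)"
    unfolding integral_closure_ring_of_type
    by (intro CollectI exI[of _ n] exI[of _ "\<lambda>i. \<phi> (a i)"]) simp
qed

lemma quot_field_in_ring_of_type:
  fixes R :: "'a::field set"
  shows "quot_field_in ring_of_type_algebra R = {a / b | a b. a \<in> R \<and> b \<in> R \<and> b \<noteq> 0}"
  unfolding quot_field_in_def by (auto simp: ring_of_type_inverse divide_inverse) (metis ring_of_type_inverse)+

lemma subdomain_ring_of_type:
  fixes R :: "'a::field set"
  assumes "1 \<in> R" "\<And>x y. x \<in> R \<Longrightarrow> y \<in> R \<Longrightarrow> x - y \<in> R"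
    and "\<And>x y. x \<in> R \<Longrightarrow> y \<in> R \<Longrightarrow> x * y \<in> R"
  shows "subdomain R ring_of_type_algebra"
proof -
  interpret F: Ring.field "ring_of_type_algebra :: 'a ring" by (rule field_from_type_algebra)
  have 0: "0 \<in> R" using assms(1) assms(2)[of 1 1] by simp
  then have neg: "- x \<in> R" if "x \<in> R" for x using assms(2)[OF 0 that] by simp
  then have "x + y \<in> R" if "x \<in> R" "y \<in> R" for x y using assms(2)[OF that(1), of "- y"] that by simp
  then show ?thesis
    using assms neg by (intro F.subdomainI' F.subringI) auto
qed

lemma subdomain_ring_of_typeD:
  fixes R :: "'a::field set"
  assumes "subdomain R ring_of_type_algebra"
  shows "0 \<in> R" "1 \<in> R" "\<And>x y. x \<in> R \<Longrightarrow> y \<in> R \<Longrightarrow> x + y \<in> R"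
    "\<And>x y. x \<in> R \<Longrightarrow> y \<in> R \<Longrightarrow> x - y \<in> R" "\<And>x y. x \<in> R \<Longrightarrow> y \<in> R \<Longrightarrow> x * y \<in> R"
    "\<And>x. x \<in> R \<Longrightarrow> - x \<in> R"
proof -
  interpret F: Ring.field "ring_of_type_algebra :: 'a ring" by (rule field_from_type_algebra)
  note E = subdomainE[OF assms]
  show "0 \<in> R" "1 \<in> R" and mult: "\<And>x y. x \<in> R \<Longrightarrow> y \<in> R \<Longrightarrow> x * y \<in> R"
    and add: "\<And>x y. x \<in> R \<Longrightarrow> y \<in> R \<Longrightarrow> x + y \<in> R" and neg: "\<And>x. x \<in> R \<Longrightarrow> - x \<in> R"
    using E by auto
  show "\<And>x y. x \<in> R \<Longrightarrow> y \<in> R \<Longrightarrow> x - y \<in> R" using add neg by force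
qed

lemma integrally_closed_domain_if_quotients_everything:
  fixes R :: "'a::field set"
  assumes "subdomain R ring_of_type_algebra"
    and "\<And>x. \<exists>a\<in>R. \<exists>b\<in>R. b \<noteq> 0 \<and> x = a / b"
  shows "integrally_closed_domain ring_of_type_algebra R \<longleftrightarrow>
    integral_closure ring_of_type_algebra R = R"
proof -
  have quot: "quot_field_in ring_of_type_algebra R = UNIV"
    unfolding quot_field_in_ring_of_type using assms(2) by blast
  have carrier: "(ring_of_type_algebra :: 'a ring)\<lparr>carrier := UNIV\<rparr> = ring_of_type_algebra"
    by (simp add: ring_of_type_algebra_def)
  show ?thesis unfolding integrally_closed_domain_def quot carrier using assms(1) by blast
qed

lemma subdomain_range_to_fract:
  "subdomain (range (to_fract :: 'd::idom \<Rightarrow> 'd fract)) ring_of_type_algebra"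
proof (rule subdomain_ring_of_type)
  show "1 \<in> range (to_fract :: 'd \<Rightarrow> 'd fract)" using to_fract_1 by (metis rangeI)
qed (auto simp flip: to_fract_mult to_fract_diff)

lemma integrally_closed_range_to_fract_iff:
  "integrally_closed_domain ring_of_type_algebra (range (to_fract :: 'd::idom \<Rightarrow> 'd fract)) \<longleftrightarrow>
   (\<forall>x :: 'd fract. quotient_field.integral x \<longrightarrow> x \<in> range to_fract)"
proof -
  have "\<exists>a\<in>range to_fract. \<exists>b\<in>range to_fract. b \<noteq> 0 \<and> x = a / b" for x :: "'d fract"
    using fract_as_quotient[of x] by auto
  from integrally_closed_domain_if_quotients_everything[OF subdomain_range_to_fract this]
  show ?thesis unfolding quotient_field.integral_closure_range by auto
qed

lemma field_ring_of_type_if_units: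
  assumes "\<And>d :: 'd::idom. d \<noteq> 0 \<Longrightarrow> d dvd 1"
  shows "Ring.field (ring_of_type_algebra :: 'd ring)"
proof -
  interpret cring "ring_of_type_algebra :: 'd ring" by (rule cring_from_type_algebra)
  have "x \<in> Units ring_of_type_algebra \<longleftrightarrow> x \<noteq> 0" for x :: 'd
  proof
    assume "x \<noteq> 0"
    then obtain y where "1 = x * y" using assms by (metis dvdE)
    then show "x \<in> Units ring_of_type_algebra"
      unfolding Units_def by (auto simp: mult.commute intro!: exI[of _ y])
  qed (auto simp: Units_def)
  then show ?thesis by (intro cring_fieldI) auto
qed

section \<open>The integral closure of \<open>D(p)\<close>\<close>

lemma D_ring_closed:
  shows "1 \<in> D_ring p" "\<And>f g. f \<in> D_ring p \<Longrightarrow> g \<in> D_ring p \<Longrightarrow> f - g \<in> D_ring p"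
    "\<And>f g. f \<in> D_ring p \<Longrightarrow> g \<in> D_ring p \<Longrightarrow> f * g \<in> D_ring p"
    "fract_poly r \<in> D_ring p" "fract_poly p * q \<in> D_ring p"
proof -
  show r: "fract_poly r \<in> D_ring p" for r
    unfolding D_ring_def by (intro CollectI exI[of _ r] exI[of _ 0]) simp
  show "1 \<in> D_ring p" using r[of 1] by simp
  show "fract_poly p * q \<in> D_ring p"
    unfolding D_ring_def by (intro CollectI exI[of _ 0] exI[of _ q]) simp
  fix f g assume "f \<in> D_ring p" "g \<in> D_ring p"
  then obtain r q r' q' where f: "f = fract_poly r + fract_poly p * q"
    and g: "g = fract_poly r' + fract_poly p * q'" unfolding D_ring_def by blast
  show "f - g \<in> D_ring p"
    unfolding D_ring_def f g
    by (intro CollectI exI[of _ "r - r'"] exI[of _ "q - q'"]) (simp add: algebra_simps)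
  show "f * g \<in> D_ring p"
    unfolding D_ring_def f g
    by (intro CollectI exI[of _ "r * r'"] exI[of _ "q * fract_poly r' + q' * fract_poly r + fract_poly p * q * q'"])
       (simp add: algebra_simps)
qed

lemma subdomain_D_ring: "subdomain (to_fract ` D_ring p) ring_of_type_algebra"
proof (rule subdomain_ring_of_type)
  show "1 \<in> to_fract ` D_ring p" using D_ring_closed(1) to_fract_1 by (metis image_eqI)
qed (auto simp: D_ring_closed simp flip: to_fract_mult to_fract_diff)

text \<open>
  Expanding a fraction by \<open>p\<close> moves numerator and denominator into \<open>pK[X]\<close>.
\<close>

lemma D_ring_quotients:
  assumes "p \<noteq> 0"
  shows "\<exists>a\<in>to_fract ` D_ring p. \<exists>b\<in>to_fract ` D_ring p. b \<noteq> 0 \<and> x = a / b"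
proof -
  obtain a b where b: "b \<noteq> 0" and x: "x = to_fract a / to_fract b"
    using fract_as_quotient by blast
  have "x = to_fract (fract_poly p * a) / to_fract (fract_poly p * b)"
    using assms by (simp add: x)
  moreover have "to_fract (fract_poly p * b) \<noteq> 0" using assms b by simp
  ultimately show ?thesis using D_ring_closed(5) by blast
qed

context algebraic_closure_of_fractions
begin

text \<open>
  The central identification. The inclusion from left to right uses transitivity of integrality, since the
  coefficients of an equation over \<open>D(p)\<close> have values in \<open>D[\<alpha>]\<close> at a root \<open>\<alpha>\<close>. Conversely, a monic
  equation modulo \<open>p\<close> becomes an equation over \<open>D(p)\<close> after subtracting the multiple of \<open>p\<close> from its
  constant coefficient.
\<close>

lemma integral_closure_D_ring:
  assumes p: "Polynomial.lead_coeff p = 1" and deg: "Polynomial.degree p > 0"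
  shows "integral_closure ring_of_type_algebra (to_fract ` D_ring p) =
    to_fract ` int_valued_at_roots p"
proof (intro Set.set_eqI iffI)
  fix x assume "x \<in> integral_closure ring_of_type_algebra (to_fract ` D_ring p)"
  then obtain n :: nat and b where b: "\<forall>i<n. b i \<in> to_fract ` D_ring p"
    and eq: "x ^ n + (\<Sum>i<n. b i * x ^ i) = 0"
    unfolding integral_closure_ring_of_type by blast
  then have "\<forall>i<n. \<exists>c. c \<in> D_ring p \<and> b i = to_fract c" by auto
  then obtain c where c: "\<And>i. i < n \<Longrightarrow> c i \<in> D_ring p" "\<And>i. i < n \<Longrightarrow> b i = to_fract (c i)"
    by metis
  have eq: "x ^ n + (\<Sum>i<n. to_fract (c i) * x ^ i) = 0"
    using eq c(2) by simp
  then obtain f where f: "x = to_fract f" using field_poly_integrally_closed by blast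
  have "to_fract (f ^ n + (\<Sum>i<n. c i * f ^ i)) = 0"
    using eq by (simp add: f quotient_field.hom_power)
  then have eq: "f ^ n + (\<Sum>i<n. c i * f ^ i) = 0" by (simp only: to_fract_eq_0_iff)
  have "f \<in> int_valued_at_roots p" unfolding int_valued_at_roots_def
  proof (intro CollectI allI impI)
    fix \<alpha> assume \<alpha>: "ev (fract_poly p) \<alpha> = 0"
    show "D.integral (ev f \<alpha>)"
    proof (rule D.integral_trans)
      show "D.integral (ev (c i) \<alpha>)" if "i < n" for i
        using c(1)[OF that] D_ring_subset_int_valued[OF p] \<alpha> unfolding int_valued_at_roots_def by blast
      show "ev f \<alpha> ^ n + (\<Sum>i<n. ev (c i) \<alpha> * ev f \<alpha> ^ i) = 0"
        using arg_cong[OF eq, of "\<lambda>h. ev h \<alpha>"] by (simp add: \<iota>_poly.hom_sum poly_sum)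
    qed
  qed
  then show "x \<in> to_fract ` int_valued_at_roots p" using f by blast
next
  fix x assume "x \<in> to_fract ` int_valued_at_roots p"
  then obtain f where f: "f \<in> int_valued_at_roots p" and x: "x = to_fract f" by blast
  obtain G where G: "Polynomial.lead_coeff G = 1" and dvd: "fract_poly p dvd fract_poly G \<circ>\<^sub>p f"
    using monic_equation_mod_if_int_valued[OF p f] by blast
  define n where "n = Polynomial.degree G"
  obtain q where q: "f ^ n + (\<Sum>i<n. [:to_fract (Polynomial.coeff G i):] * f ^ i) = fract_poly p * q"
    using dvd unfolding pcompose_monic[OF G] n_def by blast
  have n: "n > 0"
  proof (rule ccontr)
    assume "\<not> n > 0"
    then have "fract_poly p * q = 1" using q by simp
    then have "fract_poly p dvd 1" by (metis dvd_triv_left)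
    then have "Polynomial.degree p = 0" using poly_dvd_1 by fastforce
    with deg show False by simp
  qed
  \<comment> \<open>Only the constant coefficient absorbs \<open>p q\<close>; it exists because the degree \<open>n\<close> is positive.\<close>
  define c where "c = (\<lambda>i. [:to_fract (Polynomial.coeff G i):] - (if i = 0 then fract_poly p * q else 0))"
  have "c i \<in> D_ring p" for i
  proof -
    have "fract_poly [:Polynomial.coeff G i:] - fract_poly p * (if i = 0 then q else 0) \<in> D_ring p"
      by (intro D_ring_closed)
    then show ?thesis by (auto simp: c_def fract_poly_const split: if_splits)
  qed
  moreover have "to_fract f ^ n + (\<Sum>i<n. to_fract (c i) * to_fract f ^ i) = 0"
  proof -
    have "(\<Sum>i<n. c i * f ^ i) = (\<Sum>i<n. [:to_fract (Polynomial.coeff G i):] * f ^ i) -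
        (\<Sum>i<n. (if i = 0 then fract_poly p * q else 0))"
      by (subst sum_subtractf[symmetric]) (auto simp: c_def algebra_simps intro!: sum.cong)
    also have "(\<Sum>i<n. (if i = 0 then fract_poly p * q else 0)) = fract_poly p * q"
      using n by simp
    finally have "f ^ n + (\<Sum>i<n. c i * f ^ i) =
        f ^ n + (\<Sum>i<n. [:to_fract (Polynomial.coeff G i):] * f ^ i) - fract_poly p * q"
      by (simp only: add_diff_eq)
    then have "f ^ n + (\<Sum>i<n. c i * f ^ i) = 0" by (simp only: q diff_self)
    then have "to_fract (f ^ n + (\<Sum>i<n. c i * f ^ i)) = 0" by simp
    then show ?thesis by (simp add: quotient_field.hom_power)
  qed
  ultimately show "x \<in> integral_closure ring_of_type_algebra (to_fract ` D_ring p)"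
    unfolding integral_closure_ring_of_type x
    by (intro CollectI exI[of _ n] exI[of _ "\<lambda>i. to_fract (c i)"]) auto
qed

lemma D_ring_integrally_closed_iff:
  assumes p: "Polynomial.lead_coeff p = 1" and deg: "Polynomial.degree p > 0"
  shows "integrally_closed_domain ring_of_type_algebra (to_fract ` D_ring p) \<longleftrightarrow>
    int_valued_at_roots p \<subseteq> D_ring p"
proof -
  have "p \<noteq> 0" using deg by auto
  from integrally_closed_domain_if_quotients_everything[OF subdomain_D_ring D_ring_quotients[OF this]]
  have "integrally_closed_domain ring_of_type_algebra (to_fract ` D_ring p) \<longleftrightarrow>
      to_fract ` int_valued_at_roots p = to_fract ` D_ring p"
    unfolding integral_closure_D_ring[OF assms] .
  also have "\<dots> \<longleftrightarrow> int_valued_at_roots p = D_ring p"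
    by (rule inj_image_eq_iff) (auto simp: inj_def)
  finally show ?thesis using D_ring_subset_int_valued[OF p] by auto
qed

end

section \<open>Passing between a polynomial and its factors\<close>

context algebraic_closure_of_fractions
begin

text \<open>
  Nilpotents modulo \<open>p\<close> are integral whatever their denominators are, whereas an element of \<open>D(p)\<close> of
  degree below that of \<open>p\<close> has no denominator at all.
\<close>

lemma square_factor_imp_units:
  fixes p P :: "'d poly"
  assumes p: "Polynomial.lead_coeff p = 1" and P: "Polynomial.lead_coeff P = 1"
    and deg: "Polynomial.degree P > 0"
    and sq: "P * P dvd p" and closed: "int_valued_at_roots p \<subseteq> D_ring p"
    and d: "d \<noteq> (0 :: 'd)"
  shows "d dvd 1"
proof -
  obtain c where c: "p = P * P * c" using sq by blast
  define q where "q = P * c"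
  have pq: "p = P * q" by (simp add: c q_def mult.assoc)
  have q: "Polynomial.lead_coeff q = 1"
    using arg_cong[OF pq, of Polynomial.lead_coeff] p P by (simp add: lead_coeff_mult)
  have "P \<noteq> 0" "q \<noteq> 0" using P q by (metis leading_coeff_0_iff zero_neq_one)+
  then have degq: "Polynomial.degree q < Polynomial.degree p"
    using deg by (simp add: pq degree_mult_eq)
  \<comment> \<open>\<open>q = p/P\<close> has the same roots as \<open>p\<close>, so \<open>q/d\<close> has the value \<open>0\<close> at each of them.\<close>
  define f where "f = Polynomial.smult (inverse (to_fract d)) (fract_poly q)"
  have "f \<in> int_valued_at_roots p" unfolding int_valued_at_roots_def
  proof (intro CollectI allI impI)
    fix \<alpha> assume "ev (fract_poly p) \<alpha> = 0"
    then have "ev (fract_poly P) \<alpha> = 0 \<or> ev (fract_poly c) \<alpha> = 0"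
      by (simp add: c)
    then have "ev (fract_poly q) \<alpha> = 0" by (auto simp: q_def)
    then show "D.integral (ev f \<alpha>)" by (simp add: f_def)
  qed
  then have "f \<in> D_ring p" using closed by blast
  then obtain r where r: "fract_poly p dvd f - fract_poly r" unfolding D_ring_iff by blast
  obtain s r0 where r0: "r = p * s + r0" "r0 = 0 \<or> Polynomial.degree r0 < Polynomial.degree p"
    using monic_division[OF p] by blast
  have "f - fract_poly r0 = (f - fract_poly r) + fract_poly p * fract_poly s"
    by (simp add: r0)
  then have dvd: "fract_poly p dvd f - fract_poly r0" using r by (metis dvd_add dvd_triv_left)
  have "Polynomial.degree f < Polynomial.degree p"
    unfolding f_def by (rule le_less_trans[OF degree_smult_le]) (simp add: degq)
  then have "Polynomial.degree (f - fract_poly r0) < Polynomial.degree (fract_poly p)"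
    using r0(2) degq by (auto intro: degree_diff_less)
  then have "f - fract_poly r0 = 0" using dvd by (metis dvd_imp_degree_le not_le)
  then have "Polynomial.smult (to_fract d) f = fract_poly (Polynomial.smult d r0)"
    by simp
  then have "fract_poly q = fract_poly (Polynomial.smult d r0)"
    using d by (simp add: f_def)
  then have "q = Polynomial.smult d r0" by (simp only: fract_poly_eq_iff)
  then have "Polynomial.lead_coeff q = d * Polynomial.lead_coeff r0"
    by (simp only: lead_coeff_smult)
  then have "1 = d * Polynomial.lead_coeff r0" unfolding q .
  then show ?thesis by (rule dvdI)
qed

lemma ev_prod_eq_0_iff:
  assumes "finite I"
  shows "ev (fract_poly (\<Prod>i\<in>I. P i)) \<alpha> = 0 \<longleftrightarrow> (\<exists>i\<in>I. ev (fract_poly (P i)) \<alpha> = 0)"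
  using assms by (induction I rule: finite_induct) simp_all

text \<open>
  Given \<open>f\<close> integral at the roots of \<open>P i\<close>, the polynomial congruent to \<open>f\<close> modulo \<open>P i\<close> and to \<open>0\<close> modulo
  the other factors is integral at all roots of the product.
\<close>

lemma closed_prod_imp_closed_factor:
  assumes I: "finite I" "i \<in> I"
    and co: "\<And>i j. i \<in> I \<Longrightarrow> j \<in> I \<Longrightarrow> i \<noteq> j \<Longrightarrow> comaximal (fract_poly (P i)) (fract_poly (P j))"
    and closed: "int_valued_at_roots (\<Prod>i\<in>I. P i) \<subseteq> D_ring (\<Prod>i\<in>I. P i)"
  shows "int_valued_at_roots (P i) \<subseteq> D_ring (P i)"
proof
  fix f assume f: "f \<in> int_valued_at_roots (P i)"
  have "\<exists>x. \<forall>j\<in>I. fract_poly (P j) dvd x - (if j = i then f else 0)"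
    by (rule chinese_remainder_comaximal[OF I(1)]) (rule co)
  then obtain x where x: "\<forall>j\<in>I. fract_poly (P j) dvd x - (if j = i then f else 0)" ..
  have "x \<in> int_valued_at_roots (\<Prod>i\<in>I. P i)"
    unfolding int_valued_at_roots_def ev_prod_eq_0_iff[OF I(1)]
  proof (intro CollectI allI impI)
    fix \<alpha> assume "\<exists>j\<in>I. ev (fract_poly (P j)) \<alpha> = 0"
    then obtain j where j: "j \<in> I" "ev (fract_poly (P j)) \<alpha> = 0" by blast
    then obtain c where "x - (if j = i then f else 0) = fract_poly (P j) * c" using x by blast
    then have "ev (x - (if j = i then f else 0)) \<alpha> = 0" using j(2) by simp
    then show "D.integral (ev x \<alpha>)"
      using f j(2) unfolding int_valued_at_roots_def by (auto split: if_splits)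
  qed
  then obtain r where r: "fract_poly (\<Prod>i\<in>I. P i) dvd x - fract_poly r"
    using closed D_ring_iff by blast
  have "fract_poly (P i) dvd fract_poly (\<Prod>i\<in>I. P i)"
    unfolding fract_poly_prod using I by (rule dvd_prodI)
  then have "fract_poly (P i) dvd x - fract_poly r" using r by (rule dvd_trans)
  moreover have "fract_poly (P i) dvd x - f" using x I(2) by force
  ultimately have "fract_poly (P i) dvd (x - fract_poly r) - (x - f)" by (rule dvd_diff)
  then show "f \<in> D_ring (P i)" unfolding D_ring_iff by auto
qed

text \<open>
  The idempotent that is \<open>1\<close> modulo \<open>P i\<close> and \<open>0\<close> modulo the other factors has the integral values \<open>0\<close>
  and \<open>1\<close>. A representative \<open>r\<close> of it in \<open>D[X]\<close> is \<open>1\<close> modulo \<open>P i\<close> and \<open>0\<close> modulo \<open>P j\<close>.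
\<close>

lemma closed_prod_imp_comaximal:
  assumes I: "finite I" "i \<in> I" "j \<in> I" "i \<noteq> j"
    and co: "\<And>i j. i \<in> I \<Longrightarrow> j \<in> I \<Longrightarrow> i \<noteq> j \<Longrightarrow> comaximal (fract_poly (P i)) (fract_poly (P j))"
    and monic: "\<And>i. i \<in> I \<Longrightarrow> Polynomial.lead_coeff (P i) = 1"
    and closed: "int_valued_at_roots (\<Prod>i\<in>I. P i) \<subseteq> D_ring (\<Prod>i\<in>I. P i)"
  shows "comaximal (P i) (P j)"
proof -
  have "\<exists>x. \<forall>j\<in>I. fract_poly (P j) dvd x - (if j = i then 1 else 0)"
    by (rule chinese_remainder_comaximal[OF I(1)]) (rule co)
  then obtain x where x: "\<forall>j\<in>I. fract_poly (P j) dvd x - (if j = i then 1 else 0)" ..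
  have "x \<in> int_valued_at_roots (\<Prod>i\<in>I. P i)"
    unfolding int_valued_at_roots_def ev_prod_eq_0_iff[OF I(1)]
  proof (intro CollectI allI impI)
    fix \<alpha> assume "\<exists>j\<in>I. ev (fract_poly (P j)) \<alpha> = 0"
    then obtain j where j: "j \<in> I" "ev (fract_poly (P j)) \<alpha> = 0" by blast
    then obtain c where "x - (if j = i then 1 else 0) = fract_poly (P j) * c" using x by blast
    then have "ev (x - (if j = i then 1 else 0)) \<alpha> = 0" using j(2) by simp
    then show "D.integral (ev x \<alpha>)" by (auto split: if_splits)
  qed
  then obtain r where r: "fract_poly (\<Prod>i\<in>I. P i) dvd x - fract_poly r"
    using closed D_ring_iff by blast
  have dvd: "fract_poly (P l) dvd x - fract_poly r" if "l \<in> I" for l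
    by (rule dvd_trans[OF _ r]) (unfold fract_poly_prod, rule dvd_prodI[OF I(1) that])
  have "fract_poly (P i) dvd x - 1" using x I(2) by force
  from dvd_diff[OF this dvd[OF I(2)]] have "fract_poly (P i) dvd fract_poly (r - 1)" by simp
  then obtain s where s: "r - 1 = P i * s"
    unfolding fract_poly_dvd_iff[OF monic[OF I(2)]] by blast
  have "fract_poly (P j) dvd x" using x I(3,4) by force
  from dvd_diff[OF this dvd[OF I(3)]] have "fract_poly (P j) dvd fract_poly r" by simp
  then obtain t where t: "r = P j * t"
    unfolding fract_poly_dvd_iff[OF monic[OF I(3)]] by blast
  have "(- s) * P i + t * P j = P j * t - P i * s" by (simp add: mult.commute)
  also have "\<dots> = 1" unfolding s[symmetric] t[symmetric] by simp
  finally show ?thesis by (rule comaximalI)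
qed

text \<open>
  Representatives in \<open>D[X]\<close> modulo the factors are glued in \<open>D[X]\<close>. The result is a representative modulo
  the product because the factors are comaximal in \<open>K[X]\<close>.
\<close>

lemma closed_prod_if_closed_factors:
  assumes I: "finite I"
    and coK: "\<And>i j. i \<in> I \<Longrightarrow> j \<in> I \<Longrightarrow> i \<noteq> j \<Longrightarrow> comaximal (fract_poly (P i)) (fract_poly (P j))"
    and co: "\<And>i j. i \<in> I \<Longrightarrow> j \<in> I \<Longrightarrow> i \<noteq> j \<Longrightarrow> comaximal (P i) (P j)"
    and closed: "\<And>i. i \<in> I \<Longrightarrow> int_valued_at_roots (P i) \<subseteq> D_ring (P i)"
  shows "int_valued_at_roots (\<Prod>i\<in>I. P i) \<subseteq> D_ring (\<Prod>i\<in>I. P i)"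
proof
  fix f assume "f \<in> int_valued_at_roots (\<Prod>i\<in>I. P i)"
  then have "f \<in> int_valued_at_roots (P i)" if "i \<in> I" for i
    using that unfolding int_valued_at_roots_def ev_prod_eq_0_iff[OF I] by blast
  then have "\<forall>i\<in>I. \<exists>r. fract_poly (P i) dvd f - fract_poly r"
    using closed D_ring_iff by blast
  then obtain r where r: "\<And>i. i \<in> I \<Longrightarrow> fract_poly (P i) dvd f - fract_poly (r i)" by metis
  have "\<exists>x. \<forall>i\<in>I. P i dvd x - r i"
    by (rule chinese_remainder_comaximal[OF I]) (rule co)
  then obtain x where x: "\<forall>i\<in>I. P i dvd x - r i" ..
  have dvd: "fract_poly (P i) dvd f - fract_poly x" if "i \<in> I" for i
  proof -
    have "fract_poly (P i) dvd fract_poly (x - r i)" using x that fract_poly_dvd by blast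
    from dvd_diff[OF r[OF that] this] show ?thesis by simp
  qed
  have "fract_poly (\<Prod>i\<in>I. P i) dvd f - fract_poly x"
    unfolding fract_poly_prod
    by (rule prod_dvd_if_comaximal[OF I]) (rule coK, assumption+, rule dvd)
  then show "f \<in> D_ring (\<Prod>i\<in>I. P i)" unfolding D_ring_iff by blast
qed

end

section \<open>Residue class rings\<close>

lemma principal_coset:
  fixes a f :: "'a::comm_ring_1"
  shows "(PIdl\<^bsub>ring_of_type_algebra\<^esub> a) +>\<^bsub>ring_of_type_algebra\<^esub> f = {h. a dvd h - f}"
proof -
  have "PIdl\<^bsub>ring_of_type_algebra\<^esub> a = {x. a dvd x}"
    unfolding cgenideal_def by (auto simp: dvd_def mult.commute)
  then have "(PIdl\<^bsub>ring_of_type_algebra\<^esub> a) +>\<^bsub>ring_of_type_algebra\<^esub> f = {h. \<exists>x. a dvd x \<and> h = x + f}"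
    unfolding a_r_coset_def r_coset_def by auto
  moreover have "(\<exists>x. a dvd x \<and> h = x + f) \<longleftrightarrow> a dvd h - f" for h
  proof
    assume "a dvd h - f"
    then show "\<exists>x. a dvd x \<and> h = x + f" by (intro exI[of _ "h - f"]) simp
  qed auto
  ultimately show ?thesis by simp
qed

lemma principal_coset_eq_iff:
  fixes a f g :: "'a::comm_ring_1"
  shows "{h. a dvd h - f} = {h. a dvd h - g} \<longleftrightarrow> a dvd f - g"
proof
  assume "{h. a dvd h - f} = {h. a dvd h - g}"
  then have "f \<in> {h. a dvd h - g}" by auto
  then show "a dvd f - g" by simp
next
  assume fg: "a dvd f - g"
  have "a dvd h - f \<longleftrightarrow> a dvd h - g" for h
    using dvd_add_left_iff[OF fg, of "h - f"] by simp
  then show "{h. a dvd h - f} = {h. a dvd h - g}" by simp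
qed

lemma K_class_eq: "K_class p f = {h. fract_poly p dvd h - f}"
  unfolding K_class_def principal_coset ..

lemma K_class_eq_iff: "K_class p f = K_class p g \<longleftrightarrow> fract_poly p dvd f - g"
  unfolding K_class_eq principal_coset_eq_iff ..

lemma principal_ideal_hom:
  fixes a :: "'a::comm_ring_1"
  shows "ring_hom_ring ring_of_type_algebra
    (ring_of_type_algebra Quot (PIdl\<^bsub>ring_of_type_algebra\<^esub> a))
    ((+>\<^bsub>ring_of_type_algebra\<^esub>) (PIdl\<^bsub>ring_of_type_algebra\<^esub> a))"
proof -
  interpret cring "ring_of_type_algebra :: 'a ring" by (rule cring_from_type_algebra)
  have "ideal (PIdl\<^bsub>ring_of_type_algebra\<^esub> a) ring_of_type_algebra"
    by (rule cgenideal_ideal) simp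
  then show ?thesis by (rule ideal.rcos_ring_hom_ring)
qed

lemma K_class_hom: "ring_hom_ring ring_of_type_algebra (K_quot p) (K_class p)"
proof -
  have "K_class p = (+>\<^bsub>ring_of_type_algebra\<^esub>) (PIdl\<^bsub>ring_of_type_algebra\<^esub> (fract_poly p))"
    by (rule ext) (simp add: K_class_def)
  then show ?thesis unfolding K_quot_def using principal_ideal_hom by metis
qed

lemma carrier_K_quot: "carrier (K_quot p) = range (K_class p)"
  unfolding K_quot_def FactRing_def A_RCOSETS_def' K_class_def by auto

text \<open>
  The class map is a ring homomorphism, so an equation in \<open>K[X]/(p)\<close> is a congruence modulo \<open>p\<close>.
\<close>

lemma K_quot_equation:
  "K_class p f [^]\<^bsub>K_quot p\<^esub> n \<oplus>\<^bsub>K_quot p\<^esub>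
     (\<Oplus>\<^bsub>K_quot p\<^esub>i\<in>{..<n}. K_class p (c i) \<otimes>\<^bsub>K_quot p\<^esub> K_class p f [^]\<^bsub>K_quot p\<^esub> i) =
   K_class p (f ^ n + (\<Sum>i<n. c i * f ^ i))"
proof -
  interpret h: ring_hom_ring ring_of_type_algebra "K_quot p" "K_class p" by (rule K_class_hom)
  have pow: "K_class p f [^]\<^bsub>K_quot p\<^esub> i = K_class p (f ^ i)" for i :: nat
    using h.hom_nat_pow[of f i] by simp
  have mult: "K_class p g \<otimes>\<^bsub>K_quot p\<^esub> K_class p g' = K_class p (g * g')" for g g'
    using h.hom_mult[of g g'] by simp
  have add: "K_class p g \<oplus>\<^bsub>K_quot p\<^esub> K_class p g' = K_class p (g + g')" for g g'
    using h.hom_add[of g g'] by simp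
  have sum: "(\<Oplus>\<^bsub>K_quot p\<^esub>i\<in>{..<n}. K_class p (g i)) = K_class p (\<Sum>i<n. g i)" for g
    using h.hom_finsum[of g "{..<n}"] by (simp add: o_def)
  show ?thesis unfolding pow mult sum add ..
qed

lemma K_quot_zero: "\<zero>\<^bsub>K_quot p\<^esub> = K_class p 0"
proof -
  interpret h: ring_hom_ring ring_of_type_algebra "K_quot p" "K_class p" by (rule K_class_hom)
  show ?thesis using h.hom_zero by simp
qed

context algebraic_closure_of_fractions
begin

text \<open>
  An integral equation over \<open>D\<close> in the residue ring is a monic equation modulo \<open>p\<close>, hence equivalent to
  integral values at the roots.
\<close>

lemma integral_closure_K_quot:
  assumes p: "Polynomial.lead_coeff p = 1"
  shows "integral_closure (K_quot p) (range (\<lambda>d. K_class p [:to_fract d:])) =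
    K_class p ` int_valued_at_roots p"
proof (intro Set.set_eqI iffI)
  fix x assume "x \<in> integral_closure (K_quot p) (range (\<lambda>d. K_class p [:to_fract d:]))"
  then obtain n :: nat and a where x: "x \<in> carrier (K_quot p)"
    and a: "\<forall>i<n. a i \<in> range (\<lambda>d. K_class p [:to_fract d:])"
    and eq: "x [^]\<^bsub>K_quot p\<^esub> n \<oplus>\<^bsub>K_quot p\<^esub> (\<Oplus>\<^bsub>K_quot p\<^esub>i\<in>{..<n}. a i \<otimes>\<^bsub>K_quot p\<^esub> x [^]\<^bsub>K_quot p\<^esub> i) =
       \<zero>\<^bsub>K_quot p\<^esub>"
    unfolding integral_closure_def mem_Collect_eq by iprover
  obtain f where f: "x = K_class p f" using x unfolding carrier_K_quot by blast
  have "\<forall>i<n. \<exists>d. a i = K_class p [:to_fract d:]" using a by auto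
  then obtain d where d: "\<And>i. i < n \<Longrightarrow> a i = K_class p [:to_fract (d i):]" by metis
  interpret h: ring_hom_ring ring_of_type_algebra "K_quot p" "K_class p" by (rule K_class_hom)
  have "(\<Oplus>\<^bsub>K_quot p\<^esub>i\<in>{..<n}. a i \<otimes>\<^bsub>K_quot p\<^esub> x [^]\<^bsub>K_quot p\<^esub> i) =
      (\<Oplus>\<^bsub>K_quot p\<^esub>i\<in>{..<n}. K_class p [:to_fract (d i):] \<otimes>\<^bsub>K_quot p\<^esub> x [^]\<^bsub>K_quot p\<^esub> i)"
  proof (rule h.S.finsum_cong'[OF refl])
    have "K_class p g \<in> carrier (K_quot p)" for g by (simp add: carrier_K_quot)
    then show "(\<lambda>i. K_class p [:to_fract (d i):] \<otimes>\<^bsub>K_quot p\<^esub> x [^]\<^bsub>K_quot p\<^esub> i) \<in> {..<n} \<rightarrow> carrier (K_quot p)"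
      using x by (intro Pi_I h.S.m_closed h.S.nat_pow_closed)
  qed (simp add: d)
  then have "K_class p (f ^ n + (\<Sum>i<n. [:to_fract (d i):] * f ^ i)) = K_class p 0"
    using eq unfolding f K_quot_zero by (simp only: K_quot_equation)
  then have dvd: "fract_poly p dvd f ^ n + (\<Sum>i<n. [:to_fract (d i):] * f ^ i)"
    unfolding K_class_eq_iff by simp
  obtain G where G: "Polynomial.lead_coeff G = 1" "Polynomial.degree G = n"
      "\<And>i. i < n \<Longrightarrow> Polynomial.coeff G i = d i"
    using monic_poly_with_coeffs by blast
  have "fract_poly p dvd fract_poly G \<circ>\<^sub>p f"
    unfolding pcompose_monic[OF G(1)] G(2) using dvd G(3) by simp
  then show "x \<in> K_class p ` int_valued_at_roots p"
    unfolding f using int_valued_if_monic_equation_mod[OF G(1)] by blast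
next
  fix x assume "x \<in> K_class p ` int_valued_at_roots p"
  then obtain f where f: "f \<in> int_valued_at_roots p" and x: "x = K_class p f" by blast
  obtain G where G: "Polynomial.lead_coeff G = 1" and dvd: "fract_poly p dvd fract_poly G \<circ>\<^sub>p f"
    using monic_equation_mod_if_int_valued[OF p f] by blast
  let ?c = "\<lambda>i. [:to_fract (Polynomial.coeff G i):]" and ?n = "Polynomial.degree G"
  have "K_class p (f ^ ?n + (\<Sum>i<?n. ?c i * f ^ i)) = K_class p 0"
    using dvd unfolding pcompose_monic[OF G] K_class_eq_iff by simp
  then have "x [^]\<^bsub>K_quot p\<^esub> ?n \<oplus>\<^bsub>K_quot p\<^esub>
     (\<Oplus>\<^bsub>K_quot p\<^esub>i\<in>{..<?n}. K_class p (?c i) \<otimes>\<^bsub>K_quot p\<^esub> x [^]\<^bsub>K_quot p\<^esub> i) = \<zero>\<^bsub>K_quot p\<^esub>"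
    unfolding x K_quot_equation K_quot_zero .
  moreover have "x \<in> carrier (K_quot p)" by (simp add: x carrier_K_quot)
  moreover have "\<forall>i<?n. K_class p (?c i) \<in> range (\<lambda>d. K_class p [:to_fract d:])" by blast
  ultimately show "x \<in> integral_closure (K_quot p) (range (\<lambda>d. K_class p [:to_fract d:]))"
    unfolding integral_closure_def
    by (intro CollectI conjI exI[of _ ?n] exI[of _ "\<lambda>i. K_class p (?c i)"])
qed

end

lemma canonical_map_class:
  "canonical_map p ((PIdl\<^bsub>ring_of_type_algebra\<^esub> p) +>\<^bsub>ring_of_type_algebra\<^esub> f) = K_class p (fract_poly f)"
proof -
  have eq: "K_class p (fract_poly h) = K_class p (fract_poly f)" if "p dvd h - f" for h
    unfolding K_class_eq_iff using fract_poly_dvd[OF that] by simp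
  have img: "(\<lambda>h. K_class p (fract_poly h)) ` {h. p dvd h - f} =
      (\<lambda>h. K_class p (fract_poly f)) ` {h. p dvd h - f}"
    by (rule image_cong[OF refl]) (rule eq, drule CollectD, assumption)
  have "f \<in> {h. p dvd h - f}" by simp
  then have "(\<lambda>h. K_class p (fract_poly f)) ` {h. p dvd h - f} = {K_class p (fract_poly f)}"
    by (auto simp only: image_constant_conv empty_iff split: if_split)
  then show ?thesis unfolding canonical_map_def principal_coset img by simp
qed

context algebraic_closure_of_fractions
begin

text \<open>
  The canonical map is always an injective homomorphism for monic \<open>p\<close>; it is onto exactly when each
  \<open>f\<close> with integral values at the roots is congruent modulo \<open>p\<close> to some element of \<open>D[X]\<close>.
\<close>

lemma canonical_map_iso_iff:
  assumes p: "Polynomial.lead_coeff p = 1"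
  shows "canonical_map p \<in> ring_iso (D_quot p) (D_int_closure_quot p) \<longleftrightarrow>
    int_valued_at_roots p \<subseteq> D_ring p"
proof -
  let ?cl = "\<lambda>f. (PIdl\<^bsub>ring_of_type_algebra\<^esub> p) +>\<^bsub>ring_of_type_algebra\<^esub> f"
  interpret DQ: ring_hom_ring ring_of_type_algebra "D_quot p" ?cl
    unfolding D_quot_def by (rule principal_ideal_hom)
  interpret KQ: ring_hom_ring ring_of_type_algebra "K_quot p" "K_class p" by (rule K_class_hom)
  have carrier_D: "carrier (D_quot p) = range ?cl"
    unfolding D_quot_def FactRing_def A_RCOSETS_def' by auto
  have carrier_K: "carrier (D_int_closure_quot p) = K_class p ` int_valued_at_roots p"
    unfolding D_int_closure_quot_def by (simp add: integral_closure_K_quot[OF p])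
  have fract_int: "fract_poly f \<in> int_valued_at_roots p" for f
    using D_ring_subset_int_valued[OF p] D_ring_closed(4) by blast
  have hom: "canonical_map p \<in> Ring.ring_hom (D_quot p) (D_int_closure_quot p)"
  proof (rule ring_hom_memI)
    fix x assume "x \<in> carrier (D_quot p)"
    then obtain f where x: "x = ?cl f" unfolding carrier_D by blast
    show "canonical_map p x \<in> carrier (D_int_closure_quot p)"
      unfolding x canonical_map_class carrier_K using fract_int by blast
    fix y assume "y \<in> carrier (D_quot p)"
    then obtain g where y: "y = ?cl g" unfolding carrier_D by blast
    have "x \<otimes>\<^bsub>D_quot p\<^esub> y = ?cl (f * g)" "x \<oplus>\<^bsub>D_quot p\<^esub> y = ?cl (f + g)"
      using DQ.hom_mult[of f g] DQ.hom_add[of f g] by (simp_all add: x y)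
    moreover have "K_class p (fract_poly f) \<otimes>\<^bsub>K_quot p\<^esub> K_class p (fract_poly g) =
        K_class p (fract_poly (f * g))"
      "K_class p (fract_poly f) \<oplus>\<^bsub>K_quot p\<^esub> K_class p (fract_poly g) =
        K_class p (fract_poly (f + g))"
      using KQ.hom_mult[of "fract_poly f" "fract_poly g"] KQ.hom_add[of "fract_poly f" "fract_poly g"]
      by simp_all
    ultimately show "canonical_map p (x \<otimes>\<^bsub>D_quot p\<^esub> y) =
        canonical_map p x \<otimes>\<^bsub>D_int_closure_quot p\<^esub> canonical_map p y"
      "canonical_map p (x \<oplus>\<^bsub>D_quot p\<^esub> y) =
        canonical_map p x \<oplus>\<^bsub>D_int_closure_quot p\<^esub> canonical_map p y"
      unfolding x y canonical_map_class D_int_closure_quot_def by (simp_all add: canonical_map_class)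
  next
    have "\<one>\<^bsub>D_quot p\<^esub> = ?cl 1" using DQ.hom_one by simp
    moreover have "\<one>\<^bsub>K_quot p\<^esub> = K_class p (fract_poly 1)" using KQ.hom_one by simp
    ultimately show "canonical_map p \<one>\<^bsub>D_quot p\<^esub> = \<one>\<^bsub>D_int_closure_quot p\<^esub>"
      by (simp add: D_int_closure_quot_def canonical_map_class del: fract_poly_1)
  qed
  have inj: "inj_on (canonical_map p) (carrier (D_quot p))"
  proof (rule inj_onI)
    fix x y assume "x \<in> carrier (D_quot p)" "y \<in> carrier (D_quot p)"
    then obtain f g where x: "x = ?cl f" and y: "y = ?cl g" unfolding carrier_D by blast
    assume "canonical_map p x = canonical_map p y"
    then have "fract_poly p dvd fract_poly (f - g)"
      unfolding x y canonical_map_class K_class_eq_iff by simp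
    then show "x = y"
      unfolding fract_poly_dvd_iff[OF p] x y principal_coset principal_coset_eq_iff .
  qed
  have img: "canonical_map p ` carrier (D_quot p) = range (\<lambda>f. K_class p (fract_poly f))"
    unfolding carrier_D image_image canonical_map_class ..
  have "range (\<lambda>f. K_class p (fract_poly f)) \<subseteq> K_class p ` int_valued_at_roots p"
    by (rule image_subsetI) (rule imageI[OF fract_int])
  then have "canonical_map p ` carrier (D_quot p) = carrier (D_int_closure_quot p) \<longleftrightarrow>
      K_class p ` int_valued_at_roots p \<subseteq> range (\<lambda>f. K_class p (fract_poly f))"
    unfolding img carrier_K set_eq_subset by simp
  also have "\<dots> \<longleftrightarrow> (\<forall>f\<in>int_valued_at_roots p. \<exists>r. K_class p f = K_class p (fract_poly r))"
    unfolding image_subset_iff by (simp only: image_iff UNIV_I Bex_def simp_thms)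
  also have "\<dots> \<longleftrightarrow> int_valued_at_roots p \<subseteq> D_ring p"
    unfolding K_class_eq_iff subset_iff D_ring_iff Ball_def ..
  finally show ?thesis
    unfolding ring_iso_def bij_betw_def using hom inj by blast
qed

end

section \<open>Pruefer domains through pairs of elements\<close>

text \<open>
  An elementwise form of the statement that ideals generated by two elements are locally principal: the
  comaximal elements \<open>s\<close> and \<open>t\<close> are such that \<open>b\<close> generates \<open>(a, b)\<close> where \<open>s\<close> is inverted and \<open>a\<close>
  generates it where \<open>t\<close> is inverted. The relations are homogeneous in \<open>(a, b)\<close>, so common factors can be
  cancelled.
\<close>

definition pairs_locally_principal :: "'a::comm_ring_1 set \<Rightarrow> bool" where
  "pairs_locally_principal R \<longleftrightarrow>
     (\<forall>a\<in>R. \<forall>b\<in>R. \<exists>s\<in>R. \<exists>t\<in>R. \<exists>u\<in>R. \<exists>v\<in>R. s + t = 1 \<and> s * a = u * b \<and> t * b = v * a)"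

lemma pairs_locally_principalD:
  assumes "pairs_locally_principal R" "a \<in> R" "b \<in> R"
  obtains s t u v where "s \<in> R" "t \<in> R" "u \<in> R" "v \<in> R"
    "s + t = 1" "s * a = u * b" "t * b = v * a"
  using assms unfolding pairs_locally_principal_def by metis

text \<open>
  The step from two generators to finitely many: the coefficients \<open>c i\<close> sum to \<open>1\<close>, and \<open>f i\<close> generates
  the ideal of the family where \<open>c i\<close> is inverted. When a generator \<open>f x\<close> is added, splitting each \<open>c i\<close>
  as \<open>c i * t i + c i * s i\<close> by the relations of the pair \<open>f i, f x\<close> keeps the first part at \<open>i\<close> and
  moves the second part to \<open>x\<close>.
\<close>

lemma finite_families_locally_principal:
  fixes R :: "'a::comm_ring_1 set"
  assumes one: "1 \<in> R" and zero: "0 \<in> R"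
    and add: "\<And>x y. x \<in> R \<Longrightarrow> y \<in> R \<Longrightarrow> x + y \<in> R"
    and mult: "\<And>x y. x \<in> R \<Longrightarrow> y \<in> R \<Longrightarrow> x * y \<in> R"
    and pairs: "pairs_locally_principal R"
    and I: "finite I" "I \<noteq> {}" and f: "\<And>i. i \<in> I \<Longrightarrow> f i \<in> R"
  shows "\<exists>c. (\<forall>i\<in>I. c i \<in> R) \<and> (\<Sum>i\<in>I. c i) = 1 \<and>
    (\<forall>i\<in>I. \<forall>j\<in>I. \<exists>r\<in>R. c i * f j = r * f i)"
  using I f
proof (induction I rule: finite_ne_induct)
  case (singleton x)
  then show ?case using one by (intro exI[of _ "\<lambda>_. 1"]) (auto intro!: bexI[of _ 1])
next
  case (insert x A)
  have sum: "(\<Sum>i\<in>B. g i) \<in> R" if "\<And>i. i \<in> B \<Longrightarrow> g i \<in> R" for B :: "'b set" and g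
    using that by (induction B rule: infinite_finite_induct) (auto simp: zero add)
  have "\<exists>c. (\<forall>i\<in>A. c i \<in> R) \<and> (\<Sum>i\<in>A. c i) = 1 \<and>
    (\<forall>i\<in>A. \<forall>j\<in>A. \<exists>r\<in>R. c i * f j = r * f i)"
    by (rule insert.IH) (use insert.prems in simp)
  then obtain c where c': "\<forall>i\<in>A. c i \<in> R" and csum: "(\<Sum>i\<in>A. c i) = 1"
    and c: "\<forall>i\<in>A. \<forall>j\<in>A. \<exists>r\<in>R. c i * f j = r * f i"
    by iprover
  have cR: "c i \<in> R" if "i \<in> A" for i using c' that by (rule bspec)
  have "\<forall>i\<in>A. \<exists>s t u v. s \<in> R \<and> t \<in> R \<and> u \<in> R \<and> v \<in> R \<and>
      s + t = 1 \<and> s * f i = u * f x \<and> t * f x = v * f i"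
  proof
    fix i assume "i \<in> A"
    then have "f i \<in> R" "f x \<in> R" using insert.prems by auto
    from pairs_locally_principalD[OF pairs this]
    show "\<exists>s t u v. s \<in> R \<and> t \<in> R \<and> u \<in> R \<and> v \<in> R \<and>
      s + t = 1 \<and> s * f i = u * f x \<and> t * f x = v * f i" by metis
  qed
  from bchoice[OF this] obtain s where "\<forall>i\<in>A. \<exists>t u v. s i \<in> R \<and> t \<in> R \<and> u \<in> R \<and> v \<in> R \<and>
      s i + t = 1 \<and> s i * f i = u * f x \<and> t * f x = v * f i" ..
  from bchoice[OF this] obtain t where "\<forall>i\<in>A. \<exists>u v. s i \<in> R \<and> t i \<in> R \<and> u \<in> R \<and> v \<in> R \<and>
      s i + t i = 1 \<and> s i * f i = u * f x \<and> t i * f x = v * f i" ..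
  from bchoice[OF this] obtain u where "\<forall>i\<in>A. \<exists>v. s i \<in> R \<and> t i \<in> R \<and> u i \<in> R \<and> v \<in> R \<and>
      s i + t i = 1 \<and> s i * f i = u i * f x \<and> t i * f x = v * f i" ..
  from bchoice[OF this] obtain v where
    "\<forall>i\<in>A. s i \<in> R \<and> t i \<in> R \<and> u i \<in> R \<and> v i \<in> R \<and>
      s i + t i = 1 \<and> s i * f i = u i * f x \<and> t i * f x = v i * f i" ..
  then have stuv: "\<And>i. i \<in> A \<Longrightarrow> s i \<in> R" "\<And>i. i \<in> A \<Longrightarrow> t i \<in> R"
      "\<And>i. i \<in> A \<Longrightarrow> u i \<in> R" "\<And>i. i \<in> A \<Longrightarrow> v i \<in> R"
    and st: "\<And>i. i \<in> A \<Longrightarrow> s i + t i = 1"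
    and su: "\<And>i. i \<in> A \<Longrightarrow> s i * f i = u i * f x"
    and tv: "\<And>i. i \<in> A \<Longrightarrow> t i * f x = v i * f i"
    by simp_all
  \<comment> \<open>The share \<open>c j * s j\<close> of each old generator passes to \<open>x\<close>.\<close>
  define d where "d = (\<lambda>i. if i = x then (\<Sum>j\<in>A. c j * s j) else c i * t i)"
  have dx: "d x = (\<Sum>j\<in>A. c j * s j)" by (simp add: d_def)
  have dA: "d i = c i * t i" if "i \<in> A" for i using that insert.hyps by (auto simp: d_def)
  have "d i \<in> R" if "i \<in> insert x A" for i
    using that by (auto simp: dx dA intro!: sum mult cR stuv)
  moreover have "(\<Sum>i\<in>insert x A. d i) = 1"
  proof -
    have "(\<Sum>i\<in>insert x A. d i) = (\<Sum>j\<in>A. c j * s j) + (\<Sum>i\<in>A. c i * t i)"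
      using insert.hyps by (simp add: dx dA)
    also have "\<dots> = (\<Sum>i\<in>A. c i * (s i + t i))" by (simp add: sum.distrib distrib_left)
    finally show ?thesis using csum by (simp add: st)
  qed
  moreover have "\<exists>r\<in>R. d i * f j = r * f i" if ij: "i \<in> insert x A" "j \<in> insert x A" for i j
  proof -
    consider "i = x" "j = x" | "i = x" "j \<in> A" | "i \<in> A" "j = x" | "i \<in> A" "j \<in> A"
      using ij by blast
    then show ?thesis
    proof cases
      case 1
      have "d x \<in> R" by (auto simp: dx intro!: sum mult cR stuv)
      with 1 show ?thesis by blast
    next
      case 2
      have "\<forall>l\<in>A. \<exists>r. r \<in> R \<and> c l * f j = r * f l" using c 2 by blast
      then obtain r where r: "\<And>l. l \<in> A \<Longrightarrow> r l \<in> R" "\<And>l. l \<in> A \<Longrightarrow> c l * f j = r l * f l" by metis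
      have "d x * f j = (\<Sum>l\<in>A. s l * (c l * f j))"
        unfolding dx sum_distrib_right by (rule sum.cong) (auto simp: mult_ac)
      also have "\<dots> = (\<Sum>l\<in>A. r l * (s l * f l))"
        by (rule sum.cong) (auto simp: r(2) mult_ac)
      also have "\<dots> = (\<Sum>l\<in>A. r l * u l) * f x"
        unfolding sum_distrib_right by (rule sum.cong[OF refl]) (simp only: su mult.assoc)
      finally have "d i * f j = (\<Sum>l\<in>A. r l * u l) * f i" using 2 by simp
      moreover have "(\<Sum>l\<in>A. r l * u l) \<in> R" by (intro sum mult r(1) stuv)
      ultimately show ?thesis by blast
    next
      case 3
      have "d i * f j = c i * (t i * f x)" using 3 by (simp add: dA mult.assoc)
      also have "\<dots> = (c i * v i) * f i" using 3 by (simp add: tv mult.assoc)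
      finally show ?thesis using 3 cR stuv mult by blast
    next
      case 4
      obtain r where r: "r \<in> R" "c i * f j = r * f i" using c 4 by blast
      have "d i * f j = t i * (c i * f j)" using 4 by (simp add: dA mult_ac)
      also have "\<dots> = (t i * r) * f i" by (simp only: r(2) mult.assoc)
      finally show ?thesis using 4 r stuv mult by blast
    qed
  qed
  ultimately show ?case by blast
qed

text \<open>
  For \<open>x = a/b\<close> the relations read \<open>s x = u \<in> R\<close> and \<open>t = v x\<close>. Multiplying an integral equation of degree
  \<open>n\<close> by \<open>v^(n-1)\<close> gives \<open>t^(n-1) x \<in> R\<close>, and \<open>s + t = 1\<close> lowers the exponent of \<open>t\<close> to \<open>0\<close>.
\<close>

lemma pairs_locally_principal_imp_integrally_closed:
  fixes R :: "'l::field set"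
  assumes sub: "subdomain R ring_of_type_algebra"
    and quot: "\<And>x. \<exists>a\<in>R. \<exists>b\<in>R. b \<noteq> 0 \<and> x = a / b"
    and pairs: "pairs_locally_principal R"
  shows "integrally_closed_domain ring_of_type_algebra R"
proof -
  note R = subdomain_ring_of_typeD[OF sub]
  have pow: "x ^ n \<in> R" if "x \<in> R" for x and n :: nat using that R by (induction n) auto
  have "x \<in> R" if x: "x \<in> integral_closure ring_of_type_algebra R" for x
  proof -
    obtain n :: nat and r where r: "\<forall>i<n. r i \<in> R" and eq: "x ^ n + (\<Sum>i<n. r i * x ^ i) = 0"
      using x unfolding integral_closure_ring_of_type by blast
    obtain a b where ab: "a \<in> R" "b \<in> R" and b: "b \<noteq> 0" and xab: "x = a / b"
      using quot by blast
    obtain s t u v where stuv: "s \<in> R" "t \<in> R" "u \<in> R" "v \<in> R"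
      and eqs: "s + t = 1" "s * a = u * b" "t * b = v * a"
      using pairs_locally_principalD[OF pairs ab] by metis
    have sx: "s * x = u" and tx: "t = v * x" using eqs b by (simp_all add: xab field_simps)
    have n: "n > 0" using eq by (cases n) auto
    have sum: "(\<Sum>i<m. g i) \<in> R" if "\<And>i. i < m \<Longrightarrow> g i \<in> R" for m and g :: "nat \<Rightarrow> 'l"
      using that by (induction m) (auto intro: R)
    have "t ^ (n - 1) * x = v ^ (n - 1) * x ^ n"
      using n by (cases n) (simp_all add: tx power_mult_distrib)
    also have "x ^ n = - (\<Sum>i<n. r i * x ^ i)" using eq by (simp add: eq_neg_iff_add_eq_0)
    also have "v ^ (n - 1) * \<dots> = - (\<Sum>i<n. r i * (v ^ (n - 1 - i) * t ^ i))"
    proof -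
      have "v ^ (n - 1) * (r i * x ^ i) = r i * (v ^ (n - 1 - i) * t ^ i)" if "i < n" for i
      proof -
        have "v ^ (n - 1) = v ^ (n - 1 - i) * v ^ i" using that by (simp flip: power_add)
        then show ?thesis by (simp add: tx power_mult_distrib)
      qed
      then have "(\<Sum>i<n. v ^ (n - 1) * (r i * x ^ i)) = (\<Sum>i<n. r i * (v ^ (n - 1 - i) * t ^ i))"
        by (intro sum.cong refl) (simp only: lessThan_iff)
      then show ?thesis by (simp only: mult_minus_right sum_distrib_left)
    qed
    also have "\<dots> \<in> R" using r by (intro R(6) sum R(5) pow stuv) auto
    finally have "t ^ (n - 1) * x \<in> R" .
    moreover have "t ^ m * x \<in> R \<Longrightarrow> x \<in> R" for m
    proof (induction m)
      case (Suc m)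
      have "t ^ m * x = (s + t) * (t ^ m * x)" using eqs(1) by simp
      also have "\<dots> = t ^ m * (s * x) + t ^ Suc m * x" by (simp add: algebra_simps)
      also have "\<dots> \<in> R"
      proof (rule R(3)[OF _ Suc.prems])
        show "t ^ m * (s * x) \<in> R" unfolding sx by (intro R(5) pow stuv)
      qed
      finally show ?case by (rule Suc.IH)
    qed simp
    ultimately show ?thesis by blast
  qed
  moreover have "x \<in> integral_closure ring_of_type_algebra R" if "x \<in> R" for x
    unfolding integral_closure_ring_of_type
    using that R(6) by (intro CollectI exI[of _ 1] exI[of _ "\<lambda>_. - x"]) auto
  ultimately show ?thesis
    unfolding integrally_closed_domain_if_quotients_everything[OF sub quot] by blast
qed

lemma
  fixes R :: "'l::field set"
  assumes sub: "subdomain R ring_of_type_algebra"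
  shows ring_of_type_restrict_ring: "ring (ring_of_type_algebra\<lparr>carrier := R\<rparr>)"
    and ring_of_type_restrict_uminus:
      "x \<in> R \<Longrightarrow> \<ominus>\<^bsub>ring_of_type_algebra\<lparr>carrier := R\<rparr>\<^esub> x = - x"
proof -
  interpret F: Ring.field "ring_of_type_algebra :: 'l ring" by (rule field_from_type_algebra)
  interpret S: domain "ring_of_type_algebra\<lparr>carrier := R\<rparr>"
    by (rule F.subdomain_is_domain[OF sub])
  show "ring (ring_of_type_algebra\<lparr>carrier := R\<rparr>)" by (rule S.ring_axioms)
  show "x \<in> R \<Longrightarrow> \<ominus>\<^bsub>ring_of_type_algebra\<lparr>carrier := R\<rparr>\<^esub> x = - x"
    using subdomain_ring_of_typeD[OF sub] by (intro S.minus_equality) auto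
qed

lemma ideal_of_subdomainI:
  fixes R :: "'l::field set"
  assumes sub: "subdomain R ring_of_type_algebra"
    and J: "J \<subseteq> R" "0 \<in> J" "\<And>x y. x \<in> J \<Longrightarrow> y \<in> J \<Longrightarrow> x + y \<in> J"
    and scale: "\<And>r x. r \<in> R \<Longrightarrow> x \<in> J \<Longrightarrow> r * x \<in> J"
  shows "ideal J (ring_of_type_algebra\<lparr>carrier := R\<rparr>)"
proof (rule idealI[OF ring_of_type_restrict_ring[OF sub]])
  note R = subdomain_ring_of_typeD[OF sub]
  show "subgroup J (add_monoid (ring_of_type_algebra\<lparr>carrier := R\<rparr>))"
  proof
    fix x assume x: "x \<in> J"
    then have "inv\<^bsub>add_monoid (ring_of_type_algebra\<lparr>carrier := R\<rparr>)\<^esub> x = - x"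
      using ring_of_type_restrict_uminus[OF sub, of x] J(1) by (auto simp: a_inv_def)
    moreover have "- x \<in> J" using scale[of "- 1" x] x R by simp
    ultimately show "inv\<^bsub>add_monoid (ring_of_type_algebra\<lparr>carrier := R\<rparr>)\<^esub> x \<in> J" by simp
  qed (use J in auto)
next
  fix a x assume "a \<in> J" "x \<in> carrier (ring_of_type_algebra\<lparr>carrier := R\<rparr>)"
  then have "x * a \<in> J" using scale by simp
  then show "x \<otimes>\<^bsub>ring_of_type_algebra\<lparr>carrier := R\<rparr>\<^esub> a \<in> J"
    "a \<otimes>\<^bsub>ring_of_type_algebra\<lparr>carrier := R\<rparr>\<^esub> x \<in> J"
    by (simp_all add: mult.commute)
qed

lemma ideal_of_subdomainD:
  fixes R :: "'l::field set"
  assumes "ideal J (ring_of_type_algebra\<lparr>carrier := R\<rparr>)"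
  shows "J \<subseteq> R" "0 \<in> J" "\<And>r x. r \<in> R \<Longrightarrow> x \<in> J \<Longrightarrow> r * x \<in> J"
proof -
  interpret ideal J "ring_of_type_algebra\<lparr>carrier := R\<rparr>" by (rule assms)
  show "J \<subseteq> R" using a_subset by simp
  show "0 \<in> J" using additive_subgroup.zero_closed[OF additive_subgroup_axioms] by simp
  show "r * x \<in> J" if "r \<in> R" "x \<in> J" for r x using I_l_closed[of x r] that by simp
qed

lemma fractional_prod_subsetI:
  fixes I J T :: "'l::field set"
  assumes gen: "\<And>x y. x \<in> I \<Longrightarrow> y \<in> J \<Longrightarrow> x * y \<in> T"
    and T: "0 \<in> T" "\<And>x y. x \<in> T \<Longrightarrow> y \<in> T \<Longrightarrow> x + y \<in> T" "\<And>x. x \<in> T \<Longrightarrow> - x \<in> T"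
  shows "fractional_prod ring_of_type_algebra I J \<subseteq> T"
proof
  have uminus: "inv\<^bsub>add_monoid ring_of_type_algebra\<^esub> h = - h" for h :: 'l
    using ring_of_type_uminus[of h] by (simp add: a_inv_def)
  fix x assume "x \<in> fractional_prod ring_of_type_algebra I J"
  then have "x \<in> generate (add_monoid ring_of_type_algebra) (I <#>\<^bsub>ring_of_type_algebra\<^esub> J)"
    unfolding fractional_prod_def .
  then show "x \<in> T"
  proof (induction rule: generate.induct)
    case (inv h)
    then have "- h \<in> T" unfolding set_mult_def using gen T(3) by auto
    then show ?case unfolding uminus .
  qed (use gen T in \<open>auto simp: set_mult_def\<close>)
qed

lemma fractional_prod_sum_mem:
  fixes I J :: "'l::field set"
  assumes "finite A" "\<And>i. i \<in> A \<Longrightarrow> x i \<in> I" "\<And>i. i \<in> A \<Longrightarrow> y i \<in> J"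
  shows "(\<Sum>i\<in>A. x i * y i) \<in> fractional_prod ring_of_type_algebra I J"
  using assms
proof (induction A rule: finite_induct)
  case empty
  show ?case unfolding fractional_prod_def
    using generate.one[of "add_monoid (ring_of_type_algebra :: 'l ring)"] by simp
next
  case (insert a A)
  have "x a * y a \<in> I <#>\<^bsub>ring_of_type_algebra\<^esub> J"
    unfolding set_mult_def using insert.prems by auto
  from generate.eng[OF generate.incl[OF this], of "\<Sum>i\<in>A. x i * y i" "add_monoid ring_of_type_algebra"]
  show ?case using insert unfolding fractional_prod_def by simp
qed

text \<open>
  If \<open>I = (a, b)\<close> is invertible, then \<open>1 = a x + b y\<close> with \<open>x, y\<close> in the inverse of \<open>I\<close>, and \<open>s = b y\<close>,
  \<open>t = a x\<close> are as required. Conversely, for local generators \<open>i\<close> of \<open>I\<close> with coefficients \<open>c i\<close>, the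
  fractions \<open>c i / i\<close> lie in the inverse of \<open>I\<close> and \<open>\<Sum> i * (c i / i) = 1\<close>.
\<close>

lemma pruefer_domain_iff_pairs:
  fixes R :: "'l::field set"
  shows "pruefer_domain ring_of_type_algebra R \<longleftrightarrow>
    subdomain R ring_of_type_algebra \<and> pairs_locally_principal R"
proof (intro iffI conjI)
  assume pr: "pruefer_domain ring_of_type_algebra R"
  then show sub: "subdomain R ring_of_type_algebra" unfolding pruefer_domain_def by blast
  note R = subdomain_ring_of_typeD[OF sub]
  interpret S: ring "ring_of_type_algebra\<lparr>carrier := R\<rparr>" by (rule ring_of_type_restrict_ring[OF sub])
  show "pairs_locally_principal R" unfolding pairs_locally_principal_def
  proof (intro ballI)
    fix a b assume a: "a \<in> R" and b: "b \<in> R"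
    show "\<exists>s\<in>R. \<exists>t\<in>R. \<exists>u\<in>R. \<exists>v\<in>R. s + t = 1 \<and> s * a = u * b \<and> t * b = v * a"
    proof (cases "a = 0 \<and> b = 0")
      case True
      then show ?thesis using R(1,2) by (intro bexI[of _ 0] bexI[of _ 1]) auto
    next
      case False
      define I where "I = genideal (ring_of_type_algebra\<lparr>carrier := R\<rparr>) {a, b}"
      define J where "J = fractional_inverse ring_of_type_algebra R I"
      have abI: "a \<in> I" "b \<in> I"
        using S.genideal_self[of "{a, b}"] a b unfolding I_def by auto
      have "I \<noteq> {0}" using abI False by auto
      then have prod: "fractional_prod ring_of_type_algebra I J = R"
        using pr a b unfolding pruefer_domain_def J_def I_def
        by (auto simp: Let_def dest!: spec[of _ "{a, b}"])
      have Jmult: "x * y \<in> R" if "x \<in> J" "y \<in> I" for x y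
        using that unfolding J_def fractional_inverse_def by simp
      have "I \<subseteq> {r * a + r' * b | r r'. r \<in> R \<and> r' \<in> R}"
        unfolding I_def
      proof (rule S.genideal_minimal[OF ideal_of_subdomainI[OF sub]])
        show "{r * a + r' * b | r r'. r \<in> R \<and> r' \<in> R} \<subseteq> R" using R a b by auto
        show "0 \<in> {r * a + r' * b | r r'. r \<in> R \<and> r' \<in> R}"
          using R(1) by (intro CollectI exI[of _ 0]) simp
        show "{a, b} \<subseteq> {r * a + r' * b | r r'. r \<in> R \<and> r' \<in> R}"
        proof -
          have "a = 1 * a + 0 * b" "b = 0 * a + 1 * b" by simp_all
          then show ?thesis using R(1,2) by blast
        qed
      next
        fix x y assume "x \<in> {r * a + r' * b | r r'. r \<in> R \<and> r' \<in> R}"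
          "y \<in> {r * a + r' * b | r r'. r \<in> R \<and> r' \<in> R}"
        then obtain r r' q q' where "r \<in> R" "r' \<in> R" "q \<in> R" "q' \<in> R"
          and xy: "x = r * a + r' * b" "y = q * a + q' * b" by blast
        then have "r + q \<in> R" "r' + q' \<in> R" using R(3) by auto
        moreover have "x + y = (r + q) * a + (r' + q') * b" by (simp add: xy algebra_simps)
        ultimately show "x + y \<in> {r * a + r' * b | r r'. r \<in> R \<and> r' \<in> R}" by blast
      next
        fix q x assume q: "q \<in> R" and "x \<in> {r * a + r' * b | r r'. r \<in> R \<and> r' \<in> R}"
        then obtain r r' where "r \<in> R" "r' \<in> R" and x: "x = r * a + r' * b" by blast
        then have "q * r \<in> R" "q * r' \<in> R" using R(5) q by auto
        moreover have "q * x = (q * r) * a + (q * r') * b" by (simp add: x algebra_simps)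
        ultimately show "q * x \<in> {r * a + r' * b | r r'. r \<in> R \<and> r' \<in> R}" by blast
      qed
      note Isub = this
      \<comment> \<open>An additive group that contains all products of elements of \<open>I\<close> with elements of its inverse; the
        conditions on \<open>x\<close> and \<open>y\<close> say that both lie in the inverse.\<close>
      define T where "T = {a * x + b * y | x y. x * a \<in> R \<and> x * b \<in> R \<and> y * a \<in> R \<and> y * b \<in> R}"
      have "fractional_prod ring_of_type_algebra I J \<subseteq> T"
      proof (rule fractional_prod_subsetI)
        fix x y assume x: "x \<in> I" and y: "y \<in> J"
        obtain r r' where r: "r \<in> R" "r' \<in> R" and xr: "x = r * a + r' * b" using x Isub by blast
        have "y * a \<in> R" "y * b \<in> R" using Jmult[OF y] abI by auto
        then have "(r * y) * a \<in> R" "(r * y) * b \<in> R" "(r' * y) * a \<in> R" "(r' * y) * b \<in> R"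
          using R(5) r by (simp_all add: mult.assoc)
        moreover have "x * y = a * (r * y) + b * (r' * y)" by (simp add: xr algebra_simps)
        ultimately show "x * y \<in> T" unfolding T_def by blast
      next
        show "0 \<in> T" unfolding T_def using R(1) by (intro CollectI exI[of _ 0]) simp
      next
        fix x y assume "x \<in> T" "y \<in> T"
        then obtain x1 y1 x2 y2 where e: "x = a * x1 + b * y1" "y = a * x2 + b * y2"
          and m: "x1 * a \<in> R" "x1 * b \<in> R" "y1 * a \<in> R" "y1 * b \<in> R"
            "x2 * a \<in> R" "x2 * b \<in> R" "y2 * a \<in> R" "y2 * b \<in> R"
          unfolding T_def by blast
        have "x + y = a * (x1 + x2) + b * (y1 + y2)" by (simp add: e algebra_simps)
        moreover have "(x1 + x2) * a \<in> R" "(x1 + x2) * b \<in> R" "(y1 + y2) * a \<in> R" "(y1 + y2) * b \<in> R"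
          using m R(3) by (simp_all add: distrib_right)
        ultimately show "x + y \<in> T" unfolding T_def by blast
      next
        fix x assume "x \<in> T"
        then obtain x1 y1 where e: "x = a * x1 + b * y1"
          and m: "x1 * a \<in> R" "x1 * b \<in> R" "y1 * a \<in> R" "y1 * b \<in> R"
          unfolding T_def by blast
        have "- x = a * (- x1) + b * (- y1)" by (simp add: e)
        moreover have "(- x1) * a \<in> R" "(- x1) * b \<in> R" "(- y1) * a \<in> R" "(- y1) * b \<in> R"
          using m R(6) by simp_all
        ultimately show "- x \<in> T" unfolding T_def by blast
      qed
      then have "1 \<in> T" unfolding prod using R(2) by blast
      then obtain x y where e: "1 = a * x + b * y"
        and m: "x * a \<in> R" "x * b \<in> R" "y * a \<in> R" "y * b \<in> R" unfolding T_def by blast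
      show ?thesis
      proof (intro bexI conjI)
        show "y * b + x * a = 1" using e by (simp add: mult.commute add.commute)
        show "y * b * a = (y * a) * b" "x * a * b = (x * b) * a" by (simp_all add: mult_ac)
      qed (use m in auto)
    qed
  qed
next
  assume "subdomain R ring_of_type_algebra \<and> pairs_locally_principal R"
  then have sub: "subdomain R ring_of_type_algebra" and pairs: "pairs_locally_principal R" by auto
  note R = subdomain_ring_of_typeD[OF sub]
  interpret S: ring "ring_of_type_algebra\<lparr>carrier := R\<rparr>" by (rule ring_of_type_restrict_ring[OF sub])
  have "fractional_prod ring_of_type_algebra I (fractional_inverse ring_of_type_algebra R I) = R"
    if A: "finite A" "A \<subseteq> R" and I_def: "I = genideal (ring_of_type_algebra\<lparr>carrier := R\<rparr>) A"
      and I: "I \<noteq> {0}" for A I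
  proof
    define J where "J = fractional_inverse ring_of_type_algebra R I"
    have ideal: "ideal I (ring_of_type_algebra\<lparr>carrier := R\<rparr>)"
      unfolding I_def by (rule S.genideal_ideal) (use A in simp)
    note ID = ideal_of_subdomainD[OF ideal]
    have AI: "A \<subseteq> I" unfolding I_def by (rule S.genideal_self) (use A in simp)
    \<comment> \<open>The coefficients are divided by the generators, so zero generators are dropped.\<close>
    define B where "B = A - {0}"
    have B: "finite B" "B \<noteq> {}"
    proof -
      show "finite B" using A by (simp add: B_def)
      show "B \<noteq> {}"
      proof
        assume "B = {}"
        then have "A \<subseteq> {0}" by (auto simp: B_def)
        moreover have "ideal {0} (ring_of_type_algebra\<lparr>carrier := R\<rparr>)"
          by (rule ideal_of_subdomainI[OF sub]) (use R in auto)
        ultimately have "I \<subseteq> {0}" unfolding I_def by (intro S.genideal_minimal)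
        with I ID(2) show False by blast
      qed
    qed
    obtain c where cR: "\<forall>i\<in>B. c i \<in> R" and csum: "(\<Sum>i\<in>B. c i) = 1"
      and c: "\<forall>i\<in>B. \<forall>j\<in>B. \<exists>r\<in>R. c i * j = r * i"
      using finite_families_locally_principal[OF R(2,1,3,5) pairs B, of "\<lambda>i. i"] A
      by (auto simp: B_def)
    have inv: "c i / i \<in> J" if i: "i \<in> B" for i
    proof -
      have i0: "i \<noteq> 0" and iR: "i \<in> R" using i A by (auto simp: B_def)
      have "I \<subseteq> {y \<in> R. (c i / i) * y \<in> R}" unfolding I_def
      proof (rule S.genideal_minimal[OF ideal_of_subdomainI[OF sub]])
        show "A \<subseteq> {y \<in> R. (c i / i) * y \<in> R}"
        proof
          fix y assume y: "y \<in> A"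
          show "y \<in> {y \<in> R. (c i / i) * y \<in> R}"
          proof (cases "y = 0")
            case False
            then obtain r where "r \<in> R" "c i * y = r * i" using c i y by (auto simp: B_def)
            then have "(c i / i) * y = r" using i0 by (simp add: field_simps)
            with \<open>r \<in> R\<close> show ?thesis using y A by auto
          qed (use R in auto)
        qed
      next
        fix x y assume "x \<in> {y \<in> R. (c i / i) * y \<in> R}" "y \<in> {y \<in> R. (c i / i) * y \<in> R}"
        then show "x + y \<in> {y \<in> R. (c i / i) * y \<in> R}"
          using R(3) by (simp only: mem_Collect_eq distrib_left)
      next
        fix r x assume "r \<in> R" "x \<in> {y \<in> R. (c i / i) * y \<in> R}"
        then show "r * x \<in> {y \<in> R. (c i / i) * y \<in> R}"
          using R(5) by (simp only: mem_Collect_eq mult.left_commute[of _ r])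
      qed (use R in auto)
      moreover have "c i / i \<in> quot_field_in ring_of_type_algebra R"
        unfolding quot_field_in_ring_of_type using cR i i0 iR by blast
      ultimately show ?thesis unfolding J_def fractional_inverse_def by auto
    qed
    show "fractional_prod ring_of_type_algebra I (fractional_inverse ring_of_type_algebra R I) \<subseteq> R"
    proof (rule fractional_prod_subsetI)
      fix x y assume "x \<in> I" "y \<in> fractional_inverse ring_of_type_algebra R I"
      then show "x * y \<in> R" unfolding fractional_inverse_def by (simp add: mult.commute)
    qed (use R in auto)
    show "R \<subseteq> fractional_prod ring_of_type_algebra I (fractional_inverse ring_of_type_algebra R I)"
    proof
      fix r assume r: "r \<in> R"
      have "r * i * (c i / i) = r * c i" if "i \<in> B" for i
        using that by (auto simp: B_def)
      then have "(\<Sum>i\<in>B. r * i * (c i / i)) = r * (\<Sum>i\<in>B. c i)"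
        by (simp add: sum_distrib_left)
      then have "r = (\<Sum>i\<in>B. r * i * (c i / i))" using csum by simp
      also have "\<dots> \<in> fractional_prod ring_of_type_algebra I J"
        using r AI B(1) by (intro fractional_prod_sum_mem inv ID(3)) (auto simp: B_def)
      finally show "r \<in> fractional_prod ring_of_type_algebra I (fractional_inverse ring_of_type_algebra R I)"
        unfolding J_def .
    qed
  qed
  then show "pruefer_domain ring_of_type_algebra R"
    unfolding pruefer_domain_def Let_def using sub by simp
qed

lemma pairs_locally_principal_to_fract_image:
  fixes R :: "'a::idom set"
  shows "pairs_locally_principal (to_fract ` R) \<longleftrightarrow> pairs_locally_principal R"
proof -
  have sum: "to_fract s + to_fract t = 1 \<longleftrightarrow> s + t = 1" for s t :: 'a
    by (simp only: to_fract_add[symmetric] to_fract_1[symmetric] to_fract_eq_iff)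
  have prod: "to_fract s * to_fract a = to_fract u * to_fract b \<longleftrightarrow> s * a = u * b" for s a u b :: 'a
    by (simp only: to_fract_mult[symmetric] to_fract_eq_iff)
  show ?thesis unfolding pairs_locally_principal_def by (simp only: ball_simps bex_simps sum prod)
qed

section \<open>The Pruefer property of \<open>D(p)\<close>\<close>

context algebraic_closure_of_fractions
begin

lemma root_of_D_poly: "\<exists>g. g \<noteq> 0 \<and> ev (fract_poly g) y = 0"
proof -
  obtain f where f: "f \<noteq> 0" "ev f y = 0" using closure unfolding is_algebraic_closure_def by blast
  obtain d g where d: "d \<noteq> 0" and g: "fract_poly g = Polynomial.smult (to_fract d) f"
    using common_denominator by blast
  have "ev (fract_poly g) y = 0" unfolding g by (simp add: f(2))
  moreover have "g \<noteq> 0"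
  proof
    assume "g = 0"
    with g d f(1) show False by simp
  qed
  ultimately show ?thesis by blast
qed

text \<open>
  The Horner partial sums of \<open>h\<close> as polynomials over \<open>K\<close>. Their values at \<open>y\<close> are those treated in
  \<open>integral_horner_sum\<close>; as polynomials in \<open>y\<close> they can later be rewritten as polynomials in a root of \<open>p\<close>.
\<close>

definition horner :: "'d poly \<Rightarrow> nat \<Rightarrow> 'd fract poly" where
  "horner h k = (\<Sum>j\<in>{k..Polynomial.degree h}. Polynomial.monom (to_fract (Polynomial.coeff h j)) (j - k))"

lemma ev_horner:
  "ev (horner h k) y =
    (\<Sum>j\<in>{k..Polynomial.degree h}. \<iota> (to_fract (Polynomial.coeff h j)) * y ^ (j - k))"
  unfolding horner_def by (simp add: \<iota>_poly.hom_sum poly_sum poly_monom map_poly_hom_monom)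

lemma integral_ev_horner:
  assumes "ev (fract_poly h) y = 0"
  shows "D.integral (ev (horner h k) y)"
  unfolding ev_horner using D.integral_horner_sum[of h y k] assms
  unfolding map_poly_to_closure by blast

lemma ev_horner_Suc:
  "ev (horner h k) y = \<iota> (to_fract (Polynomial.coeff h k)) + y * ev (horner h (Suc k)) y"
proof (cases "k \<le> Polynomial.degree h")
  case True
  have "(\<Sum>j\<in>{Suc k..Polynomial.degree h}. \<iota> (to_fract (Polynomial.coeff h j)) * y ^ (j - k)) =
      (\<Sum>j\<in>{Suc k..Polynomial.degree h}. y * (\<iota> (to_fract (Polynomial.coeff h j)) * y ^ (j - Suc k)))"
  proof (rule sum.cong[OF refl])
    fix j assume "j \<in> {Suc k..Polynomial.degree h}"
    then have "j - k = Suc (j - Suc k)" by auto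
    then have "y ^ (j - k) = y * y ^ (j - Suc k)" by (simp only: power_Suc)
    then show "\<iota> (to_fract (Polynomial.coeff h j)) * y ^ (j - k) =
        y * (\<iota> (to_fract (Polynomial.coeff h j)) * y ^ (j - Suc k))"
      by (simp only: mult_ac)
  qed
  then show ?thesis
    unfolding ev_horner sum.atLeast_Suc_atMost[OF True] sum_distrib_left by simp
next
  case False
  then show ?thesis by (simp add: ev_horner coeff_eq_0)
qed

lemma ev_horner_0: "ev (horner h 0) y = ev (fract_poly h) y"
proof -
  have "ev (fract_poly h) y = (\<Sum>j\<le>Polynomial.degree h. \<iota> (to_fract (Polynomial.coeff h j)) * y ^ j)"
    by (simp add: poly_altdef)
  then show ?thesis unfolding ev_horner by (simp only: atLeast0AtMost diff_zero)
qed

text \<open>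
  The relations for the pair \<open>(y, 1)\<close> over the ring of integral elements, with \<open>t = y * ev V y\<close>. Take an
  equation \<open>g(y) = 0\<close> over \<open>D\<close>. Since the coefficients of \<open>g\<close> form a locally principal family, \<open>c k * g\<close> is
  divisible by the coefficient \<open>g_k\<close>; the quotient \<open>h k\<close> still has the root \<open>y\<close> and its \<open>k\<close>-th coefficient is
  \<open>c k\<close>. The Horner sums \<open>z_k\<close> of \<open>h k\<close> are integral and satisfy \<open>z_k = c k + y z_(k+1)\<close>. Summation over
  \<open>k\<close> gives \<open>S = 1 - y V\<close>, and \<open>y z_k\<close> is integral because it equals \<open>z_(k-1)\<close> minus a coefficient of \<open>h k\<close>;
  for \<open>k = 0\<close> it is \<open>0\<close>, as \<open>z_0 = h 0 (y)\<close>.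
\<close>

lemma pruefer_relations_at_element:
  assumes pairs: "pairs_locally_principal (UNIV :: 'd set)"
  shows "\<exists>S V. D.integral (ev S y) \<and> D.integral (ev V y) \<and>
    ev S y + y * ev V y = 1 \<and> D.integral (ev S y * y)"
proof -
  obtain g where g: "g \<noteq> 0" "ev (fract_poly g) y = 0" using root_of_D_poly by blast
  \<comment> \<open>Vanishing coefficients are left out so that \<open>g_k\<close> can be cancelled.\<close>
  define I where "I = {k. k \<le> Polynomial.degree g \<and> Polynomial.coeff g k \<noteq> 0}"
  have I: "finite I" "I \<noteq> {}" using g(1) by (auto simp: I_def intro!: exI[of _ "Polynomial.degree g"])
  have "\<exists>c. (\<forall>i\<in>I. c i \<in> (UNIV :: 'd set)) \<and> (\<Sum>i\<in>I. c i) = 1 \<and>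
    (\<forall>i\<in>I. \<forall>j\<in>I. \<exists>r\<in>UNIV. c i * Polynomial.coeff g j = r * Polynomial.coeff g i)"
    by (rule finite_families_locally_principal[OF _ _ _ _ pairs I]) simp_all
  then obtain c where csum: "(\<Sum>i\<in>I. c i) = 1"
    and "\<forall>i\<in>I. \<forall>j\<in>I. \<exists>r. c i * Polynomial.coeff g j = r * Polynomial.coeff g i" by auto
  then obtain r where r: "\<And>i j. i \<in> I \<Longrightarrow> j \<in> I \<Longrightarrow>
      c i * Polynomial.coeff g j = r i j * Polynomial.coeff g i"
    by metis
  define h where "h = (\<lambda>k. \<Sum>l\<in>I. Polynomial.monom (r k l) l)"
  have ch: "Polynomial.coeff (h k) l = (if l \<in> I then r k l else 0)" for k l
    unfolding h_def using I(1) by (auto simp: coeff_sum)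
  have hroot: "ev (fract_poly (h k)) y = 0" and hk: "Polynomial.coeff (h k) k = c k" if k: "k \<in> I" for k
  proof -
    have nz: "Polynomial.coeff g k \<noteq> 0" using k by (simp add: I_def)
    have "Polynomial.smult (Polynomial.coeff g k) (h k) = Polynomial.smult (c k) g"
    proof (rule poly_eqI)
      fix l
      show "Polynomial.coeff (Polynomial.smult (Polynomial.coeff g k) (h k)) l =
          Polynomial.coeff (Polynomial.smult (c k) g) l"
      proof (cases "l \<in> I")
        case True
        then show ?thesis using r[OF k True] by (simp add: ch mult.commute)
      next
        case False
        then have "Polynomial.coeff g l = 0" unfolding I_def using coeff_eq_0[of g l] by (cases "l \<le> Polynomial.degree g") auto
        then show ?thesis using False by (simp add: ch)
      qed
    qed
    then have "fract_poly (Polynomial.smult (Polynomial.coeff g k) (h k)) =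
        fract_poly (Polynomial.smult (c k) g)" by (rule arg_cong)
    then have "ev (fract_poly (Polynomial.smult (Polynomial.coeff g k) (h k))) y =
        ev (fract_poly (Polynomial.smult (c k) g)) y" by (rule arg_cong)
    then show "ev (fract_poly (h k)) y = 0" using g(2) nz by simp
    have "c k * Polynomial.coeff g k = r k k * Polynomial.coeff g k" by (rule r[OF k k])
    then show "Polynomial.coeff (h k) k = c k" using nz k by (simp add: ch)
  qed
  define S where "S = (\<Sum>k\<in>I. horner (h k) k)"
  define V where "V = - (\<Sum>k\<in>I. horner (h k) (Suc k))"
  have evS: "ev S y = (\<Sum>k\<in>I. ev (horner (h k) k) y)"
    unfolding S_def by (simp add: \<iota>_poly.hom_sum poly_sum)
  have evV: "ev V y = - (\<Sum>k\<in>I. ev (horner (h k) (Suc k)) y)"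
    unfolding V_def by (simp add: \<iota>_poly.hom_sum \<iota>_poly.hom_uminus poly_sum)
  have "D.integral (ev S y)" unfolding evS
    by (intro D.integral_sum integral_ev_horner hroot)
  moreover have "D.integral (ev V y)" unfolding evV
    by (intro D.integral_uminus D.integral_sum integral_ev_horner hroot)
  moreover have "ev S y + y * ev V y = 1"
  proof -
    have "ev S y = (\<Sum>k\<in>I. \<iota> (to_fract (c k)) + y * ev (horner (h k) (Suc k)) y)"
      unfolding evS
    proof (rule sum.cong[OF refl])
      fix k assume "k \<in> I"
      show "ev (horner (h k) k) y = \<iota> (to_fract (c k)) + y * ev (horner (h k) (Suc k)) y"
        using ev_horner_Suc[of "h k" k y] unfolding hk[OF \<open>k \<in> I\<close>] .
    qed
    also have "\<dots> = \<iota> (to_fract (\<Sum>k\<in>I. c k)) + y * (\<Sum>k\<in>I. ev (horner (h k) (Suc k)) y)"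
      by (simp only: sum.distrib sum_distrib_left D.hom_sum)
    finally show ?thesis unfolding csum evV by simp
  qed
  moreover have "D.integral (ev S y * y)"
  proof -
    have "D.integral (ev (horner (h k) k) y * y)" if k: "k \<in> I" for k
    proof (cases k)
      case 0
      then show ?thesis using hroot[OF k] by (simp add: ev_horner_0)
    next
      case (Suc j)
      have "ev (horner (h k) k) y * y = ev (horner (h k) j) y - \<iota> (to_fract (Polynomial.coeff (h k) j))"
        unfolding Suc using ev_horner_Suc[of "h (Suc j)" j y] by (simp add: mult.commute)
      then show ?thesis
        using D.integral_diff[OF integral_ev_horner[OF hroot[OF k]] D.integral_hom] by simp
    qed
    then show ?thesis unfolding evS sum_distrib_right by (intro D.integral_sum)
  qed
  ultimately show ?thesis by blast
qed

text \<open>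
  The roots of an irreducible polynomial are conjugate: an equation of the value at one root holds at all.
\<close>

lemma int_valued_if_integral_at_root:
  assumes irr: "Factorial_Ring.irreducible (fract_poly P)"
    and root: "ev (fract_poly P) \<alpha> = 0" and int: "D.integral (ev f \<alpha>)"
  shows "f \<in> int_valued_at_roots P"
proof -
  obtain G where G: "Polynomial.lead_coeff G = 1" "ev (fract_poly G) (ev f \<alpha>) = 0"
    using int unfolding D_integral_iff by blast
  have "fract_poly P dvd fract_poly G \<circ>\<^sub>p f"
    by (rule irreducible_dvd_if_common_root[OF irr root]) (simp only: ev_pcompose G(2))
  then show ?thesis by (rule int_valued_if_monic_equation_mod[OF G(1)])
qed

lemma integral_at_root_imp_D_value:
  assumes irr: "Factorial_Ring.irreducible (fract_poly P)"
    and root: "ev (fract_poly P) \<alpha> = 0" and int: "D.integral (ev f \<alpha>)"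
    and closed: "int_valued_at_roots P \<subseteq> D_ring P"
  shows "\<exists>r. ev (fract_poly r) \<alpha> = ev f \<alpha>"
proof -
  have "f \<in> D_ring P" using int_valued_if_integral_at_root[OF irr root int] closed by blast
  then obtain r q where "f = fract_poly r + fract_poly P * q" unfolding D_ring_def by blast
  then have "ev f \<alpha> = ev (fract_poly r) \<alpha>" using root by simp
  then show ?thesis by metis
qed

text \<open>
  The residue field of an irreducible \<open>P\<close> embeds into the algebraic closure by evaluation at a root
  \<open>\<alpha>\<close>. If \<open>b(\<alpha>) \<noteq> 0\<close>, the ratio \<open>y = a(\<alpha>)/b(\<alpha>)\<close> is itself the value of a polynomial \<open>w\<close>, so the
  integral elements that occur in the relations for \<open>y\<close> are values of polynomials and hence, by
  assumption, values of polynomials over \<open>D\<close>.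
\<close>

lemma pruefer_relations_mod_irreducible:
  fixes P :: "'d poly"
  assumes pairs: "pairs_locally_principal (UNIV :: 'd set)"
    and irr: "Factorial_Ring.irreducible (fract_poly P)"
    and closed: "int_valued_at_roots P \<subseteq> D_ring P"
  shows "\<exists>s u v. fract_poly P dvd fract_poly s * a - fract_poly u * b \<and>
    fract_poly P dvd (1 - fract_poly s) * b - fract_poly v * a"
proof (cases "fract_poly P dvd b")
  case True
  then show ?thesis by (intro exI[of _ 0]) simp
next
  case False
  have "Polynomial.degree (fract_poly P) > 0" by (rule irreducible_field_poly_degree[OF irr])
  then obtain \<alpha> where root: "ev (fract_poly P) \<alpha> = 0" using exists_root by blast
  obtain m b' where b': "m * fract_poly P + b' * b = 1"
    using irreducible_field_poly_comaximal[OF irr False] unfolding comaximal_def by blast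
  then have "ev (m * fract_poly P + b' * b) \<alpha> = ev 1 \<alpha>" by (rule arg_cong)
  then have binv: "ev b' \<alpha> * ev b \<alpha> = 1" using root by simp
  \<comment> \<open>\<open>b'\<close> represents the inverse of \<open>b(\<alpha>)\<close>.\<close>
  define w where "w = a * b'"
  define y where "y = ev w \<alpha>"
  have yb: "y * ev b \<alpha> = ev a \<alpha>"
    using binv by (simp add: y_def w_def mult.assoc)
  obtain S V where S: "D.integral (ev S y)" and V: "D.integral (ev V y)"
    and SV: "ev S y + y * ev V y = 1" and Sy: "D.integral (ev S y * y)"
    using pruefer_relations_at_element[OF pairs, of y] by blast
  obtain s where s: "ev (fract_poly s) \<alpha> = ev S y"
    using integral_at_root_imp_D_value[OF irr root _ closed, of "S \<circ>\<^sub>p w"] S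
    unfolding ev_pcompose y_def by blast
  obtain v where v: "ev (fract_poly v) \<alpha> = ev V y"
    using integral_at_root_imp_D_value[OF irr root _ closed, of "V \<circ>\<^sub>p w"] V
    unfolding ev_pcompose y_def by blast
  have "ev (S \<circ>\<^sub>p w * w) \<alpha> = ev S y * y" by (simp add: ev_pcompose y_def)
  then obtain u where u: "ev (fract_poly u) \<alpha> = ev S y * y"
    using integral_at_root_imp_D_value[OF irr root _ closed, of "S \<circ>\<^sub>p w * w"] Sy by metis
  have "fract_poly P dvd fract_poly s * a - fract_poly u * b"
  proof (rule irreducible_dvd_if_common_root[OF irr root])
    show "ev (fract_poly s * a - fract_poly u * b) \<alpha> = 0"
      by (simp add: s u mult.assoc yb)
  qed
  moreover have "fract_poly P dvd (1 - fract_poly s) * b - fract_poly v * a"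
  proof (rule irreducible_dvd_if_common_root[OF irr root])
    have "ev ((1 - fract_poly s) * b - fract_poly v * a) \<alpha> =
        (1 - ev S y) * ev b \<alpha> - ev V y * (y * ev b \<alpha>)"
      by (simp add: s v yb)
    also have "\<dots> = (1 - (ev S y + y * ev V y)) * ev b \<alpha>" by (simp add: algebra_simps)
    finally show "ev ((1 - fract_poly s) * b - fract_poly v * a) \<alpha> = 0" unfolding SV by simp
  qed
  ultimately show ?thesis by blast
qed

end

text \<open>
  Turning congruences modulo \<open>q\<close> into equalities by adding multiples of \<open>q\<close>. With \<open>s a - u b = q w\<close> and
  \<open>(1 - s) b - v a = q z\<close>, the correction \<open>\<sigma>\<close> of \<open>s\<close> has to satisfy \<open>\<sigma> a = - w\<close> modulo \<open>b\<close> and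
  \<open>\<sigma> b = z\<close> modulo \<open>a\<close>, which is solvable since \<open>a\<close> and \<open>b\<close> are comaximal; \<open>\<mu>\<close> and \<open>\<nu>\<close> are the
  quotients.
\<close>

lemma correct_relations_mod:
  fixes a b q s u v :: "'a::comm_ring_1"
  assumes co: "comaximal a b" and su: "q dvd s * a - u * b" and tv: "q dvd (1 - s) * b - v * a"
  shows "\<exists>\<sigma> \<mu> \<nu>. (s + q * \<sigma>) * a = (u + q * \<mu>) * b \<and>
    (1 - (s + q * \<sigma>)) * b = (v + q * \<nu>) * a"
proof -
  obtain x y where xy: "x * a + y * b = 1" using co unfolding comaximal_def by blast
  obtain w z where w: "s * a - u * b = q * w" and z: "(1 - s) * b - v * a = q * z"
    using su tv by (auto elim!: dvdE)
  \<comment> \<open>From \<open>x a + y b = 1\<close>: \<open>x a\<close> is \<open>1\<close> modulo \<open>b\<close> and \<open>y b\<close> is \<open>1\<close> modulo \<open>a\<close>.\<close>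
  define \<sigma> where "\<sigma> = z * y * y * b - w * x * x * a"
  define \<mu> where "\<mu> = w * (2 * y - y * y * b) + z * y * y * a"
  define \<nu> where "\<nu> = z * (2 * x - x * x * a) + w * x * x * b"
  have xa: "x * a = 1 - y * b" using xy by (simp add: algebra_simps)
  have yb: "y * b = 1 - x * a" using xy by (simp add: algebra_simps)
  have "w + \<sigma> * a = w - w * ((x * a) * (x * a)) + z * y * y * a * b"
    by (simp add: \<sigma>_def algebra_simps)
  also have "\<dots> = \<mu> * b" unfolding xa by (simp add: \<mu>_def algebra_simps)
  finally have sa: "w + \<sigma> * a = \<mu> * b" .
  have "z - \<sigma> * b = z - z * ((y * b) * (y * b)) + w * x * x * a * b"
    by (simp add: \<sigma>_def algebra_simps)
  also have "\<dots> = \<nu> * a" unfolding yb by (simp add: \<nu>_def algebra_simps)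
  finally have tb: "z - \<sigma> * b = \<nu> * a" .
  have "(s + q * \<sigma>) * a - (u + q * \<mu>) * b = (s * a - u * b) + q * (\<sigma> * a - \<mu> * b)"
    by (simp add: algebra_simps)
  also have "\<dots> = q * (w + \<sigma> * a - \<mu> * b)" unfolding w by (simp add: algebra_simps)
  also have "\<dots> = 0" unfolding sa by simp
  finally have 1: "(s + q * \<sigma>) * a = (u + q * \<mu>) * b" by simp
  have "(1 - (s + q * \<sigma>)) * b - (v + q * \<nu>) * a = ((1 - s) * b - v * a) + q * (- \<sigma> * b - \<nu> * a)"
    by (simp add: algebra_simps)
  also have "\<dots> = q * (z - \<sigma> * b - \<nu> * a)" unfolding z by (simp add: algebra_simps)
  also have "\<dots> = 0" unfolding tb by simp
  finally have 2: "(1 - (s + q * \<sigma>)) * b = (v + q * \<nu>) * a" by simp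
  show ?thesis using 1 2 by blast
qed

context algebraic_closure_of_fractions
begin

text \<open>
  The arguments \<open>a, b\<close> are divided by a greatest common divisor in \<open>K[X]\<close>, which may lead out of \<open>D(p)\<close> but
  does not change the relations. The local relations at the factors of \<open>p\<close> are then glued and corrected.
\<close>

lemma pairs_locally_principal_D_ring:
  fixes P :: "nat \<Rightarrow> 'd poly"
  assumes pairs: "pairs_locally_principal (UNIV :: 'd set)"
    and I: "finite I"
    and irr: "\<And>i. i \<in> I \<Longrightarrow> Factorial_Ring.irreducible (fract_poly (P i))"
    and coK: "\<And>i j. i \<in> I \<Longrightarrow> j \<in> I \<Longrightarrow> i \<noteq> j \<Longrightarrow> comaximal (fract_poly (P i)) (fract_poly (P j))"
    and co: "\<And>i j. i \<in> I \<Longrightarrow> j \<in> I \<Longrightarrow> i \<noteq> j \<Longrightarrow> comaximal (P i) (P j)"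
    and closed: "\<And>i. i \<in> I \<Longrightarrow> int_valued_at_roots (P i) \<subseteq> D_ring (P i)"
  shows "pairs_locally_principal (D_ring (\<Prod>i\<in>I. P i))"
  unfolding pairs_locally_principal_def
proof (intro ballI)
  define p where "p = (\<Prod>i\<in>I. P i)"
  fix a b :: "'d fract poly"
  note R = D_ring_closed[where p = p]
  have add: "f + g \<in> D_ring p" if "f \<in> D_ring p" "g \<in> D_ring p" for f g
  proof -
    have "0 \<in> D_ring p" using R(4)[of 0] by simp
    then have "f - (0 - g) \<in> D_ring p" using that by (intro R(2))
    then show ?thesis by simp
  qed
  show "\<exists>s\<in>D_ring (\<Prod>i\<in>I. P i). \<exists>t\<in>D_ring (\<Prod>i\<in>I. P i). \<exists>u\<in>D_ring (\<Prod>i\<in>I. P i).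
    \<exists>v\<in>D_ring (\<Prod>i\<in>I. P i). s + t = 1 \<and> s * a = u * b \<and> t * b = v * a"
    unfolding p_def[symmetric]
  proof (cases "a = 0 \<and> b = 0")
    case True
    have "0 \<in> D_ring p" using R(4)[of 0] by simp
    then show "\<exists>s\<in>D_ring p. \<exists>t\<in>D_ring p. \<exists>u\<in>D_ring p. \<exists>v\<in>D_ring p.
        s + t = 1 \<and> s * a = u * b \<and> t * b = v * a"
      using R(1) True by (intro bexI[of _ 0] bexI[of _ 1]) auto
  next
    case False
    obtain x y where "(x * a + y * b) dvd a" "(x * a + y * b) dvd b"
      using field_poly_bezout by blast
    then obtain a' b' where ab: "a = (x * a + y * b) * a'" "b = (x * a + y * b) * b'" by blast
    define g where "g = x * a + y * b"
    have ag: "a = g * a'" unfolding g_def by (rule ab(1))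
    have bg: "b = g * b'" unfolding g_def by (rule ab(2))
    have "g \<noteq> 0"
    proof
      assume "g = 0"
      then have "g * a' = 0" "g * b' = 0" by simp_all
      with False show False unfolding ag[symmetric] bg[symmetric] by simp
    qed
    have "g * (x * a' + y * b') = x * (g * a') + y * (g * b')" by (simp add: algebra_simps)
    also have "\<dots> = g * 1" unfolding ag[symmetric] bg[symmetric] by (simp add: g_def)
    finally have "x * a' + y * b' = 1" using \<open>g \<noteq> 0\<close> by (simp only: mult_cancel_left) simp
    then have coab: "comaximal a' b'" by (rule comaximalI)
    have "\<forall>i\<in>I. \<exists>s u v. fract_poly (P i) dvd fract_poly s * a' - fract_poly u * b' \<and>
        fract_poly (P i) dvd (1 - fract_poly s) * b' - fract_poly v * a'"
      using pruefer_relations_mod_irreducible[OF pairs irr closed] by blast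
    from bchoice[OF this] obtain s where
      "\<forall>i\<in>I. \<exists>u v. fract_poly (P i) dvd fract_poly (s i) * a' - fract_poly u * b' \<and>
        fract_poly (P i) dvd (1 - fract_poly (s i)) * b' - fract_poly v * a'" ..
    from bchoice[OF this] obtain u where
      "\<forall>i\<in>I. \<exists>v. fract_poly (P i) dvd fract_poly (s i) * a' - fract_poly (u i) * b' \<and>
        fract_poly (P i) dvd (1 - fract_poly (s i)) * b' - fract_poly v * a'" ..
    from bchoice[OF this] obtain v where
      suv: "\<forall>i\<in>I. fract_poly (P i) dvd fract_poly (s i) * a' - fract_poly (u i) * b' \<and>
        fract_poly (P i) dvd (1 - fract_poly (s i)) * b' - fract_poly (v i) * a'" ..
    have crt: "\<exists>x. \<forall>i\<in>I. P i dvd x - r i" for r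
      by (rule chinese_remainder_comaximal[OF I]) (rule co)
    obtain S where S: "\<forall>i\<in>I. P i dvd S - s i" using crt ..
    obtain U where U: "\<forall>i\<in>I. P i dvd U - u i" using crt ..
    obtain V where V: "\<forall>i\<in>I. P i dvd V - v i" using crt ..
    have dvd: "fract_poly (P i) dvd fract_poly S * a' - fract_poly U * b'"
      "fract_poly (P i) dvd (1 - fract_poly S) * b' - fract_poly V * a'" if i: "i \<in> I" for i
    proof -
      have dS: "fract_poly (P i) dvd fract_poly (S - s i)"
        and dU: "fract_poly (P i) dvd fract_poly (U - u i)"
        and dV: "fract_poly (P i) dvd fract_poly (V - v i)"
        using S U V i fract_poly_dvd by blast+
      have "fract_poly S * a' - fract_poly U * b' = (fract_poly (s i) * a' - fract_poly (u i) * b') +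
          (fract_poly (S - s i) * a' - fract_poly (U - u i) * b')" by (simp add: algebra_simps)
      then show "fract_poly (P i) dvd fract_poly S * a' - fract_poly U * b'"
        using suv i dS dU by (metis dvd_add dvd_diff dvd_mult2)
      have "(1 - fract_poly S) * b' - fract_poly V * a' = ((1 - fract_poly (s i)) * b' - fract_poly (v i) * a') -
          (fract_poly (S - s i) * b' + fract_poly (V - v i) * a')" by (simp add: algebra_simps)
      then show "fract_poly (P i) dvd (1 - fract_poly S) * b' - fract_poly V * a'"
        using suv i dS dV by (metis dvd_add dvd_diff dvd_mult2)
    qed
    have "fract_poly p dvd fract_poly S * a' - fract_poly U * b'"
      unfolding p_def fract_poly_prod
      by (rule prod_dvd_if_comaximal[OF I]) (rule coK, assumption+, rule dvd)
    moreover have "fract_poly p dvd (1 - fract_poly S) * b' - fract_poly V * a'"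
      unfolding p_def fract_poly_prod
      by (rule prod_dvd_if_comaximal[OF I]) (rule coK, assumption+, rule dvd)
    ultimately obtain \<sigma> \<mu> \<nu> where
      e1: "(fract_poly S + fract_poly p * \<sigma>) * a' = (fract_poly U + fract_poly p * \<mu>) * b'"
      and e2: "(1 - (fract_poly S + fract_poly p * \<sigma>)) * b' = (fract_poly V + fract_poly p * \<nu>) * a'"
      using correct_relations_mod[OF coab] by blast
    have mem: "fract_poly r + fract_poly p * q \<in> D_ring p" for r q
      by (intro add R)
    show "\<exists>s\<in>D_ring p. \<exists>t\<in>D_ring p. \<exists>u\<in>D_ring p. \<exists>v\<in>D_ring p.
        s + t = 1 \<and> s * a = u * b \<and> t * b = v * a"
    proof (intro bexI conjI)
      show "(fract_poly S + fract_poly p * \<sigma>) + (1 - (fract_poly S + fract_poly p * \<sigma>)) = 1" by simp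
      show "(fract_poly S + fract_poly p * \<sigma>) * a = (fract_poly U + fract_poly p * \<mu>) * b"
        unfolding ag bg using e1 by (metis mult.left_commute)
      show "(1 - (fract_poly S + fract_poly p * \<sigma>)) * b = (fract_poly V + fract_poly p * \<nu>) * a"
        unfolding ag bg using e2 by (metis mult.left_commute)
    qed (intro mem R(1) R(2))+
  qed
qed

lemma set_Omega:
  assumes "p \<noteq> 0"
  shows "\<alpha> \<in># Omega \<iota> p \<longleftrightarrow> ev (fract_poly p) \<alpha> = 0"
  unfolding Omega_def using assms by (subst set_count_proots) auto

lemma D_bar_eq: "D_bar \<iota> = {x. D.integral x}"
  unfolding D_bar_def by (rule D.integral_closure_range)

lemma Int_K_eq: "p \<noteq> 0 \<Longrightarrow> Int_K \<iota> (Omega \<iota> p) (D_bar \<iota>) = int_valued_at_roots p"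
  unfolding Int_K_def int_valued_at_roots_def D_bar_eq by (simp add: set_Omega Ball_def)

end

section \<open>The characterization\<close>

theorem theorem4p5:
  fixes \<iota> :: "'d::idom fract \<Rightarrow> 'c::alg_closed_field"
    and p :: "'d poly" and k :: nat and P :: "nat \<Rightarrow> 'd poly" and e :: "nat \<Rightarrow> nat"
  assumes D_closed: "integrally_closed_domain ring_of_type_algebra (range (to_fract :: 'd \<Rightarrow> 'd fract))"
    and D_not_field: "\<not> Ring.field (ring_of_type_algebra :: 'd ring)"
    and alg_closure: "is_algebraic_closure \<iota>"
    and p_monic: "Polynomial.lead_coeff p = 1"
    and p_nonconst: "Polynomial.degree p > 0"
    and P_monic: "\<And>i. i \<in> {1..k} \<Longrightarrow> Polynomial.lead_coeff (P i) = 1"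
    and P_irred: "\<And>i. i \<in> {1..k} \<Longrightarrow> Factorial_Ring.irreducible (P i)"
    and P_distinct: "inj_on P {1..k}"
    and e_pos: "\<And>i. i \<in> {1..k} \<Longrightarrow> e i \<ge> 1"
    and p_fact: "p = (\<Prod>i\<in>{1..k}. P i ^ e i)"
  shows "(integrally_closed_domain ring_of_type_algebra (to_fract ` D_ring p) \<longleftrightarrow>
           (\<forall>i\<in>{1..k}. e i = 1) \<and>
           (\<forall>i\<in>{1..k}. canonical_map (P i) \<in> ring_iso (D_quot (P i)) (D_int_closure_quot (P i))) \<and>
           (\<forall>i\<in>{1..k}. \<forall>j\<in>{1..k}. i \<noteq> j \<longrightarrow> resultant (P i) (P j) dvd 1))
       \<and> (pruefer_domain ring_of_type_algebra (range (to_fract :: 'd \<Rightarrow> 'd fract)) \<longrightarrow>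
           (integrally_closed_domain ring_of_type_algebra (to_fract ` D_ring p) \<longleftrightarrow>
            pruefer_domain ring_of_type_algebra (to_fract ` D_ring p)) \<and>
           (integrally_closed_domain ring_of_type_algebra (to_fract ` D_ring p) \<longrightarrow>
            D_ring p = Int_K \<iota> (Omega \<iota> p) (D_bar \<iota>)))"
proof -
  interpret C: algebraic_closure_of_fractions \<iota> by unfold_locales (rule alg_closure)
  let ?closed = "\<lambda>q. C.int_valued_at_roots q \<subseteq> D_ring q"
  have D_int: "x \<in> range to_fract" if "quotient_field.integral x" for x :: "'d fract"
    using D_closed that unfolding integrally_closed_range_to_fract_iff by blast
  have irrK: "Factorial_Ring.irreducible (fract_poly (P i))" if "i \<in> {1..k}" for i
    by (rule C.irreducible_fract_poly[OF D_int P_monic[OF that] P_irred[OF that]])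
  have coK: "comaximal (fract_poly (P i)) (fract_poly (P j))"
    if i: "i \<in> {1..k}" and j: "j \<in> {1..k}" and "i \<noteq> j" for i j
  proof (rule C.monic_irreducibles_comaximal[OF D_int P_monic[OF i] P_irred[OF i] P_monic[OF j] P_irred[OF j]])
    show "P i \<noteq> P j" using P_distinct that unfolding inj_on_def by blast
  qed
  have P_deg: "Polynomial.degree (P i) > 0" if "i \<in> {1..k}" for i
    using irreducible_field_poly_degree[OF irrK[OF that]] by (simp only: fract_poly_degree)
  have closed_iff: "integrally_closed_domain ring_of_type_algebra (to_fract ` D_ring p) \<longleftrightarrow> ?closed p"
    by (rule C.D_ring_integrally_closed_iff[OF p_monic p_nonconst])
  have closed_imp_e: "e i = 1" if closed: "?closed p" and i: "i \<in> {1..k}" for i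
  proof (rule ccontr)
    assume "e i \<noteq> 1"
    with e_pos[OF i] have "2 \<le> e i" by simp
    then have "P i * P i dvd P i ^ e i"
      using le_imp_power_dvd[of 2 "e i" "P i"] by (simp only: power2_eq_square)
    also have "P i ^ e i dvd p" unfolding p_fact using i by (intro dvd_prodI) auto
    finally have "d dvd 1" if "d \<noteq> 0" for d :: 'd
      using C.square_factor_imp_units[OF p_monic P_monic[OF i] P_deg[OF i] _ closed that] by blast
    then have "Ring.field (ring_of_type_algebra :: 'd ring)" by (rule field_ring_of_type_if_units)
    with D_not_field show False by contradiction
  qed
  have p_prod: "p = (\<Prod>i\<in>{1..k}. P i)" if "\<forall>i\<in>{1..k}. e i = 1"
    unfolding p_fact using that by (intro prod.cong) auto
  have closed_imp_co: "comaximal (P i) (P j)"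
    if closed: "?closed p" and "i \<in> {1..k}" "j \<in> {1..k}" "i \<noteq> j" for i j
  proof (rule C.closed_prod_imp_comaximal[of "{1..k}"])
    have "p = (\<Prod>i\<in>{1..k}. P i)" using p_prod closed_imp_e[OF closed] by blast
    with closed show "?closed (\<Prod>i\<in>{1..k}. P i)" by simp
  qed (use that coK P_monic in auto)
  have closed_imp_factor: "?closed (P i)" if closed: "?closed p" and i: "i \<in> {1..k}" for i
  proof (rule C.closed_prod_imp_closed_factor[of "{1..k}"])
    have "p = (\<Prod>i\<in>{1..k}. P i)" using p_prod closed_imp_e[OF closed] by blast
    with closed show "?closed (\<Prod>i\<in>{1..k}. P i)" by simp
  qed (use i coK in auto)
  have iso_iff: "canonical_map (P i) \<in> ring_iso (D_quot (P i)) (D_int_closure_quot (P i)) \<longleftrightarrow> ?closed (P i)"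
    if "i \<in> {1..k}" for i
    by (rule C.canonical_map_iso_iff[OF P_monic[OF that]])
  have res_iff: "resultant (P i) (P j) dvd 1 \<longleftrightarrow> comaximal (P i) (P j)" if "i \<in> {1..k}" for i j
    using resultant_unit_imp_comaximal[OF _ P_deg[OF that]]
      comaximal_imp_resultant_unit[OF P_monic[OF that]] by blast
  have closed_if: "?closed p"
    if e: "\<forall>i\<in>{1..k}. e i = 1" and cl: "\<And>i. i \<in> {1..k} \<Longrightarrow> ?closed (P i)"
      and co: "\<And>i j. i \<in> {1..k} \<Longrightarrow> j \<in> {1..k} \<Longrightarrow> i \<noteq> j \<Longrightarrow> comaximal (P i) (P j)"
    unfolding p_prod[OF e] by (rule C.closed_prod_if_closed_factors[OF _ coK co cl]) auto
  have "?closed p \<longleftrightarrow> (\<forall>i\<in>{1..k}. e i = 1) \<and>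
      (\<forall>i\<in>{1..k}. canonical_map (P i) \<in> ring_iso (D_quot (P i)) (D_int_closure_quot (P i))) \<and>
      (\<forall>i\<in>{1..k}. \<forall>j\<in>{1..k}. i \<noteq> j \<longrightarrow> resultant (P i) (P j) dvd 1)"
    (is "_ \<longleftrightarrow> ?conditions")
  proof
    assume closed: "?closed p"
    show ?conditions
      using closed_imp_e[OF closed] iso_iff closed_imp_factor[OF closed]
        res_iff closed_imp_co[OF closed] by blast
  next
    assume ?conditions
    then show "?closed p" using iso_iff res_iff by (intro closed_if) blast+
  qed
  moreover have "?closed p \<longleftrightarrow> pruefer_domain ring_of_type_algebra (to_fract ` D_ring p)"
    if D_pruefer: "pruefer_domain ring_of_type_algebra (range (to_fract :: 'd \<Rightarrow> 'd fract))"
  proof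
    assume closed: "?closed p"
    have pairs: "pairs_locally_principal (UNIV :: 'd set)"
      using D_pruefer unfolding pruefer_domain_iff_pairs pairs_locally_principal_to_fract_image by blast
    have "p = (\<Prod>i\<in>{1..k}. P i)" using p_prod closed_imp_e[OF closed] by blast
    moreover have "pairs_locally_principal (D_ring (\<Prod>i\<in>{1..k}. P i))"
      by (rule C.pairs_locally_principal_D_ring[OF pairs _ irrK coK closed_imp_co[OF closed]
            closed_imp_factor[OF closed]]) auto
    ultimately show "pruefer_domain ring_of_type_algebra (to_fract ` D_ring p)"
      unfolding pruefer_domain_iff_pairs pairs_locally_principal_to_fract_image
      using subdomain_D_ring by simp
  next
    assume "pruefer_domain ring_of_type_algebra (to_fract ` D_ring p)"
    then have "pairs_locally_principal (to_fract ` D_ring p)"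
      unfolding pruefer_domain_iff_pairs by blast
    moreover have "p \<noteq> 0" using p_nonconst by auto
    ultimately have "integrally_closed_domain ring_of_type_algebra (to_fract ` D_ring p)"
      using pairs_locally_principal_imp_integrally_closed[OF subdomain_D_ring D_ring_quotients] by blast
    then show "?closed p" unfolding closed_iff .
  qed
  moreover have "D_ring p = Int_K \<iota> (Omega \<iota> p) (D_bar \<iota>)" if "?closed p"
  proof -
    have "p \<noteq> 0" using p_nonconst by auto
    from C.D_ring_subset_int_valued[OF p_monic] that have "D_ring p = C.int_valued_at_roots p"
      by (rule equalityI)
    also have "\<dots> = Int_K \<iota> (Omega \<iota> p) (D_bar \<iota>)"
      using C.Int_K_eq[OF \<open>p \<noteq> 0\<close>] by (rule sym)
    finally show ?thesis .
  qed
  ultimately show ?thesis unfolding closed_iff by blast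
qed

end
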